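(* Assume (V), (N1)--(N3), (F0)--(F3) (listed in the context), and let $\omega>0$. Suppose that $V(x)=\omega^2\varepsilon(x)$ and $f(u)=\omega^2\chi\big(\tfrac12|u|^2\big)u$ for $u\in\mathbb{R}^6$, with $\varepsilon\colon\mathbb{R}^2\to\mathbb{R}$ and $\chi\colon[0,\infty)\to\mathbb{R}$. Let $u=\begin{pmatrix}U\\\widetilde U\end{pmatrix}\in X$ be a critical point of $J$ and let $$E(x_1,x_2,x_3,t)=U(x_1,x_2)\cos(kx_3+\omega t)+\widetilde U(x_1,x_2)\sin(kx_3+\omega t),$$ $$D=\varepsilon E+\chi\big(\langle|E|^2\rangle\big)E,\qquad B=H=-\frac1\omega\nabla\times\big(U\sin(kx_3+\omega t)-\widetilde U\cos(kx_3+\omega t)\big).$$ Then the total electromagnetic energy per unit interval on the $x_3$-axis is finite, i.e. for all $t,a\in\mathbb{R}$, $$\mathcal{L}(t):=\frac12\int_{\mathbb{R}^2}\int_a^{a+1}\langle E,D\rangle+\langle B,H\rangle\,dx_3\,d(x_1,x_2)<+\infty .$$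
   Context: Fix $k\in\mathbb{R}\setminus\{0\}$. $\langle\cdot,\cdot\rangle$ is the Euclidean inner product, $\langle\cdot,\cdot\rangle_2$ the inner product of $L^2(\mathbb{R}^2)^6$, $|\cdot|_q$ the $L^q$-norm. $\langle|E|^2\rangle=\frac1T\int_0^T|E|^2\,dt$ with $T=2\pi/\omega$ is the time average, so $\langle|E|^2\rangle=\frac12(|U|^2+|\widetilde U|^2)=\frac12|u|^2$. The field $B$ is determined from Faraday's law $\nabla\times E+\partial_tB=0$ by time integration; $\nabla\times$ is the usual curl in $\mathbb{R}^3$ (in the sense of distributions). A vector in $\mathbb{R}^6$ is written $u=\begin{pmatrix}U\\\widetilde U\end{pmatrix}$ with $U=(u_1,u_2,u_3)$, $\widetilde U=(\tilde u_1,\tilde u_2,\tilde u_3)$. Operators. For $\alpha,\tilde\alpha\colon\mathbb{R}^2\to\mathbb{R}$ and $\beta,\tilde\beta\colon\mathbb{R}^2\to\mathbb{R}^3$ (derivatives in the sense of distributions when necessary), $$\overset{\circ}{\nabla}\begin{pmatrix}\alpha\\\tilde\alpha\end{pmatrix}=(\partial_{x_1}\alpha,\ \partial_{x_2}\alpha,\ k\tilde\alpha,\ \partial_{x_1}\tilde\alpha,\ \partial_{x_2}\tilde\alpha,\ -k\alpha)^T,$$ $$\overset{\circ}{\nabla}\times\begin{pmatrix}\beta\\\tilde\beta\end{pmatrix}=(\partial_{x_2}\beta_3-k\tilde\beta_2,\ k\tilde\beta_1-\partial_{x_1}\beta_3,\ \partial_{x_1}\beta_2-\partial_{x_2}\beta_1,\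 \partial_{x_2}\tilde\beta_3+k\beta_2,\ -k\beta_1-\partial_{x_1}\tilde\beta_3,\ \partial_{x_1}\tilde\beta_2-\partial_{x_2}\tilde\beta_1)^T,$$ and $b_L(u,v)=\int_{\mathbb{R}^2}\langle\overset{\circ}{\nabla}\times u,\overset{\circ}{\nabla}\times v\rangle\,dx$ whenever $\overset{\circ}{\nabla}\times u,\overset{\circ}{\nabla}\times v\in L^2(\mathbb{R}^2)^6$. $N$-functions. $\Phi\colon\mathbb{R}\to[0,\infty)$ is an $N$-function if it is even, convex, $\lim_{t\to0}\Phi(t)/t=0$, $\lim_{t\to\infty}\Phi(t)/t=\infty$ and $\Phi(t)>0$ for $t>0$. It satisfies $\Delta_2$ globally if there is $K>0$ with $\Phi(2t)\le K\Phi(t)$ for all $t\in\mathbb{R}$; it satisfies $\nabla_2$ globally if there is $K'>1$ with $\Phi(K't)\ge 2K'\Phi(t)$ for all $t\in\mathbb{R}$. $L^\Phi:=\{u\colon\mathbb{R}^2\to\mathbb{R}^6:\Phi\circ|u|\in L^1(\mathbb{R}^2)\}$ with norm $|u|_\Phi:=\inf\{\alpha>0:\int_{\mathbb{R}^2}\Phi(|u|/\alpha)\,dx\le1\}$. Assumptions. There is an $N$-function $\Phi$ such that: (N1) $\Phi$ satisfies $\Delta_2$ and $\nabla_2$ globally; (N2) $\lim_{t\to0}\Phi(t)/t^2=0$; (N3) $\lim_{t\to\infty}\Phi(t)/t^2=\infty$. (V) $V\in L^\infty(\mathbb{R}^2)$ is radially symmetric, positive, bounded away from $0$, and $\operatorname{ess\,sup}V<k^2$.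 (F0) $F\colon\mathbb{R}^6\to\mathbb{R}$ is convex, nonnegative, of class $C^1$; $f:=F'$ denotes its gradient. (F1) $f(u)=o(|u|)$ as $u\to0$. (F2) There is $c_1>0$ with $|f(u)|\le c_1(1+\Phi'(|u|))$ for all $u\in\mathbb{R}^6$. (F3) There are $\gamma>2$ and $c_2>0$ with $\frac1\gamma\langle f(u),u\rangle\ge F(u)\ge c_2\Phi(|u|)$ for all $u\in\mathbb{R}^6$. Function spaces. $\mathcal{V}:=\{u\in H^1(\mathbb{R}^2)^6:\langle u,\overset{\circ}{\nabla}(\alpha,\tilde\alpha)^T\rangle_2=0\ \forall\alpha,\tilde\alpha\in C_0^\infty(\mathbb{R}^2)\}$ with norm $\|u\|=\big(\sum_{i=1}^3|\nabla u_i|_2^2+k^2|u_i|_2^2+|\nabla\tilde u_i|_2^2+k^2|\tilde u_i|_2^2\big)^{1/2}$; $\mathcal{W}\subset L^2(\mathbb{R}^2)^6\cap L^\Phi$ is the completion of $\{\overset{\circ}{\nabla}(\phi,\tilde\phi)^T:\phi,\tilde\phi\in C_0^\infty(\mathbb{R}^2)\}$ with respect to $\|w\|=(|w|_2^2+|w|_\Phi^2)^{1/2}$; $X:=\mathcal{V}\oplus\mathcal{W}$ with $\|v+w\|^2=\|v\|^2+\|w\|^2$. The functional $J\colon X\to\mathbb{R}$, of class $C^1$, is $$J(u)=\tfrac12b_L(u,u)-\tfrac12\int_{\mathbb{R}^2}V(x)|u|^2\,dx-\int_{\mathbb{R}^2}F(u)\,dx .$$ *)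

theory Defs
  imports
    "HOL-Analysis.Analysis"
    "HOL-Library.Landau_Symbols"
    "HOL-Probability.Essential_Supremum"
begin

text \<open>
  Elements of function spaces are represented by functions, not by classes modulo equality
  almost everywhere; every notion below is invariant under changes on null sets.
  A vector \<open>u = (U, U~)\<close> of \<open>\<real>\<^sup>6\<close> is a pair of vectors of \<open>\<real>\<^sup>3\<close>; the norm and the inner product
  of the product type are the Euclidean ones of \<open>\<real>\<^sup>6\<close>.
\<close>

type_synonym R2 = "real ^ 2"
type_synonym R3 = "real ^ 3"
type_synonym R6 = "R3 \<times> R3"


section \<open>Test functions and distributional derivatives\<close>

definition partial :: "'n::finite \<Rightarrow> (real ^ 'n \<Rightarrow> real) \<Rightarrow> real ^ 'n \<Rightarrow> real" where
  "partial i \<phi> x = frechet_derivative \<phi> (at x) (axis i 1)"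

definition smooth :: "(real ^ 'n::finite \<Rightarrow> real) \<Rightarrow> bool" where
  "smooth \<phi> \<longleftrightarrow> (\<forall>is :: 'n list. \<forall>x. foldr partial is \<phi> differentiable at x)"

definition test_fun :: "(real ^ 'n::finite \<Rightarrow> real) \<Rightarrow> bool" where
  "test_fun \<phi> \<longleftrightarrow> smooth \<phi> \<and> compact (closure {x. \<phi> x \<noteq> 0})"

definition loc_integrable ::
    "(real ^ 'n::finite \<Rightarrow> 'b::{banach, second_countable_topology}) \<Rightarrow> bool" where
  "loc_integrable g \<longleftrightarrow> (\<forall>K. compact K \<longrightarrow> set_integrable lebesgue K g)"

definition dist_of ::
    "(real ^ 'n::finite \<Rightarrow> 'b::{banach, second_countable_topology}) \<Rightarrow> (real ^ 'n \<Rightarrow> real) \<Rightarrow> 'b" where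
  "dist_of g \<phi> = (LINT x|lebesgue. \<phi> x *\<^sub>R g x)"

definition dpartial ::
    "'n::finite \<Rightarrow> (real ^ 'n \<Rightarrow> real) \<Rightarrow> (real ^ 'n \<Rightarrow> real) \<Rightarrow> real" where
  "dpartial i g \<phi> = - dist_of g (partial i \<phi>)"

text \<open>A (vector-valued) distribution \<open>T\<close> is given by the locally integrable function \<open>g\<close>.\<close>

definition represents ::
    "(real ^ 'n::finite \<Rightarrow> 'b::{banach, second_countable_topology}) \<Rightarrow>
      ((real ^ 'n \<Rightarrow> real) \<Rightarrow> 'b) \<Rightarrow> bool" where
  "represents g T \<longleftrightarrow> loc_integrable g \<and> (\<forall>\<phi>. test_fun \<phi> \<longrightarrow> dist_of g \<phi> = T \<phi>)"

definition dgrad :: "(R2 \<Rightarrow> real) \<Rightarrow> (R2 \<Rightarrow> real) \<Rightarrow> R2" where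
  "dgrad g \<phi> = (\<chi> i. dpartial i g \<phi>)"

definition weak_grad :: "(R2 \<Rightarrow> real) \<Rightarrow> R2 \<Rightarrow> R2" where
  "weak_grad g = (SOME G. represents G (dgrad g))"

definition dcurl :: "(R3 \<Rightarrow> R3) \<Rightarrow> (R3 \<Rightarrow> real) \<Rightarrow> R3" where
  "dcurl A \<phi> = (let d = (\<lambda>i j. dpartial i (\<lambda>x. A x $ j) \<phi>)
     in vector [d 2 3 - d 3 2, d 3 1 - d 1 3, d 1 2 - d 2 1])"

text \<open>The choice below is unique up to a null set, whenever a representing function exists.\<close>

definition weak_curl :: "(R3 \<Rightarrow> R3) \<Rightarrow> R3 \<Rightarrow> R3" where
  "weak_curl A = (SOME C. represents C (dcurl A))"


section \<open>The operators acting on functions of two variables\<close>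

definition ring_grad :: "real \<Rightarrow> (R2 \<Rightarrow> real) \<Rightarrow> (R2 \<Rightarrow> real) \<Rightarrow> R2 \<Rightarrow> R6" where
  "ring_grad k \<alpha> \<alpha>' x =
    (vector [partial 1 \<alpha> x, partial 2 \<alpha> x, k * \<alpha>' x],
     vector [partial 1 \<alpha>' x, partial 2 \<alpha>' x, - k * \<alpha> x])"

definition ring_dcurl :: "real \<Rightarrow> (R2 \<Rightarrow> R6) \<Rightarrow> (R2 \<Rightarrow> real) \<Rightarrow> R6" where
  "ring_dcurl k u \<phi> =
    (let b = (\<lambda>j. dist_of (\<lambda>x. fst (u x) $ j) \<phi>);
         b' = (\<lambda>j. dist_of (\<lambda>x. snd (u x) $ j) \<phi>);
         d = (\<lambda>i j. dpartial i (\<lambda>x. fst (u x) $ j) \<phi>);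
         d' = (\<lambda>i j. dpartial i (\<lambda>x. snd (u x) $ j) \<phi>)
     in (vector [d 2 3 - k * b' 2, k * b' 1 - d 1 3, d 1 2 - d 2 1],
         vector [d' 2 3 + k * b 2, - k * b 1 - d' 1 3, d' 1 2 - d' 2 1]))"

definition ring_curl :: "real \<Rightarrow> (R2 \<Rightarrow> R6) \<Rightarrow> R2 \<Rightarrow> R6" where
  "ring_curl k u = (SOME c. represents c (ring_dcurl k u))"

definition b_L :: "real \<Rightarrow> (R2 \<Rightarrow> R6) \<Rightarrow> (R2 \<Rightarrow> R6) \<Rightarrow> real" where
  "b_L k u v = (LINT x|lebesgue. ring_curl k u x \<bullet> ring_curl k v x)"


section \<open>N-functions and Orlicz spaces\<close>

definition N_function :: "(real \<Rightarrow> real) \<Rightarrow> bool" where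
  "N_function \<Phi> \<longleftrightarrow>
     (\<forall>t. \<Phi> t \<ge> 0) \<and> (\<forall>t. \<Phi> (- t) = \<Phi> t) \<and> convex_on UNIV \<Phi> \<and>
     ((\<lambda>t. \<Phi> t / t) \<longlongrightarrow> 0) (at 0) \<and> filterlim (\<lambda>t. \<Phi> t / t) at_top at_top \<and>
     (\<forall>t>0. \<Phi> t > 0)"

definition Delta2 :: "(real \<Rightarrow> real) \<Rightarrow> bool" where
  "Delta2 \<Phi> \<longleftrightarrow> (\<exists>K>0. \<forall>t. \<Phi> (2 * t) \<le> K * \<Phi> t)"

definition Nabla2 :: "(real \<Rightarrow> real) \<Rightarrow> bool" where
  "Nabla2 \<Phi> \<longleftrightarrow> (\<exists>K'>1. \<forall>t. \<Phi> (K' * t) \<ge> 2 * K' * \<Phi> t)"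

text \<open>
  A convex function need not be differentiable at every point, so \<open>\<Phi>'\<close> is read as the right
  derivative, which always exists and is the derivative wherever the latter exists.
\<close>

definition right_deriv :: "(real \<Rightarrow> real) \<Rightarrow> real \<Rightarrow> real" where
  "right_deriv \<Phi> t = Lim (at_right t) (\<lambda>s. (\<Phi> s - \<Phi> t) / (s - t))"

definition L2 :: "(R2 \<Rightarrow> 'b::euclidean_space) set" where
  "L2 = {u \<in> borel_measurable lebesgue. integrable lebesgue (\<lambda>x. (norm (u x))\<^sup>2)}"

definition L2_norm :: "(R2 \<Rightarrow> 'b::euclidean_space) \<Rightarrow> real" where
  "L2_norm u = sqrt (LINT x|lebesgue. (norm (u x))\<^sup>2)"

definition L_infty :: "(R2 \<Rightarrow> real) set" where
  "L_infty = {g \<in> borel_measurable lebesgue. \<exists>C. AE x in lebesgue. \<bar>g x\<bar> \<le> C}"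

definition L_Phi :: "(real \<Rightarrow> real) \<Rightarrow> (R2 \<Rightarrow> R6) set" where
  "L_Phi \<Phi> = {u \<in> borel_measurable lebesgue. integrable lebesgue (\<lambda>x. \<Phi> (norm (u x)))}"

definition Phi_norm :: "(real \<Rightarrow> real) \<Rightarrow> (R2 \<Rightarrow> R6) \<Rightarrow> real" where
  "Phi_norm \<Phi> u = Inf {\<alpha>. \<alpha> > 0 \<and> (\<integral>\<^sup>+x. ennreal (\<Phi> (norm (u x) / \<alpha>)) \<partial>lebesgue) \<le> 1}"


section \<open>The space of admissible fields and the functional\<close>

definition H1 :: "(R2 \<Rightarrow> real) set" where
  "H1 = {g \<in> L2. \<exists>G \<in> L2. represents G (dgrad g)}"

definition V_space :: "real \<Rightarrow> (R2 \<Rightarrow> R6) set" where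
  "V_space k = {u. (\<forall>j\<in>Basis. (\<lambda>x. u x \<bullet> j) \<in> H1) \<and>
     (\<forall>\<alpha> \<alpha>'. test_fun \<alpha> \<longrightarrow> test_fun \<alpha>' \<longrightarrow>
        (LINT x|lebesgue. u x \<bullet> ring_grad k \<alpha> \<alpha>' x) = 0)}"

definition V_norm :: "real \<Rightarrow> (R2 \<Rightarrow> R6) \<Rightarrow> real" where
  "V_norm k u = sqrt (\<Sum>j\<in>Basis. ((L2_norm (weak_grad (\<lambda>x. u x \<bullet> j)))\<^sup>2
     + k\<^sup>2 * (L2_norm (\<lambda>x. u x \<bullet> j))\<^sup>2))"

definition W_norm :: "(real \<Rightarrow> real) \<Rightarrow> (R2 \<Rightarrow> R6) \<Rightarrow> real" where
  "W_norm \<Phi> w = sqrt ((L2_norm w)\<^sup>2 + (Phi_norm \<Phi> w)\<^sup>2)"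

definition W_space :: "real \<Rightarrow> (real \<Rightarrow> real) \<Rightarrow> (R2 \<Rightarrow> R6) set" where
  "W_space k \<Phi> = {w \<in> L2 \<inter> L_Phi \<Phi>. \<exists>\<phi> \<phi>'. (\<forall>n::nat. test_fun (\<phi> n) \<and> test_fun (\<phi>' n)) \<and>
     (\<lambda>n. W_norm \<Phi> (\<lambda>x. ring_grad k (\<phi> n) (\<phi>' n) x - w x)) \<longlonglongrightarrow> 0}"

definition X_space :: "real \<Rightarrow> (real \<Rightarrow> real) \<Rightarrow> (R2 \<Rightarrow> R6) set" where
  "X_space k \<Phi> = {\<lambda>x. v x + w x | v w. v \<in> V_space k \<and> w \<in> W_space k \<Phi>}"

text \<open>The sum is direct modulo null sets, so the value does not depend on the choice.\<close>

definition X_norm :: "real \<Rightarrow> (real \<Rightarrow> real) \<Rightarrow> (R2 \<Rightarrow> R6) \<Rightarrow> real" where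
  "X_norm k \<Phi> u = (SOME r. \<exists>v\<in>V_space k. \<exists>w\<in>W_space k \<Phi>.
     u = (\<lambda>x. v x + w x) \<and> r = sqrt ((V_norm k v)\<^sup>2 + (W_norm \<Phi> w)\<^sup>2))"

definition J_functional :: "real \<Rightarrow> (R2 \<Rightarrow> real) \<Rightarrow> (R6 \<Rightarrow> real) \<Rightarrow> (R2 \<Rightarrow> R6) \<Rightarrow> real" where
  "J_functional k V F u = 1/2 * b_L k u u
     - 1/2 * (LINT x|lebesgue. V x * (norm (u x))\<^sup>2) - (LINT x|lebesgue. F (u x))"

text \<open>\<open>u \<in> X\<close> and the Frechet derivative of \<open>I\<close> at \<open>u\<close>, in the normed space \<open>X\<close>, is zero.\<close>

definition critical_point ::
    "real \<Rightarrow> (real \<Rightarrow> real) \<Rightarrow> ((R2 \<Rightarrow> R6) \<Rightarrow> real) \<Rightarrow> (R2 \<Rightarrow> R6) \<Rightarrow> bool" where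
  "critical_point k \<Phi> I u \<longleftrightarrow> u \<in> X_space k \<Phi> \<and>
     (\<forall>e>0. \<exists>d>0. \<forall>h\<in>X_space k \<Phi>. X_norm k \<Phi> h < d \<longrightarrow>
        \<bar>I (\<lambda>x. u x + h x) - I u\<bar> \<le> e * X_norm k \<Phi> h)"


section \<open>The electromagnetic fields\<close>

definition plane :: "R3 \<Rightarrow> R2" where
  "plane x = vector [x $ 1, x $ 2]"

definition E_field :: "real \<Rightarrow> real \<Rightarrow> (R2 \<Rightarrow> R6) \<Rightarrow> R3 \<Rightarrow> real \<Rightarrow> R3" where
  "E_field k \<omega> u x t = cos (k * x $ 3 + \<omega> * t) *\<^sub>R fst (u (plane x))
     + sin (k * x $ 3 + \<omega> * t) *\<^sub>R snd (u (plane x))"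

text \<open>The time primitive of \<open>E_field\<close> is \<open>A_field\<close> divided by \<open>\<omega>\<close>.\<close>

definition A_field :: "real \<Rightarrow> real \<Rightarrow> (R2 \<Rightarrow> R6) \<Rightarrow> R3 \<Rightarrow> real \<Rightarrow> R3" where
  "A_field k \<omega> u x t = sin (k * x $ 3 + \<omega> * t) *\<^sub>R fst (u (plane x))
     - cos (k * x $ 3 + \<omega> * t) *\<^sub>R snd (u (plane x))"

definition B_field :: "real \<Rightarrow> real \<Rightarrow> (R2 \<Rightarrow> R6) \<Rightarrow> R3 \<Rightarrow> real \<Rightarrow> R3" where
  "B_field k \<omega> u x t = - (1 / \<omega>) *\<^sub>R weak_curl (\<lambda>y. A_field k \<omega> u y t) x"

definition time_average :: "real \<Rightarrow> (real \<Rightarrow> real) \<Rightarrow> real" where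
  "time_average T g = 1 / T * (LINT t:{0..T}|lborel. g t)"

definition D_field :: "real \<Rightarrow> real \<Rightarrow> (R2 \<Rightarrow> real) \<Rightarrow> (real \<Rightarrow> real) \<Rightarrow>
    (R2 \<Rightarrow> R6) \<Rightarrow> R3 \<Rightarrow> real \<Rightarrow> R3" where
  "D_field k \<omega> \<epsilon> sus u x t = \<epsilon> (plane x) *\<^sub>R E_field k \<omega> u x t
     + sus (time_average (2 * pi / \<omega>) (\<lambda>s. (norm (E_field k \<omega> u x s))\<^sup>2)) *\<^sub>R E_field k \<omega> u x t"

definition energy_density :: "(R3 \<Rightarrow> real \<Rightarrow> R3) \<Rightarrow> (R3 \<Rightarrow> real \<Rightarrow> R3) \<Rightarrow>
    (R3 \<Rightarrow> real \<Rightarrow> R3) \<Rightarrow> (R3 \<Rightarrow> real \<Rightarrow> R3) \<Rightarrow> real \<Rightarrow> R3 \<Rightarrow> real" where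
  "energy_density E D B H t x = E x t \<bullet> D x t + B x t \<bullet> H x t"

text \<open>
  Negative values of the density would be cut off by \<open>ennreal\<close>; the definition is meant for
  measurable densities that are nonnegative almost everywhere.
\<close>

definition em_energy :: "(R3 \<Rightarrow> real \<Rightarrow> R3) \<Rightarrow> (R3 \<Rightarrow> real \<Rightarrow> R3) \<Rightarrow>
    (R3 \<Rightarrow> real \<Rightarrow> R3) \<Rightarrow> (R3 \<Rightarrow> real \<Rightarrow> R3) \<Rightarrow> real \<Rightarrow> real \<Rightarrow> ennreal" where
  "em_energy E D B H a t = 1/2 * (\<integral>\<^sup>+y. (\<integral>\<^sup>+z\<in>{a..a+1}.
     ennreal (energy_density E D B H t (vector [y $ 1, y $ 2, z])) \<partial>lebesgue) \<partial>(lebesgue :: R2 measure))"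

end

theory Submission
  imports Defs "HOL-Real_Asymp.Real_Asymp" "HOL-Computational_Algebra.Polynomial"
begin

text \<open>
  Criticality of \<open>u\<close> matters only through \<open>u \<in> X\<close>. Write \<open>u = v + w\<close> with \<open>v\<close> in \<open>\<V>\<close> and \<open>w\<close> in
  \<open>\<W>\<close>. The distributional ring curl annihilates ring gradients, hence \<open>w\<close>, so that of \<open>u\<close> is
  an \<open>L\<^sup>2\<close> function \<open>c = (C, C~)\<close> built from the weak gradients of \<open>v\<close>. By Fubini and an integration
  by parts in \<open>x\<^sub>3\<close>, \<open>sin (k x\<^sub>3 + \<omega> t) C - cos (k x\<^sub>3 + \<omega> t) C~\<close> represents the curl which defines
  \<open>B\<close>, and the fundamental lemma of the calculus of variations identifies it with the chosen
  representative; this bounds the magnetic energy by the integral of \<open>\<bar>c\<bar>\<^sup>2\<close>.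
  For the electric energy, the time average of \<open>\<bar>E\<bar>\<^sup>2\<close> is \<open>\<bar>u\<bar>\<^sup>2 / 2\<close>, so the density is at most
  \<open>\<epsilon> \<bar>u\<bar>\<^sup>2 + \<omega>\<^sup>-\<^sup>2 \<langle>f u, u\<rangle>\<close>, and the growth conditions bound \<open>\<langle>f u, u\<rangle>\<close> by a multiple of
  \<open>\<bar>u\<bar>\<^sup>2 + \<Phi> \<bar>u\<bar>\<close>. What remains is that \<open>H\<^sup>1(\<real>\<^sup>2)\<close> embeds into the Orlicz space of \<open>\<Phi>\<close>.
\<close>

section \<open>Test functions\<close>

text \<open>In the plane \<open>H1\<close> just fails to consist of bounded functions, and
  \<open>\<Phi>\<close> is not a power, so the embedding is proved for \<open>\<Phi>\<close>
  directly. Averages over squares suit this: halving the side changes an average by at most a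
  constant times the L2 norm of the gradient on the larger square, with no power of the side left
  over, while integrating over the position of the square gains the square of the side.
  \<open>Delta2\<close> allows \<open>\<Phi>\<close> of a sum of increments to be taken apart at the
  price of a geometric weight, and (N2) turns \<open>\<Phi>\<close> of a bounded increment into a
  multiple of its square. The magnetic part is shaped by \<open>weak_curl\<close> being a choice:
  nothing is known about it until a representing function is exhibited. The candidate is visible
  because the ring curl is the ordinary curl with the derivative in x3 carried out on the
  trigonometric factors; the time primitive of the electric field and its curl therefore have the
  same form, with u replaced by c.\<close>

lemma smooth_differentiable: "smooth \<phi> \<Longrightarrow> \<phi> differentiable at x"
  unfolding smooth_def by (drule spec[of _ "[]"]) simp

lemma smooth_partial:
  assumes "smooth \<phi>" shows "smooth (partial i \<phi>)"
  unfolding smooth_def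
proof (intro allI)
  fix js and x :: "real ^ 'a"
  have "foldr partial (js @ [i]) \<phi> differentiable at x"
    using assms unfolding smooth_def by blast
  then show "foldr partial js (partial i \<phi>) differentiable at x" by simp
qed

text \<open>\<open>smooth\<close> quantifies over all iterated partials, so it is the largest class
  of differentiable functions closed under partial differentiation. A proof of smoothness only has
  to exhibit some such class.\<close>

lemma smooth_coinduct:
  assumes "\<phi> \<in> S"
    and diff: "\<And>f x. f \<in> S \<Longrightarrow> f differentiable at x"
    and step: "\<And>f i. f \<in> S \<Longrightarrow> partial i f \<in> S"
  shows "smooth \<phi>"
proof -
  have "foldr partial js \<phi> \<in> S" for js
    by (induction js) (auto simp: assms)
  then show ?thesis unfolding smooth_def using diff by blast
qed

lemma has_derivative_imp_partial:
  "(f has_derivative D) (at x) \<Longrightarrow> partial i f x = D (axis i 1)"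
  unfolding partial_def by (simp add: frechet_derivative_at[symmetric])

lemma partial_add:
  assumes "f differentiable at x" "g differentiable at x"
  shows "partial i (\<lambda>x. f x + g x) x = partial i f x + partial i g x"
  using has_derivative_imp_partial[OF has_derivative_add[OF assms[unfolded frechet_derivative_works]]]
  unfolding partial_def by simp

lemma partial_mult:
  assumes "f differentiable at x" "g differentiable at x"
  shows "partial i (\<lambda>x. f x * g x) x = f x * partial i g x + partial i f x * g x"
  using has_derivative_imp_partial[OF has_derivative_mult[OF assms[unfolded frechet_derivative_works]]]
  unfolding partial_def by simp

lemma partial_const: "partial i (\<lambda>x. c) x = 0"
  by (rule has_derivative_imp_partial) simp

lemma smooth_const: "smooth (\<lambda>x. c)"
proof (rule smooth_coinduct[of _ "range (\<lambda>c x. c)"])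
  fix f :: "real ^ 'a \<Rightarrow> real" and i
  assume "f \<in> range (\<lambda>c x. c)"
  then obtain c where f: "f = (\<lambda>x. c)" by blast
  have "partial i f = (\<lambda>x. 0)" unfolding f partial_const ..
  then show "partial i f \<in> range (\<lambda>c x. c)" by blast
qed auto

text \<open>The Leibniz rule turns a product into a sum of two products, so closure under sums and
  under products has to be established together before \<open>smooth_coinduct\<close>
  applies.\<close>

inductive_set smooth_span :: "(real ^ 'n::finite \<Rightarrow> real) set" where
  base: "smooth f \<Longrightarrow> f \<in> smooth_span"
| add: "f \<in> smooth_span \<Longrightarrow> g \<in> smooth_span \<Longrightarrow> (\<lambda>x. f x + g x) \<in> smooth_span"
| mult: "f \<in> smooth_span \<Longrightarrow> g \<in> smooth_span \<Longrightarrow> (\<lambda>x. f x * g x) \<in> smooth_span"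

lemma smooth_span_differentiable: "f \<in> smooth_span \<Longrightarrow> f differentiable at x"
  by (induction rule: smooth_span.induct) (auto intro: smooth_differentiable)

lemma smooth_span_imp_smooth:
  assumes "\<phi> \<in> smooth_span" shows "smooth \<phi>"
proof (rule smooth_coinduct[OF assms smooth_span_differentiable])
  show "partial i f \<in> smooth_span" if "f \<in> smooth_span" for f :: "real ^ 'a \<Rightarrow> real" and i
    using that
  proof induction
    case (base f)
    then show ?case by (intro smooth_span.base smooth_partial)
  next
    case (add f g)
    have "partial i (\<lambda>x. f x + g x) = (\<lambda>x. partial i f x + partial i g x)"
      using add by (intro ext partial_add smooth_span_differentiable)
    then show ?case using smooth_span.add[OF add(3,4)] by simp
  next
    case (mult f g)
    have "partial i (\<lambda>x. f x * g x) = (\<lambda>x. f x * partial i g x + partial i f x * g x)"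
      using mult by (intro ext partial_mult smooth_span_differentiable)
    then show ?case
      using smooth_span.add[OF smooth_span.mult[OF mult(1) mult(4)] smooth_span.mult[OF mult(3) mult(2)]] by simp
  qed
qed

lemma smooth_add: "smooth f \<Longrightarrow> smooth g \<Longrightarrow> smooth (\<lambda>x. f x + g x)"
  by (rule smooth_span_imp_smooth[OF smooth_span.add[OF smooth_span.base smooth_span.base]])

lemma smooth_mult: "smooth f \<Longrightarrow> smooth g \<Longrightarrow> smooth (\<lambda>x. f x * g x)"
  by (rule smooth_span_imp_smooth[OF smooth_span.mult[OF smooth_span.base smooth_span.base]])

lemma smooth_prod: "(\<And>i. i \<in> I \<Longrightarrow> smooth (f i)) \<Longrightarrow> smooth (\<lambda>x. \<Prod>i\<in>I. f i x)"
  by (induction I rule: infinite_finite_induct) (simp_all add: smooth_const smooth_mult)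

lemma differentiable_translate:
  fixes f :: "'a::real_normed_vector \<Rightarrow> 'b::real_normed_vector"
  assumes "\<And>x. f differentiable at x" shows "(\<lambda>x. f (x + a)) differentiable at x"
  using differentiable_compose[of f "\<lambda>x. x + a" x UNIV] assms by (auto intro: differentiable_within_subset)

lemma partial_translate:
  assumes "\<And>x. f differentiable at x"
  shows "partial i (\<lambda>x. f (x + a)) x = partial i f (x + a)"
proof -
  have "((\<lambda>x. f (x + a)) has_derivative (\<lambda>h. frechet_derivative f (at (x + a)) h)) (at x)"
    by (rule has_derivative_compose[of "\<lambda>x. x + a" "\<lambda>h. h", simplified])
      (use assms in \<open>auto simp: frechet_derivative_works[symmetric] intro!: derivative_eq_intros\<close>)
  then show ?thesis unfolding partial_def by (simp add: frechet_derivative_at[symmetric])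
qed

lemma smooth_translate:
  assumes "smooth f" shows "smooth (\<lambda>x. f (x + a))"
proof (rule smooth_coinduct[of _ "{\<lambda>x. g (x + a) | g. smooth g}"])
  fix h :: "real ^ 'a \<Rightarrow> real" and i assume "h \<in> {\<lambda>x. g (x + a) | g. smooth g}"
  then obtain g where g: "smooth g" "h = (\<lambda>x. g (x + a))" by blast
  show "h differentiable at x" for x
    unfolding g(2) by (intro differentiable_translate smooth_differentiable g)
  have "partial i h = (\<lambda>x. partial i g (x + a))"
    unfolding g(2) by (intro ext partial_translate smooth_differentiable g)
  then show "partial i h \<in> {\<lambda>x. g (x + a) | g. smooth g}"
    using smooth_partial[OF g(1)] by blast
qed (use assms in blast)

lemma smooth_continuous: "smooth f \<Longrightarrow> continuous_on S f"
  by (meson continuous_at_imp_continuous_on differentiable_imp_continuous_within smooth_differentiable)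

lemma smooth_borel: "smooth f \<Longrightarrow> f \<in> borel_measurable borel"
  by (intro borel_measurable_continuous_onI smooth_continuous)

lemma test_fun_iff: "test_fun \<phi> \<longleftrightarrow> smooth \<phi> \<and> bounded {x. \<phi> x \<noteq> 0}"
  unfolding test_fun_def by (simp add: compact_closure)

lemma partial_eq_0_outside_closure:
  assumes "x \<notin> closure {x. f x \<noteq> 0}" shows "partial i f x = 0"
proof -
  have "(f has_derivative (\<lambda>h. 0)) (at x)"
    by (rule has_derivative_transform_within_open[of "\<lambda>x. 0" _ _ _ "- closure {x. f x \<noteq> 0}"])
      (use assms closure_subset[of "{x. f x \<noteq> 0}"] in \<open>auto simp: open_Compl\<close>)
  then show ?thesis by (rule has_derivative_imp_partial)
qed

lemma test_fun_partial: assumes "test_fun \<phi>" shows "test_fun (partial i \<phi>)"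
proof -
  have "{x. partial i \<phi> x \<noteq> 0} \<subseteq> closure {x. \<phi> x \<noteq> 0}"
    using partial_eq_0_outside_closure by blast
  then show ?thesis using assms unfolding test_fun_iff
    by (meson smooth_partial bounded_closure bounded_subset)
qed

lemma test_fun_add: "test_fun f \<Longrightarrow> test_fun g \<Longrightarrow> test_fun (\<lambda>x. f x + g x)"
  unfolding test_fun_iff
  using bounded_subset[of "{x. f x \<noteq> 0} \<union> {x. g x \<noteq> 0}" "{x. f x + g x \<noteq> 0}"]
  by (simp add: smooth_add subset_iff)

lemma test_fun_mult_left: "smooth f \<Longrightarrow> test_fun g \<Longrightarrow> test_fun (\<lambda>x. f x * g x)"
  unfolding test_fun_iff
  using bounded_subset[of "{x. g x \<noteq> 0}" "{x. f x * g x \<noteq> 0}"]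
  by (simp add: smooth_mult subset_iff)

lemma test_fun_cmult: "test_fun g \<Longrightarrow> test_fun (\<lambda>x. c * g x)"
  by (rule test_fun_mult_left[OF smooth_const])

lemma test_fun_translate: assumes "test_fun f" shows "test_fun (\<lambda>x. f (x + a))"
proof -
  have "{x. f (x + a) \<noteq> 0} = (\<lambda>x. x - a) ` {x. f x \<noteq> 0}"
    by (auto simp: image_iff) (metis add_diff_cancel)
  then have "bounded {x. f (x + a) \<noteq> 0}"
    using assms bounded_translation_minus[of "{x. f x \<noteq> 0}" a] unfolding test_fun_iff by metis
  then show ?thesis using assms unfolding test_fun_iff by (simp add: smooth_translate)
qed

lemma test_fun_smooth: "test_fun f \<Longrightarrow> smooth f" unfolding test_fun_def by simp

lemma test_fun_differentiable: "test_fun f \<Longrightarrow> f differentiable at x"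
  by (simp add: test_fun_smooth smooth_differentiable)

lemma test_fun_support:
  assumes "test_fun f" obtains R where "R > 0" "\<And>x. norm x \<ge> R \<Longrightarrow> f x = 0"
proof -
  obtain b where "b > 0" "\<And>x. f x \<noteq> 0 \<Longrightarrow> norm x \<le> b"
    using assms bounded_pos[of "{x. f x \<noteq> 0}"] unfolding test_fun_iff by auto
  then show thesis by (intro that[of "b + 1"]) (force+)
qed

lemma test_fun_bounded:
  assumes "test_fun f" obtains M where "M > 0" "\<And>x. \<bar>f x\<bar> \<le> M"
proof -
  obtain R where R: "\<And>x. norm x \<ge> R \<Longrightarrow> f x = 0" using test_fun_support[OF assms] by metis
  have "compact (f ` cball 0 R)"
    by (intro compact_continuous_image smooth_continuous test_fun_smooth assms) auto
  then obtain M where M: "M > 0" "\<And>x. x \<in> cball 0 R \<Longrightarrow> norm (f x) \<le> M"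
    using compact_imp_bounded[of "f ` cball 0 R"] unfolding bounded_pos by auto
  show thesis
  proof (rule that[OF M(1)])
    show "\<bar>f x\<bar> \<le> M" for x
      using M R[of x] by (cases "norm x \<le> R") (auto simp: less_imp_le)
  qed
qed

section \<open>Smooth bump functions supported in boxes\<close>

text \<open>The polynomial factor makes this class of flat functions closed under differentiation.\<close>

definition flat :: "real poly \<Rightarrow> real \<Rightarrow> real" where
  "flat p t = (if t \<le> 0 then 0 else poly p (1/t) * exp (- (1/t)))"

text \<open>The free exponent \<open>n\<close> makes the induction over the coefficients go through:
  splitting off the constant term moves one power of \<open>s\<close> out of the remaining
  polynomial.\<close>

lemma poly_times_exp_minus_tendsto: "((\<lambda>s::real. s ^ n * poly p s * exp (- s)) \<longlongrightarrow> 0) at_top"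
proof (induction p arbitrary: n)
  case (pCons a p)
  have "((\<lambda>s::real. a * (s ^ n * exp (- s)) + s ^ Suc n * poly p s * exp (- s)) \<longlongrightarrow> a * 0 + 0) at_top"
    by (intro tendsto_intros pCons) real_asymp
  then show ?case by (simp add: algebra_simps)
qed simp

text \<open>With s = 1/t one has d/dt = - s^2 d/ds, and the derivative of p(s) exp(-s) in s is (p' -
  p)(s) exp(-s); this explains the factor \<open>monom 1 2\<close> and the sign. At 0 the right
  difference quotient is s p(s) exp(-s), which tends to 0.\<close>

lemma flat_has_derivative: "(flat p has_real_derivative flat (monom 1 2 * (p - pderiv p)) t) (at t)"
proof -
  consider "t < 0" | "t = 0" | "t > 0" by linarith
  then show ?thesis
  proof cases
    case 1
    have "(flat p has_real_derivative 0) (at t)"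
      by (rule has_field_derivative_transform_within_open[of "\<lambda>t. 0" _ _ "{..<0}"])
        (use 1 in \<open>auto simp: flat_def\<close>)
    then show ?thesis using 1 by (simp add: flat_def)
  next
    case 2
    have "((\<lambda>h. (flat p (0 + h) - flat p 0) / h) \<longlongrightarrow> 0) (at 0)"
    proof (subst filterlim_at_split, intro conjI)
      show "((\<lambda>h. (flat p (0 + h) - flat p 0) / h) \<longlongrightarrow> 0) (at_left 0)"
        by (rule tendsto_eventually) (simp add: flat_def eventually_at_filter)
      have "((\<lambda>h. (1/h) ^ 1 * poly p (1/h) * exp (- (1/h))) \<longlongrightarrow> 0) (at_right (0::real))"
        by (rule filterlim_compose[OF poly_times_exp_minus_tendsto]) real_asymp
      then show "((\<lambda>h. (flat p (0 + h) - flat p 0) / h) \<longlongrightarrow> 0) (at_right 0)"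
        by (rule Lim_transform_eventually)
          (simp add: flat_def eventually_at_filter)
    qed
    then show ?thesis using 2 by (simp add: DERIV_def flat_def)
  next
    case 3
    have "((\<lambda>t. poly p (1/t)) has_real_derivative poly (pderiv p) (1/t) * (- (1 / t\<^sup>2))) (at t)"
      by (rule DERIV_chain2[OF poly_DERIV])
        (use 3 in \<open>auto intro!: derivative_eq_intros simp: power2_eq_square\<close>)
    moreover have "((\<lambda>t. exp (- (1/t))) has_real_derivative exp (- (1/t)) * (1 / t\<^sup>2)) (at t)"
      using 3 by (auto intro!: derivative_eq_intros simp: power2_eq_square)
    ultimately have "((\<lambda>t. poly p (1/t) * exp (- (1/t))) has_real_derivative
        poly (pderiv p) (1/t) * (- (1 / t\<^sup>2)) * exp (- (1/t)) + exp (- (1/t)) * (1 / t\<^sup>2) * poly p (1/t)) (at t)"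
      by (rule DERIV_mult)
    also have "poly (pderiv p) (1/t) * (- (1 / t\<^sup>2)) * exp (- (1/t)) + exp (- (1/t)) * (1 / t\<^sup>2) * poly p (1/t)
        = flat (monom 1 2 * (p - pderiv p)) t"
      using 3 by (simp add: flat_def poly_monom power_one_over algebra_simps)
    finally show ?thesis
      by (rule has_field_derivative_transform_within_open[of _ _ _ "{0<..}"])
        (use 3 in \<open>auto simp: flat_def\<close>)
  qed
qed

text \<open>The scalar \<open>r\<close> in the class absorbs the factor from the chain rule, which
  is 0 for the directions other than \<open>i\<close>.\<close>

lemma smooth_flat_affine: "smooth (\<lambda>x. flat p (c * x $ i + d))"
proof (rule smooth_coinduct[of _ "{\<lambda>x. r * flat q (c * x $ i + d) | r q. True}"])
  fix f :: "real ^ 'a \<Rightarrow> real" and j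
  assume "f \<in> {\<lambda>x. r * flat q (c * x $ i + d) | r q. True}"
  then obtain r q where f: "f = (\<lambda>x. r * flat q (c * x $ i + d))" by blast
  have D: "(f has_derivative (\<lambda>h. r * (flat (monom 1 2 * (q - pderiv q)) (c * x $ i + d) * (c * h $ i)))) (at x)" for x
  proof -
    have "((\<lambda>x. c * x $ i + d) has_derivative (\<lambda>h. c * h $ i)) (at x)"
      by (auto intro!: derivative_eq_intros bounded_linear.has_derivative[OF bounded_linear_vec_nth])
    from has_derivative_compose[OF this flat_has_derivative[unfolded has_field_derivative_def]]
    show ?thesis unfolding f by (auto intro!: derivative_eq_intros)
  qed
  then show "f differentiable at x" for x unfolding differentiable_def by blast
  have "partial j f = (\<lambda>x. (r * (c * axis j 1 $ i)) * flat (monom 1 2 * (q - pderiv q)) (c * x $ i + d))"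
    by (rule ext) (simp add: has_derivative_imp_partial[OF D])
  then show "partial j f \<in> {\<lambda>x. r * flat q (c * x $ i + d) | r q. True}" by blast
qed (rule CollectI, rule exI[of _ 1], auto)

text \<open>The approximants stay between 0 and the indicator, so the indicator times a locally
  integrable function is an integrable majorant when passing to the limit.\<close>

lemma box_indicator_approx:
  fixes a b :: "real ^ 'n::finite"
  obtains \<phi> :: "nat \<Rightarrow> real ^ 'n \<Rightarrow> real" where
    "\<And>n. test_fun (\<phi> n)" "\<And>n x. 0 \<le> \<phi> n x" "\<And>n x. \<phi> n x \<le> 1"
    "\<And>n x. x \<notin> box a b \<Longrightarrow> \<phi> n x = 0"
    "\<And>x. (\<lambda>n. \<phi> n x) \<longlonglongrightarrow> indicator (box a b) x"
proof
  \<comment> \<open>There is one factor for each face of the box. \<open>flat 1\<close> is exp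
    (-1/t) for t > 0 and 0 otherwise; dilating by \<open>Suc n\<close> drives each factor to 1
    inside the box while it keeps vanishing beyond its face.\<close>
  define \<phi> where "\<phi> n x = (\<Prod>i\<in>UNIV. flat 1 (Suc n * x $ i + (- Suc n * a $ i)) * flat 1 (- Suc n * x $ i + Suc n * b $ i))"
    for n :: nat and x :: "real ^ 'n"
  have flat1: "0 \<le> flat 1 t" "flat 1 t \<le> 1" for t by (auto simp: flat_def)
  show zero: "\<phi> n x = 0" if "x \<notin> box a b" for n x
  proof -
    from that obtain i where "x $ i \<le> a $ i \<or> b $ i \<le> x $ i"
      by (auto simp: mem_box_cart not_less)
    then have "- real (Suc n) * x $ i + real (Suc n) * b $ i \<le> 0 \<or> real (Suc n) * x $ i + (- real (Suc n) * a $ i) \<le> 0"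
    proof
      assume "x $ i \<le> a $ i"
      then have "real (Suc n) * x $ i \<le> real (Suc n) * a $ i" by (intro mult_left_mono) auto
      then show ?thesis by linarith
    next
      assume "b $ i \<le> x $ i"
      then have "real (Suc n) * b $ i \<le> real (Suc n) * x $ i" by (intro mult_left_mono) auto
      then show ?thesis by linarith
    qed
    then have "flat 1 (Suc n * x $ i + (- Suc n * a $ i)) * flat 1 (- Suc n * x $ i + Suc n * b $ i) = 0"
      by (auto simp: flat_def)
    then show ?thesis unfolding \<phi>_def by (intro prod_zero) (auto intro!: bexI[of _ i])
  qed
  have "smooth (\<phi> n)" for n
    unfolding \<phi>_def by (intro smooth_prod smooth_mult smooth_flat_affine)
  moreover have "bounded {x. \<phi> n x \<noteq> 0}" for n
    by (rule bounded_subset[OF bounded_box[of a b]]) (use zero in blast)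
  ultimately show "test_fun (\<phi> n)" for n unfolding test_fun_iff by blast
  show "0 \<le> \<phi> n x" for n x unfolding \<phi>_def by (intro prod_nonneg mult_nonneg_nonneg flat1)
  show "\<phi> n x \<le> 1" for n x unfolding \<phi>_def
    by (intro prod_le_1 conjI mult_nonneg_nonneg mult_le_one flat1)
  show "(\<lambda>n. \<phi> n x) \<longlonglongrightarrow> indicator (box a b) x" for x
  proof (cases "x \<in> box a b")
    case True
    have lim: "(\<lambda>n. flat 1 (Suc n * t)) \<longlonglongrightarrow> 1" if "t > 0" for t :: real
    proof -
      have "(\<lambda>n. exp (- (1 / (real (Suc n) * t)))) \<longlonglongrightarrow> 1" using that by real_asymp
      moreover have "flat 1 (Suc n * t) = exp (- (1 / (real (Suc n) * t)))" for n
        using that by (simp add: flat_def not_le zero_less_mult_iff del: of_nat_Suc)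
      ultimately show ?thesis by simp
    qed
    have eq: "\<phi> n x = (\<Prod>i\<in>UNIV. flat 1 (Suc n * (x $ i - a $ i)) * flat 1 (Suc n * (b $ i - x $ i)))" for n
      unfolding \<phi>_def by (simp add: algebra_simps)
    have "(\<lambda>n. \<phi> n x) \<longlonglongrightarrow> (\<Prod>i\<in>(UNIV :: 'n set). 1 * 1)"
      unfolding eq using True by (intro tendsto_prod tendsto_mult lim) (auto simp: mem_box_cart simp del: of_nat_Suc)
    with True show ?thesis by simp
  qed (simp add: zero)
qed

section \<open>Translation and integration by parts\<close>

lemma
  fixes a :: "'a::euclidean_space"
  shows lebesgue_measurable_translate: "(\<lambda>x. x + a) \<in> lebesgue \<rightarrow>\<^sub>M lebesgue"
    and lebesgue_distr_translate: "distr lebesgue lebesgue (\<lambda>x. x + a) = lebesgue"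
proof -
  have eq: "(\<lambda>x. a + (\<Sum>j\<in>Basis. (1 * (x \<bullet> j)) *\<^sub>R j)) = (\<lambda>x. x + a)"
    by (auto simp: euclidean_representation)
  show "(\<lambda>x. x + a) \<in> lebesgue \<rightarrow>\<^sub>M lebesgue"
    using lebesgue_affine_measurable[of "\<lambda>_. 1" a] unfolding eq by simp
  show "distr lebesgue lebesgue (\<lambda>x. x + a) = lebesgue"
    using lebesgue_affine_euclidean[of "\<lambda>_. 1" a] unfolding eq by (simp add: density_1)
qed

lemma lebesgue_integral_translate:
  fixes f :: "'a::euclidean_space \<Rightarrow> 'b::{banach, second_countable_topology}"
  assumes "f \<in> borel_measurable lebesgue"
  shows "(LINT x|lebesgue. f (x + a)) = (LINT x|lebesgue. f x)"
  using integral_distr[OF lebesgue_measurable_translate assms, of a]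
  by (simp add: lebesgue_distr_translate)

text \<open>The cutoffs to balls of integer radius are integrable, hence measurable, and at each
  point they are eventually equal to \<open>g\<close>.\<close>

lemma loc_integrable_measurable:
  assumes "loc_integrable g" shows "g \<in> borel_measurable lebesgue"
proof (rule borel_measurable_LIMSEQ_metric)
  show "(\<lambda>x. indicator (cball 0 (real n)) x *\<^sub>R g x) \<in> borel_measurable lebesgue" for n
    using assms unfolding loc_integrable_def set_integrable_def by (auto intro: borel_measurable_integrable)
  show "(\<lambda>n. indicator (cball 0 (real n)) x *\<^sub>R g x) \<longlonglongrightarrow> g x" for x
  proof (rule tendsto_eventually)
    obtain N where "norm x < real N" using reals_Archimedean2 by blast
    then show "\<forall>\<^sub>F n in sequentially. indicator (cball 0 (real n)) x *\<^sub>R g x = g x"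
      by (intro eventually_sequentiallyI[of N]) (auto simp: indicator_def)
  qed
qed

lemma loc_integrable_bounded_mult:
  fixes g :: "real ^ 'n::finite \<Rightarrow> 'b::{banach, second_countable_topology}"
  assumes g: "loc_integrable g" and h: "h \<in> borel_measurable lebesgue"
    and le: "\<And>x. \<bar>h x\<bar> \<le> M * indicator (cball 0 R) x"
  shows "integrable lebesgue (\<lambda>x. h x *\<^sub>R g x)"
proof (rule Bochner_Integration.integrable_bound)
  have "set_integrable lebesgue (cball 0 R) g"
    using g unfolding loc_integrable_def by auto
  then show "integrable lebesgue (\<lambda>x. M *\<^sub>R (indicator (cball 0 R) x *\<^sub>R g x))"
    unfolding set_integrable_def by (intro integrable_scaleR_right)
  show "(\<lambda>x. h x *\<^sub>R g x) \<in> borel_measurable lebesgue"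
    using h loc_integrable_measurable[OF g] by measurable
  show "AE x in lebesgue. norm (h x *\<^sub>R g x) \<le> norm (M *\<^sub>R (indicator (cball 0 R) x *\<^sub>R g x))"
  proof (rule AE_I2)
    fix x
    have "\<bar>h x\<bar> * norm (g x) \<le> \<bar>M * indicator (cball 0 R) x\<bar> * norm (g x)"
      using le[of x] by (intro mult_right_mono) auto
    then show "norm (h x *\<^sub>R g x) \<le> norm (M *\<^sub>R (indicator (cball 0 R) x *\<^sub>R g x))"
      by (simp add: abs_mult mult.assoc)
  qed
qed

lemma test_fun_bound:
  assumes "test_fun f"
  obtains M R where "M > 0" "R > 0" "\<And>x. \<bar>f x\<bar> \<le> M * indicator (cball 0 R) x"
proof -
  obtain R where R: "R > 0" "\<And>x. norm x \<ge> R \<Longrightarrow> f x = 0" using test_fun_support[OF assms] by metis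
  obtain M where M: "M > 0" "\<And>x. \<bar>f x\<bar> \<le> M" using test_fun_bounded[OF assms] by metis
  show thesis using R M by (intro that[of M R]) (auto simp: indicator_def)
qed

lemma smooth_lebesgue_measurable: "smooth f \<Longrightarrow> f \<in> borel_measurable lebesgue"
  by (rule measurable_completion) (simp add: smooth_borel)

lemma test_fun_integrable:
  assumes "loc_integrable g" "test_fun f"
  shows "integrable lebesgue (\<lambda>x. f x *\<^sub>R g x)"
proof -
  obtain M R where "\<And>x. \<bar>f x\<bar> \<le> M * indicator (cball 0 R) x" using test_fun_bound[OF assms(2)] by metis
  then show ?thesis
    by (intro loc_integrable_bounded_mult[OF assms(1) smooth_lebesgue_measurable[OF test_fun_smooth[OF assms(2)]]])
qed

lemma loc_integrable_continuous:
  assumes "continuous_on UNIV g" shows "loc_integrable g"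
  unfolding loc_integrable_def
proof (intro allI impI)
  fix K :: "(real ^ 'a) set" assume "compact K"
  then have "set_integrable lborel K g" unfolding set_integrable_def
    by (intro borel_integrable_compact) (auto intro: continuous_on_subset[OF assms])
  then show "set_integrable lebesgue K g" unfolding set_integrable_def
    using \<open>compact K\<close> assms
    by (subst integrable_completion)
       (auto intro!: borel_measurable_continuous_onI borel_measurable_scaleR borel_measurable_indicator borel_compact)
qed

lemma has_real_derivative_along_axis:
  assumes "\<And>x. f differentiable at x"
  shows "((\<lambda>t. f (x + t *\<^sub>R axis i 1)) has_real_derivative partial i f (x + t *\<^sub>R axis i 1)) (at t within S)"
proof -
  define y where "y = x + t *\<^sub>R axis i 1"
  have D: "(f has_derivative frechet_derivative f (at y)) (at y)"
    using assms frechet_derivative_works by blast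
  have "((\<lambda>t. x + t *\<^sub>R axis i 1) has_derivative (\<lambda>h. h *\<^sub>R axis i 1)) (at t within S)"
    by (auto intro!: derivative_eq_intros)
  from has_derivative_compose[OF this D[unfolded y_def]]
  have "((\<lambda>t. f (x + t *\<^sub>R axis i 1)) has_derivative (\<lambda>h. frechet_derivative f (at y) (h *\<^sub>R axis i 1))) (at t within S)"
    unfolding y_def .
  moreover have "(\<lambda>h. frechet_derivative f (at y) (h *\<^sub>R axis i 1)) = (*) (partial i f y)"
    using linear_frechet_derivative[OF assms, of y] by (auto simp: partial_def linear_cmul)
  ultimately show ?thesis unfolding y_def has_field_derivative_def by simp
qed

section \<open>Differentiation of pairings along translations\<close>

lemma difference_quotient_tendsto:
  fixes g :: "real ^ 'n::finite \<Rightarrow> real"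
  assumes g: "loc_integrable g" and f: "test_fun f"
    and X: "X \<longlonglongrightarrow> 0" "\<And>n. X n \<noteq> 0"
  shows "(\<lambda>n. LINT x|lebesgue. (f (x + X n *\<^sub>R axis i 1) - f x) / X n * g x)
    \<longlonglongrightarrow> (LINT x|lebesgue. partial i f x * g x)"
proof -
  obtain M where M: "M > 0" "\<And>x. \<bar>partial i f x\<bar> \<le> M"
    using test_fun_bounded[OF test_fun_partial[OF f]] by metis
  obtain R where R: "R > 0" "\<And>x. norm x \<ge> R \<Longrightarrow> f x = 0" using test_fun_support[OF f] by metis
  obtain C where C: "C > 0" "\<And>n. \<bar>X n\<bar> \<le> C"
    using convergent_imp_Bseq[OF convergentI[OF X(1)]] unfolding Bseq_def by auto
  \<comment> \<open>The mean value inequality bounds the quotient by the bound \<open>M\<close> of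
    the partial derivative, and shifts of length at most \<open>C\<close> keep its support in the
    ball of radius R + C.\<close>
  define w where "w x = M * indicator (cball 0 (R + C)) x * \<bar>g x\<bar>" for x
  show ?thesis
  proof (rule integral_dominated_convergence[where w = w])
    show "(\<lambda>x. partial i f x * g x) \<in> borel_measurable lebesgue"
      using smooth_lebesgue_measurable[OF test_fun_smooth[OF test_fun_partial[OF f]]] loc_integrable_measurable[OF g]
      by measurable
    show "(\<lambda>x. (f (x + X n *\<^sub>R axis i 1) - f x) / X n * g x) \<in> borel_measurable lebesgue" for n
      using smooth_lebesgue_measurable[OF test_fun_smooth[OF f]] loc_integrable_measurable[OF g]
        smooth_lebesgue_measurable[OF smooth_translate[OF test_fun_smooth[OF f]]]
      by measurable
    have "set_integrable lebesgue (cball 0 (R + C)) g" using g unfolding loc_integrable_def by auto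
    then have "integrable lebesgue (\<lambda>x. M * \<bar>indicator (cball 0 (R + C)) x *\<^sub>R g x\<bar>)"
      unfolding set_integrable_def by simp
    then show "integrable lebesgue w" unfolding w_def by (simp add: abs_mult mult.assoc)
    show "AE x in lebesgue. (\<lambda>n. (f (x + X n *\<^sub>R axis i 1) - f x) / X n * g x) \<longlonglongrightarrow> partial i f x * g x"
    proof (intro AE_I2 tendsto_mult tendsto_const)
      fix x
      have "((\<lambda>t. (f (x + t *\<^sub>R axis i 1) - f x) / t) \<longlongrightarrow> partial i f x) (at 0)"
        using has_real_derivative_along_axis[OF test_fun_differentiable[OF f], of x i 0 UNIV]
        unfolding DERIV_def by simp
      then show "(\<lambda>n. (f (x + X n *\<^sub>R axis i 1) - f x) / X n) \<longlonglongrightarrow> partial i f x"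
        using X unfolding tendsto_at_iff_sequentially comp_def by auto
    qed
    show "AE x in lebesgue. norm ((f (x + X n *\<^sub>R axis i 1) - f x) / X n * g x) \<le> w x" for n
    proof (rule AE_I2)
      fix x
      have "\<bar>f (x + X n *\<^sub>R axis i 1) - f x\<bar> \<le> M * \<bar>X n\<bar>"
        using field_differentiable_bound[of UNIV "\<lambda>t. f (x + t *\<^sub>R axis i 1)" "\<lambda>t. partial i f (x + t *\<^sub>R axis i 1)" M "X n" 0]
          has_real_derivative_along_axis[OF test_fun_differentiable[OF f]] M by simp
      then have 1: "\<bar>(f (x + X n *\<^sub>R axis i 1) - f x) / X n\<bar> \<le> M"
        using X(2)[of n] by (simp add: field_simps)
      have 2: "\<bar>(f (x + X n *\<^sub>R axis i 1) - f x) / X n\<bar> \<le> M * indicator (cball 0 (R + C)) x"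
      proof (cases "norm x \<le> R + C")
        case False
        have "norm x \<le> norm (x + X n *\<^sub>R axis i 1) + norm (X n *\<^sub>R (axis i 1 :: real ^ 'n))"
          by (metis add_diff_cancel norm_triangle_ineq4)
        moreover have "norm (X n *\<^sub>R (axis i 1 :: real ^ 'n)) \<le> C" using C by simp
        ultimately have "R \<le> norm (x + X n *\<^sub>R axis i 1)" "R \<le> norm x" using False C by linarith+
        then show ?thesis using False R by simp
      qed (use 1 in simp)
      have "norm ((f (x + X n *\<^sub>R axis i 1) - f x) / X n * g x)
          = \<bar>(f (x + X n *\<^sub>R axis i 1) - f x) / X n\<bar> * \<bar>g x\<bar>" by (simp add: abs_mult)
      also have "\<dots> \<le> w x" unfolding w_def by (rule mult_right_mono[OF 2]) simp
      finally show "norm ((f (x + X n *\<^sub>R axis i 1) - f x) / X n * g x) \<le> w x" .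
    qed
  qed
qed

text \<open>Differentiation under the integral sign; a general \<open>s\<close> reduces to
  difference quotients at 0 of the translated test function \<open>f'\<close>.\<close>

lemma has_real_derivative_test_fun_integral:
  fixes g :: "real ^ 'n::finite \<Rightarrow> real"
  assumes g: "loc_integrable g" and f: "test_fun f"
  shows "((\<lambda>s. LINT x|lebesgue. f (x + s *\<^sub>R axis i 1) * g x) has_real_derivative
    (LINT x|lebesgue. partial i f (x + s *\<^sub>R axis i 1) * g x)) (at s)"
  unfolding DERIV_def tendsto_at_iff_sequentially comp_def
proof (intro allI impI)
  fix X :: "nat \<Rightarrow> real" assume X: "\<forall>n. X n \<in> UNIV - {0}" "X \<longlonglongrightarrow> 0"
  define f' where "f' = (\<lambda>x. f (x + s *\<^sub>R axis i 1))"
  have f': "test_fun f'" unfolding f'_def by (rule test_fun_translate[OF f])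
  have p: "partial i f' x = partial i f (x + s *\<^sub>R axis i 1)" for x
    unfolding f'_def by (rule partial_translate) (rule test_fun_differentiable[OF f])
  have int: "integrable lebesgue (\<lambda>x. f (x + t *\<^sub>R axis i 1) * g x)" for t
    using test_fun_integrable[OF g test_fun_translate[OF f]] by simp
  have eq: "((LINT x|lebesgue. f (x + (s + h) *\<^sub>R axis i 1) * g x) - (LINT x|lebesgue. f (x + s *\<^sub>R axis i 1) * g x)) / h
      = (LINT x|lebesgue. (f' (x + h *\<^sub>R axis i 1) - f' x) / h * g x)" for h
  proof -
    have "((LINT x|lebesgue. f (x + (s + h) *\<^sub>R axis i 1) * g x) - (LINT x|lebesgue. f (x + s *\<^sub>R axis i 1) * g x)) / h
      = (LINT x|lebesgue. (f (x + (s + h) *\<^sub>R axis i 1) * g x - f (x + s *\<^sub>R axis i 1) * g x) / h)"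
      using int by simp
    also have "\<dots> = (LINT x|lebesgue. (f' (x + h *\<^sub>R axis i 1) - f' x) / h * g x)"
      unfolding f'_def by (rule Bochner_Integration.integral_cong)
        (simp_all add: algebra_simps diff_divide_distrib)
    finally show ?thesis .
  qed
  show "(\<lambda>n. ((LINT x|lebesgue. f (x + (s + X n) *\<^sub>R axis i 1) * g x) - (LINT x|lebesgue. f (x + s *\<^sub>R axis i 1) * g x)) / X n)
      \<longlonglongrightarrow> (LINT x|lebesgue. partial i f (x + s *\<^sub>R axis i 1) * g x)"
    unfolding eq using difference_quotient_tendsto[OF g f', of X i] X by (simp add: p)
qed

text \<open>Translation invariance of Lebesgue measure makes the pairing with the shifted test
  function constant in the shift, so its derivative vanishes. Constant \<open>g\<close> gives
  integration by parts; a \<open>g\<close> depending on x1, x2 gives integration by parts in x3 for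
  the fields.\<close>

lemma integral_partial_mult_invariant:
  fixes g :: "real ^ 'n::finite \<Rightarrow> real"
  assumes g: "loc_integrable g" and f: "test_fun f"
    and inv: "\<And>x h. g (x + h *\<^sub>R axis i 1) = g x"
  shows "(LINT x|lebesgue. partial i f x * g x) = 0"
proof -
  have m: "(\<lambda>x. f x * g x) \<in> borel_measurable lebesgue"
    using test_fun_integrable[OF g f] by (auto dest: borel_measurable_integrable)
  have const: "(\<lambda>s. LINT x|lebesgue. f (x + s *\<^sub>R axis i 1) * g x) = (\<lambda>s. LINT x|lebesgue. f x * g x)"
  proof
    fix s
    show "(LINT x|lebesgue. f (x + s *\<^sub>R axis i 1) * g x) = (LINT x|lebesgue. f x * g x)"
      using lebesgue_integral_translate[OF m, of "s *\<^sub>R axis i 1"] by (simp add: inv)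
  qed
  have "((\<lambda>s. LINT x|lebesgue. f (x + s *\<^sub>R axis i 1) * g x) has_real_derivative 0) (at 0)"
    unfolding const by simp
  from DERIV_unique[OF this has_real_derivative_test_fun_integral[OF g f]]
  show ?thesis by simp
qed

lemma integration_by_parts:
  fixes f h :: "real ^ 'n::finite \<Rightarrow> real"
  assumes f: "smooth f" and h: "test_fun h"
  shows "(LINT x|lebesgue. partial i f x * h x) = - (LINT x|lebesgue. f x * partial i h x)"
proof -
  have fh: "test_fun (\<lambda>x. f x * h x)" by (rule test_fun_mult_left[OF f h])
  have 1: "integrable lebesgue (\<lambda>x. f x * partial i h x)" "integrable lebesgue (\<lambda>x. partial i f x * h x)"
    using test_fun_integrable[of "\<lambda>x. 1::real", OF loc_integrable_continuous[OF continuous_on_const]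
       test_fun_mult_left[OF f test_fun_partial[OF h]]]
      test_fun_integrable[of "\<lambda>x. 1::real", OF loc_integrable_continuous[OF continuous_on_const]
       test_fun_mult_left[OF smooth_partial[OF f] h]] by simp_all
  have "0 = (LINT x|lebesgue. partial i (\<lambda>x. f x * h x) x * 1)"
    by (rule integral_partial_mult_invariant[symmetric, OF loc_integrable_continuous[OF continuous_on_const] fh]) simp
  also have "\<dots> = (LINT x|lebesgue. f x * partial i h x + partial i f x * h x)"
    by (simp add: partial_mult smooth_differentiable f test_fun_differentiable h)
  also have "\<dots> = (LINT x|lebesgue. f x * partial i h x) + (LINT x|lebesgue. partial i f x * h x)"
    by (rule Bochner_Integration.integral_add) fact+
  finally show ?thesis by simp
qed

text \<open>Symmetry of mixed partials in integrated form. A difference quotient in direction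
  \<open>i\<close> commutes with \<open>partial j\<close> at once; integrating by parts in
  \<open>j\<close> and letting the step tend to 0 exchanges the derivatives without comparing them
  pointwise.\<close>

lemma integral_partial_partial_commute:
  fixes f h :: "real ^ 'n::finite \<Rightarrow> real"
  assumes f: "test_fun f" and h: "test_fun h"
  shows "(LINT x|lebesgue. partial i f x * partial j h x) = (LINT x|lebesgue. partial j f x * partial i h x)"
proof -
  define X where "X n = 1 / real (Suc n)" for n
  have X: "X \<longlonglongrightarrow> 0" "\<And>n. X n \<noteq> 0" unfolding X_def by real_asymp auto
  define f' where "f' n = (\<lambda>x. 1 / X n * (f (x + X n *\<^sub>R axis i 1) + (-1) * f x))" for n
  have f': "test_fun (f' n)" for n
    unfolding f'_def by (intro test_fun_cmult test_fun_add test_fun_translate f)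
  have loc: "loc_integrable u" if "test_fun u" for u :: "real ^ 'n \<Rightarrow> real"
    by (intro loc_integrable_continuous smooth_continuous test_fun_smooth that)
  have pf': "partial j (f' n) x = (partial j f (x + X n *\<^sub>R axis i 1) - partial j f x) / X n" for n x
  proof -
    have "partial j (\<lambda>x. f (x + X n *\<^sub>R axis i 1) + (-1) * f x) x
      = partial j (\<lambda>x. f (x + X n *\<^sub>R axis i 1)) x + partial j (\<lambda>x. (-1) * f x) x"
      by (intro partial_add test_fun_differentiable test_fun_cmult test_fun_translate f)
    also have "\<dots> = partial j f (x + X n *\<^sub>R axis i 1) - partial j f x"
      by (subst partial_translate, rule test_fun_differentiable[OF f], subst partial_mult)
        (simp_all add: partial_const test_fun_differentiable f)
    finally have *: "partial j (\<lambda>x. f (x + X n *\<^sub>R axis i 1) + (-1) * f x) x =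
      partial j f (x + X n *\<^sub>R axis i 1) - partial j f x" .
    have "partial j (f' n) x = 1 / X n * partial j (\<lambda>x. f (x + X n *\<^sub>R axis i 1) + (-1) * f x) x"
      unfolding f'_def
      by (subst partial_mult)
        (simp, intro test_fun_differentiable test_fun_cmult test_fun_add test_fun_translate f, simp add: partial_const)
    then show ?thesis unfolding * by simp
  qed
  have "(\<lambda>n. LINT x|lebesgue. f' n x * partial j h x) \<longlonglongrightarrow> (LINT x|lebesgue. partial i f x * partial j h x)"
    using difference_quotient_tendsto[OF loc[OF test_fun_partial[OF h, of j]] f X, of i] unfolding f'_def by simp
  moreover have "(LINT x|lebesgue. f' n x * partial j h x) = - (LINT x|lebesgue. partial j (f' n) x * h x)" for n
    using integration_by_parts[OF test_fun_smooth[OF f'] h, of j n] by simp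
  ultimately have "(\<lambda>n. - (LINT x|lebesgue. (partial j f (x + X n *\<^sub>R axis i 1) - partial j f x) / X n * h x))
      \<longlonglongrightarrow> (LINT x|lebesgue. partial i f x * partial j h x)" by (simp add: pf')
  moreover have "(\<lambda>n. - (LINT x|lebesgue. (partial j f (x + X n *\<^sub>R axis i 1) - partial j f x) / X n * h x))
      \<longlonglongrightarrow> - (LINT x|lebesgue. partial i (partial j f) x * h x)"
    by (intro tendsto_minus difference_quotient_tendsto loc h test_fun_partial f X)
  ultimately have "(LINT x|lebesgue. partial i f x * partial j h x) = - (LINT x|lebesgue. partial i (partial j f) x * h x)"
    by (rule LIMSEQ_unique)
  also have "\<dots> = (LINT x|lebesgue. partial j f x * partial i h x)"
    using integration_by_parts[OF test_fun_smooth[OF test_fun_partial[OF f]] h, of i j] by simp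
  finally show ?thesis .
qed

section \<open>The fundamental lemma of the calculus of variations\<close>

text \<open>Cauchy-Schwarz, from the nonnegativity of the quadratic polynomial in t given by the
  integral of (f + t g)^2.\<close>

lemma integral_mult_squared_le:
  fixes f g :: "'a \<Rightarrow> real"
  assumes [measurable]: "f \<in> borel_measurable M" "g \<in> borel_measurable M"
    and f: "integrable M (\<lambda>x. (f x)\<^sup>2)" and g: "integrable M (\<lambda>x. (g x)\<^sup>2)"
  shows "integrable M (\<lambda>x. f x * g x)"
    and "(LINT x|M. f x * g x)\<^sup>2 \<le> (LINT x|M. (f x)\<^sup>2) * (LINT x|M. (g x)\<^sup>2)"
proof -
  show fg: "integrable M (\<lambda>x. f x * g x)"
  proof (rule Bochner_Integration.integrable_bound)
    show "integrable M (\<lambda>x. (f x)\<^sup>2 + (g x)\<^sup>2)" using f g by simp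
    have "\<bar>a * b\<bar> \<le> a\<^sup>2 + b\<^sup>2" for a b :: real
    proof -
      have "0 \<le> (\<bar>a\<bar> - \<bar>b\<bar>)\<^sup>2" "0 \<le> \<bar>a\<bar> * \<bar>b\<bar>" by simp_all
      then have "2 * (\<bar>a\<bar> * \<bar>b\<bar>) \<le> a\<^sup>2 + b\<^sup>2" "0 \<le> \<bar>a\<bar> * \<bar>b\<bar>" by (simp_all add: power2_diff)
      then show ?thesis unfolding abs_mult by linarith
    qed
    then show "AE x in M. norm (f x * g x) \<le> norm ((f x)\<^sup>2 + (g x)\<^sup>2)" by simp
  qed measurable
  define a b c where "a = (LINT x|M. (f x)\<^sup>2)" and "b = (LINT x|M. (g x)\<^sup>2)" and "c = (LINT x|M. f x * g x)"
  have q: "0 \<le> a + 2 * t * c + t\<^sup>2 * b" for t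
  proof -
    have "0 \<le> (LINT x|M. (f x + t * g x)\<^sup>2)" by (rule integral_nonneg_AE) simp
    also have "\<dots> = (LINT x|M. (f x)\<^sup>2 + ((2 * t) * (f x * g x) + t\<^sup>2 * (g x)\<^sup>2))"
      by (simp add: power2_eq_square algebra_simps)
    also have "\<dots> = a + 2 * t * c + t\<^sup>2 * b"
      unfolding a_def b_def c_def using f g fg by (simp add: add.assoc)
    finally show ?thesis .
  qed
  have b0: "b \<ge> 0" unfolding b_def by (rule integral_nonneg_AE) simp
  have "c\<^sup>2 \<le> a * b"
  proof (cases "b = 0")
    case True
    have "c = 0"
    proof (rule ccontr)
      assume "c \<noteq> 0"
      \<comment> \<open>With b = 0 the polynomial is affine in t; at this t it would take the value
        -1.\<close>
      then have "a + 2 * (- (a + 1) / (2 * c)) * c = -1" by (simp add: field_simps)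
      then show False using q[of "- (a + 1) / (2 * c)"] True by simp
    qed
    with True show ?thesis by simp
  next
    case False
    \<comment> \<open>The quadratic polynomial attains its minimum at t = - c / b.\<close>
    have "0 \<le> a + 2 * (- c / b) * c + (- c / b)\<^sup>2 * b" by (rule q)
    also have "\<dots> = a - c\<^sup>2 / b" using False by (simp add: power2_eq_square field_simps)
    finally show ?thesis using False b0 by (simp add: field_simps)
  qed
  then show "(LINT x|M. f x * g x)\<^sup>2 \<le> (LINT x|M. (f x)\<^sup>2) * (LINT x|M. (g x)\<^sup>2)"
    unfolding a_def b_def c_def .
qed

lemma loc_integrable_cbox:
  assumes "loc_integrable g" shows "set_integrable lebesgue (cbox a b) g"
  using assms unfolding loc_integrable_def by auto

lemma loc_integrable_box:
  assumes "loc_integrable g" shows "set_integrable lebesgue (box a b) g"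
  by (rule set_integrable_subset[OF loc_integrable_cbox[OF assms, of a b]]) (auto simp: box_subset_cbox)

text \<open>Splitting of boxes and the differentiation theorem are used for the gauge integral
  \<open>integral\<close>, dominated convergence for the Lebesgue integral. The boundary of a box is
  null, so open and closed boxes are interchangeable.\<close>

lemma integral_cbox_conv:
  fixes g :: "real ^ 'n::finite \<Rightarrow> real"
  assumes g: "loc_integrable g"
  shows "g integrable_on cbox a b"
    and "integral (cbox a b) g = (LINT x|lebesgue. indicator (box a b) x * g x)"
    and "integral (cbox a b) g = (LINT x|lebesgue. indicator (cbox a b) x * g x)"
  using set_lebesgue_integral_eq_integral[OF loc_integrable_cbox[OF g, of a b]]
    set_lebesgue_integral_eq_integral[OF loc_integrable_box[OF g, of a b]]
  by (auto simp: integral_open_interval set_lebesgue_integral_def)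

lemma test_fun_integral_tendsto_box:
  fixes g :: "real ^ 'n::finite \<Rightarrow> real"
  assumes g: "loc_integrable g"
    and \<phi>: "\<And>n. test_fun (\<phi> n)" "\<And>n x. 0 \<le> \<phi> n x" "\<And>n x. \<phi> n x \<le> 1"
      "\<And>n x. x \<notin> box a b \<Longrightarrow> \<phi> n x = 0"
      "\<And>x. (\<lambda>n. \<phi> n x) \<longlonglongrightarrow> indicator (box a b) x"
  shows "(\<lambda>n. LINT x|lebesgue. \<phi> n x * g x) \<longlonglongrightarrow> integral (cbox a b) g"
  unfolding integral_cbox_conv(2)[OF g]
proof (rule integral_dominated_convergence[where w = "\<lambda>x. \<bar>indicator (box a b) x * g x\<bar>"])
  have i: "integrable lebesgue (\<lambda>x. indicator (box a b) x * g x)"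
    using loc_integrable_box[OF g, of a b] unfolding set_integrable_def by simp
  then show "integrable lebesgue (\<lambda>x. \<bar>indicator (box a b) x * g x\<bar>)"
    and "(\<lambda>x. indicator (box a b) x * g x) \<in> borel_measurable lebesgue"
    by (simp_all add: borel_measurable_integrable)
  show "(\<lambda>x. \<phi> n x * g x) \<in> borel_measurable lebesgue" for n
    using borel_measurable_integrable[OF test_fun_integrable[OF g \<phi>(1)]] by simp
  show "AE x in lebesgue. (\<lambda>n. \<phi> n x * g x) \<longlonglongrightarrow> indicator (box a b) x * g x"
    by (intro AE_I2 tendsto_mult tendsto_const \<phi>(5))
  show "AE x in lebesgue. norm (\<phi> n x * g x) \<le> \<bar>indicator (box a b) x * g x\<bar>" for n
  proof (rule AE_I2)
    fix x
    have "\<bar>\<phi> n x\<bar> \<le> indicator (box a b) x"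
      using \<phi>(2,3)[of n x] \<phi>(4)[of x n] by (auto simp: indicator_def)
    then have "\<bar>\<phi> n x\<bar> * \<bar>g x\<bar> \<le> indicator (box a b) x * \<bar>g x\<bar>" by (rule mult_right_mono) simp
    then show "norm (\<phi> n x * g x) \<le> \<bar>indicator (box a b) x * g x\<bar>" by (simp add: abs_mult)
  qed
qed

text \<open>Testing with approximations of indicators shows that the integral over every box
  vanishes; Lebesgue differentiation then recovers \<open>g\<close> from these integrals almost
  everywhere.\<close>

theorem fundamental_lemma_calculus_of_variations:
  fixes g :: "real ^ 'n::finite \<Rightarrow> real"
  assumes g: "loc_integrable g" and zero: "\<And>\<phi>. test_fun \<phi> \<Longrightarrow> (LINT x|lebesgue. \<phi> x * g x) = 0"
  shows "AE x in lebesgue. g x = 0"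
proof -
  have int0: "integral (cbox a b) g = 0" for a b
  proof -
    obtain \<phi> :: "nat \<Rightarrow> real ^ 'n \<Rightarrow> real" where \<phi>: "\<And>n. test_fun (\<phi> n)" "\<And>n x. 0 \<le> \<phi> n x" "\<And>n x. \<phi> n x \<le> 1"
      "\<And>n x. x \<notin> box a b \<Longrightarrow> \<phi> n x = 0"
      "\<And>x. (\<lambda>n. \<phi> n x) \<longlonglongrightarrow> indicator (box a b) x"
      using box_indicator_approx[of a b] by metis
    from test_fun_integral_tendsto_box[OF g \<phi>] show ?thesis
      by (simp add: zero \<phi>(1) LIMSEQ_const_iff)
  qed
  obtain N where N: "negligible N"
    "\<And>x e. \<lbrakk>x \<notin> N; 0 < e\<rbrakk> \<Longrightarrow> \<exists>d>0. \<forall>h. 0 < h \<and> h < d \<longrightarrow>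
       norm (integral (cbox x (x + h *\<^sub>R One)) g /\<^sub>R h ^ DIM(real ^ 'n) - g x) < e"
    using integrable_ccontinuous_explicit[of g] integral_cbox_conv(1)[OF g] by metis
  have "g x = 0" if xN: "x \<notin> N" for x
  proof (rule ccontr)
    assume "g x \<noteq> 0"
    then obtain d where "d > 0" "\<forall>h. 0 < h \<and> h < d \<longrightarrow>
       norm (integral (cbox x (x + h *\<^sub>R One)) g /\<^sub>R h ^ DIM(real ^ 'n) - g x) < \<bar>g x\<bar>"
      using N(2)[OF xN, of "\<bar>g x\<bar>"] by (meson zero_less_abs_iff)
    from spec[OF this(2), of "d/2"] this(1) show False by (simp add: int0)
  qed
  then show ?thesis using N(1) by (intro AE_I'[of N]) (auto simp: negligible_iff_null_sets)
qed

section \<open>Uniqueness of representing functions\<close>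

lemma loc_integrable_inner:
  fixes g :: "real ^ 'n::finite \<Rightarrow> 'b::euclidean_space"
  assumes "loc_integrable g" shows "loc_integrable (\<lambda>x. g x \<bullet> c)"
  unfolding loc_integrable_def set_integrable_def
proof (intro allI impI)
  fix K :: "(real ^ 'n) set" assume "compact K"
  then have "integrable lebesgue (\<lambda>x. (indicator K x *\<^sub>R g x) \<bullet> c)"
    using assms unfolding loc_integrable_def set_integrable_def by (intro integrable_inner_left) blast
  then show "integrable lebesgue (\<lambda>x. indicator K x *\<^sub>R (g x \<bullet> c))" by simp
qed

lemma loc_integrable_diff: "loc_integrable f \<Longrightarrow> loc_integrable g \<Longrightarrow> loc_integrable (\<lambda>x. f x - g x)"
  unfolding loc_integrable_def set_integrable_def by (simp add: scaleR_diff_right)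

lemma dist_of_inner:
  fixes g :: "real ^ 'n::finite \<Rightarrow> 'b::euclidean_space"
  assumes "loc_integrable g" "test_fun \<phi>"
  shows "dist_of g \<phi> \<bullet> c = (LINT x|lebesgue. \<phi> x * (g x \<bullet> c))"
  unfolding dist_of_def using test_fun_integrable[OF assms]
  by (cases "c = 0") (simp_all flip: integral_inner_left)

text \<open>Because of this a representing function picked by \<open>SOME\<close> can be estimated
  through any explicit representative. The scalar fundamental lemma is applied to each
  component.\<close>

lemma represents_unique:
  fixes g g' :: "real ^ 'n::finite \<Rightarrow> 'b::euclidean_space"
  assumes g: "represents g T" and g': "represents g' T"
  shows "AE x in lebesgue. g x = g' x"
proof -
  have "AE x in lebesgue. (g x \<bullet> b - g' x \<bullet> b) = 0" for b
  proof (rule fundamental_lemma_calculus_of_variations)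
    show "loc_integrable (\<lambda>x. g x \<bullet> b - g' x \<bullet> b)"
      using g g' unfolding represents_def by (intro loc_integrable_diff loc_integrable_inner) auto
    fix \<phi> :: "real ^ 'n \<Rightarrow> real" assume \<phi>: "test_fun \<phi>"
    have l: "loc_integrable (\<lambda>x. g x \<bullet> b)" "loc_integrable (\<lambda>x. g' x \<bullet> b)"
      using g g' unfolding represents_def by (auto intro: loc_integrable_inner)
    have "(LINT x|lebesgue. \<phi> x * (g x \<bullet> b - g' x \<bullet> b))
        = (LINT x|lebesgue. \<phi> x * (g x \<bullet> b)) - (LINT x|lebesgue. \<phi> x * (g' x \<bullet> b))"
      using test_fun_integrable[OF l(1) \<phi>] test_fun_integrable[OF l(2) \<phi>] by (simp add: right_diff_distrib)
    also have "\<dots> = dist_of g \<phi> \<bullet> b - dist_of g' \<phi> \<bullet> b"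
      using g g' by (simp only: represents_def dist_of_inner[OF _ \<phi>])
    also have "\<dots> = 0" using g g' \<phi> unfolding represents_def by simp
    finally show "(LINT x|lebesgue. \<phi> x * (g x \<bullet> b - g' x \<bullet> b)) = 0" .
  qed
  then have "AE x in lebesgue. \<forall>b\<in>Basis. g x \<bullet> b - g' x \<bullet> b = 0"
    by (intro AE_finite_allI) auto
  then show ?thesis by eventually_elim (auto intro: euclidean_eqI)
qed

text \<open>A weak derivative gives no pointwise fundamental theorem of calculus, so the shift is
  put on test functions approximating the indicator of the box. Their pairing with \<open>v\<close>
  is differentiable in the shift, with a derivative that is a pairing with \<open>g\<close>; the
  mean value inequality passes to the limit.\<close>

lemma integral_shifted_box_diff_le:
  fixes v g :: "real ^ 'n::finite \<Rightarrow> real"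
  assumes v: "loc_integrable v" and g: "loc_integrable g"
    and weak: "\<And>\<phi>. test_fun \<phi> \<Longrightarrow> (LINT x|lebesgue. \<phi> x * g x) = - (LINT x|lebesgue. partial i \<phi> x * v x)"
    and h: "h \<ge> 0"
  shows "\<bar>integral (cbox (a + h *\<^sub>R axis i 1) (b + h *\<^sub>R axis i 1)) v - integral (cbox a b) v\<bar>
     \<le> h * integral (cbox a (b + h *\<^sub>R axis i 1)) (\<lambda>x. \<bar>g x\<bar>)"
proof -
  let ?e = "axis i 1 :: real ^ 'n"
  obtain \<phi> :: "nat \<Rightarrow> real ^ 'n \<Rightarrow> real" where \<phi>: "\<And>n. test_fun (\<phi> n)" "\<And>n x. 0 \<le> \<phi> n x" "\<And>n x. \<phi> n x \<le> 1"
      "\<And>n x. x \<notin> box a b \<Longrightarrow> \<phi> n x = 0"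
      "\<And>x. (\<lambda>n. \<phi> n x) \<longlonglongrightarrow> indicator (box a b) x"
    using box_indicator_approx[of a b] by metis
  have mem: "x - h *\<^sub>R ?e \<in> box a b \<longleftrightarrow> x \<in> box (a + h *\<^sub>R ?e) (b + h *\<^sub>R ?e)" for x
    by (auto simp: mem_box_cart algebra_simps)
  have lim0: "(\<lambda>n. LINT x|lebesgue. \<phi> n x * v x) \<longlonglongrightarrow> integral (cbox a b) v"
    by (rule test_fun_integral_tendsto_box[OF v \<phi>])
  have "(\<lambda>n. \<phi> n (x - h *\<^sub>R ?e)) \<longlonglongrightarrow> indicator (box (a + h *\<^sub>R ?e) (b + h *\<^sub>R ?e)) x" for x
    using \<phi>(5)[of "x - h *\<^sub>R ?e"] mem[of x] by (simp add: indicator_def)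
  then have limh: "(\<lambda>n. LINT x|lebesgue. \<phi> n (x - h *\<^sub>R ?e) * v x) \<longlonglongrightarrow>
      integral (cbox (a + h *\<^sub>R ?e) (b + h *\<^sub>R ?e)) v"
    using test_fun_translate[OF \<phi>(1), of _ "- h *\<^sub>R ?e"]
    by (intro test_fun_integral_tendsto_box[OF v]) (use \<phi> mem in auto)
  have ga: "loc_integrable (\<lambda>x. \<bar>g x\<bar>)"
    using g unfolding loc_integrable_def by (auto intro: set_integrable_abs)
  have bound: "\<bar>(LINT x|lebesgue. \<phi> n (x - h *\<^sub>R ?e) * v x) - (LINT x|lebesgue. \<phi> n x * v x)\<bar>
     \<le> h * integral (cbox a (b + h *\<^sub>R ?e)) (\<lambda>x. \<bar>g x\<bar>)" for n
  proof -
    let ?I = "integral (cbox a (b + h *\<^sub>R ?e)) (\<lambda>x. \<bar>g x\<bar>)"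
    \<comment> \<open>The parameter runs over [-h, 0] because moving the box forward by h means
      evaluating the test function at x - h e.\<close>
    have D: "((\<lambda>s. LINT x|lebesgue. \<phi> n (x + s *\<^sub>R ?e) * v x) has_real_derivative
        (LINT x|lebesgue. partial i (\<phi> n) (x + s *\<^sub>R ?e) * v x)) (at s within {-h..0})" for s
      by (rule has_field_derivative_at_within) (rule has_real_derivative_test_fun_integral[OF v \<phi>(1)])
    have B: "\<bar>LINT x|lebesgue. partial i (\<phi> n) (x + s *\<^sub>R ?e) * v x\<bar> \<le> ?I" if s: "s \<in> {-h..0}" for s
    proof -
      have t: "test_fun (\<lambda>x. \<phi> n (x + s *\<^sub>R ?e))" by (rule test_fun_translate[OF \<phi>(1)])
      have p: "partial i (\<lambda>x. \<phi> n (x + s *\<^sub>R ?e)) x = partial i (\<phi> n) (x + s *\<^sub>R ?e)" for x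
        by (rule partial_translate) (rule test_fun_differentiable[OF \<phi>(1)])
      have "\<bar>LINT x|lebesgue. partial i (\<phi> n) (x + s *\<^sub>R ?e) * v x\<bar> = \<bar>LINT x|lebesgue. \<phi> n (x + s *\<^sub>R ?e) * g x\<bar>"
        using weak[OF t] by (simp add: p)
      also have "\<dots> \<le> (LINT x|lebesgue. \<bar>\<phi> n (x + s *\<^sub>R ?e) * g x\<bar>)"
        by (rule integral_abs_bound)
      also have "\<dots> \<le> (LINT x|lebesgue. indicator (cbox a (b + h *\<^sub>R ?e)) x * \<bar>g x\<bar>)"
      proof (rule integral_mono)
        show "integrable lebesgue (\<lambda>x. \<bar>\<phi> n (x + s *\<^sub>R ?e) * g x\<bar>)"
          using test_fun_integrable[OF g t] by simp
        show "integrable lebesgue (\<lambda>x. indicator (cbox a (b + h *\<^sub>R ?e)) x * \<bar>g x\<bar>)"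
          using loc_integrable_cbox[OF ga] unfolding set_integrable_def by simp
        fix x
        \<comment> \<open>For s in [-h, 0] the shifted support stays in the region swept out by the
          moving box.\<close>
        have "\<bar>\<phi> n (x + s *\<^sub>R ?e)\<bar> \<le> indicator (cbox a (b + h *\<^sub>R ?e)) x"
        proof (cases "x + s *\<^sub>R ?e \<in> box a b")
          case True
          have "x \<in> cbox a (b + h *\<^sub>R ?e)"
            unfolding mem_box_cart
          proof
            fix j
            have "a $ j < x $ j + s * axis i 1 $ j" "x $ j + s * axis i 1 $ j < b $ j"
              using True unfolding mem_box_cart by (auto dest: spec[of _ j])
            then show "a $ j \<le> x $ j \<and> x $ j \<le> (b + h *\<^sub>R ?e) $ j"
              using s h by (auto simp: axis_def split: if_splits)
          qed
          then show ?thesis using \<phi>(2,3)[of n "x + s *\<^sub>R ?e"] by simp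
        qed (simp add: \<phi>(4))
        then have "\<bar>\<phi> n (x + s *\<^sub>R ?e)\<bar> * \<bar>g x\<bar> \<le> indicator (cbox a (b + h *\<^sub>R ?e)) x * \<bar>g x\<bar>"
          by (rule mult_right_mono) simp
        then show "\<bar>\<phi> n (x + s *\<^sub>R ?e) * g x\<bar> \<le> indicator (cbox a (b + h *\<^sub>R ?e)) x * \<bar>g x\<bar>"
          by (simp add: abs_mult)
      qed
      also have "\<dots> = ?I" by (rule integral_cbox_conv(3)[OF ga, symmetric])
      finally show ?thesis .
    qed
    have "norm ((LINT x|lebesgue. \<phi> n (x + (-h) *\<^sub>R ?e) * v x) - (LINT x|lebesgue. \<phi> n (x + 0 *\<^sub>R ?e) * v x))
       \<le> ?I * norm (-h - 0)"
      by (rule field_differentiable_bound[of "{-h..0}", OF _ D]) (use B h in auto)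
    then show ?thesis using h by (simp add: mult.commute)
  qed
  show ?thesis
    by (rule LIMSEQ_le_const2[OF tendsto_rabs[OF tendsto_diff[OF limh lim0]]]) (use bound in auto)
qed

section \<open>Averages over squares\<close>

text \<open>On a set of finite measure |u| is dominated by the integrable function 1 +
  |u|^2.\<close>

lemma L2_imp_loc_integrable:
  fixes u :: "R2 \<Rightarrow> 'b::euclidean_space"
  assumes "u \<in> L2" shows "loc_integrable u"
  unfolding loc_integrable_def set_integrable_def
proof (intro allI impI)
  fix K :: "R2 set" assume K: "compact K"
  have um: "u \<in> borel_measurable lebesgue" and ui: "integrable lebesgue (\<lambda>x. (norm (u x))\<^sup>2)"
    using assms unfolding L2_def by auto
  have Km: "K \<in> sets lebesgue" and Kf: "emeasure lebesgue K < \<infinity>"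
    using K lmeasurable_compact[OF K] by (auto simp: fmeasurable_def)
  show "integrable lebesgue (\<lambda>x. indicator K x *\<^sub>R u x)"
  proof (rule Bochner_Integration.integrable_bound)
    show "integrable lebesgue (\<lambda>x. indicator K x + (norm (u x))\<^sup>2)"
      using ui Km Kf by (intro Bochner_Integration.integrable_add) auto
    show "(\<lambda>x. indicator K x *\<^sub>R u x) \<in> borel_measurable lebesgue"
      using um Km by measurable
    have "\<bar>t\<bar> \<le> 1 + t\<^sup>2" for t :: real
    proof -
      have "0 \<le> (\<bar>t\<bar> - 1)\<^sup>2" "0 \<le> t\<^sup>2" by simp_all
      moreover have "(\<bar>t\<bar> - 1)\<^sup>2 = t\<^sup>2 - 2 * \<bar>t\<bar> + 1" by (simp add: power2_diff)
      ultimately show ?thesis by linarith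
    qed
    from this[of "norm (u x)" for x]
    show "AE x in lebesgue. norm (indicator K x *\<^sub>R u x) \<le> norm (indicator K x + (norm (u x))\<^sup>2)"
      by (auto simp: indicator_def)
  qed
qed

lemma axis_in_Basis_real: "(axis i 1 :: real ^ 'n::finite) \<in> Basis"
  by (simp add: axis_in_Basis_iff)

text \<open>Since \<open>h\<close> is the side of the box in direction \<open>i\<close>, the doubled
  box consists of the box and its translate by \<open>h\<close>; the difference is that between the
  integrals over these two halves.\<close>

lemma integral_doubled_box_diff_le:
  fixes v g :: "real ^ 'n::finite \<Rightarrow> real"
  assumes v: "loc_integrable v" and g: "loc_integrable g"
    and weak: "\<And>\<phi>. test_fun \<phi> \<Longrightarrow> (LINT x|lebesgue. \<phi> x * g x) = - (LINT x|lebesgue. partial i \<phi> x * v x)"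
    and h: "h \<ge> 0" "b $ i = a $ i + h"
  shows "\<bar>integral (cbox a (b + h *\<^sub>R axis i 1)) v - 2 * integral (cbox a b) v\<bar>
     \<le> h * integral (cbox a (b + h *\<^sub>R axis i 1)) (\<lambda>x. \<bar>g x\<bar>)"
proof -
  let ?e = "axis i 1 :: real ^ 'n" and ?b' = "b + h *\<^sub>R axis i 1"
  have inner: "x \<bullet> ?e = x $ i" for x :: "real ^ 'n" by (simp add: inner_axis)
  have bi: "(b + h *\<^sub>R ?e) $ j = (if j = i then b $ i + h else b $ j)" for j
    by (simp add: axis_def)
  have "x \<in> cbox a ?b' \<and> x $ i \<le> b $ i \<longleftrightarrow> x \<in> cbox a b" for x
  proof
    assume A: "x \<in> cbox a ?b' \<and> x $ i \<le> b $ i"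
    have "a $ j \<le> x $ j \<and> x $ j \<le> b $ j" for j
      using A[THEN conjunct1, unfolded mem_box_cart bi, THEN spec, of j] A by (cases "j = i") auto
    then show "x \<in> cbox a b" by (simp add: mem_box_cart)
  next
    assume A: "x \<in> cbox a b"
    have "a $ j \<le> x $ j \<and> x $ j \<le> ?b' $ j" for j
      using A[unfolded mem_box_cart, THEN spec, of j] h(1) by (auto simp: axis_def)
    then show "x \<in> cbox a ?b' \<and> x $ i \<le> b $ i" using A by (simp add: mem_box_cart)
  qed
  then have 1: "cbox a ?b' \<inter> {x. x \<bullet> ?e \<le> b $ i} = cbox a b" unfolding inner by blast
  have "x \<in> cbox a ?b' \<and> b $ i \<le> x $ i \<longleftrightarrow> x \<in> cbox (a + h *\<^sub>R ?e) ?b'" for x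
  proof
    assume A: "x \<in> cbox a ?b' \<and> b $ i \<le> x $ i"
    have "(a + h *\<^sub>R ?e) $ j \<le> x $ j \<and> x $ j \<le> ?b' $ j" for j
      using A[THEN conjunct1, unfolded mem_box_cart, THEN spec, of j] A h by (cases "j = i") (auto simp: axis_def)
    then show "x \<in> cbox (a + h *\<^sub>R ?e) ?b'" by (simp add: mem_box_cart)
  next
    assume A: "x \<in> cbox (a + h *\<^sub>R ?e) ?b'"
    have "a $ j \<le> x $ j \<and> x $ j \<le> ?b' $ j" for j
      using A[unfolded mem_box_cart, THEN spec, of j] h by (cases "j = i") (auto simp: axis_def)
    then show "x \<in> cbox a ?b' \<and> b $ i \<le> x $ i"
      using A[unfolded mem_box_cart, THEN spec, of i] h by (simp add: mem_box_cart)
  qed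
  then have 2: "cbox a ?b' \<inter> {x. x \<bullet> ?e \<ge> b $ i} = cbox (a + h *\<^sub>R ?e) ?b'" unfolding inner by blast
  have "integral (cbox a ?b') v = integral (cbox a b) v + integral (cbox (a + h *\<^sub>R ?e) ?b') v"
    using integral_split[OF integral_cbox_conv(1)[OF v, of a ?b'] axis_in_Basis_real[of i], of "b $ i"]
    unfolding 1 2 .
  then show ?thesis using integral_shifted_box_diff_le[OF v g weak h(1), of a b] by simp
qed

lemma sum_Basis_nth: "(\<Sum>x\<in>(Basis :: (real ^ 'n::finite) set). x $ i) = 1"
  using inner_sum_left_Basis[OF axis_in_Basis_real[of i], of "\<lambda>_. 1"] by (simp add: inner_axis)

abbreviation square :: "R2 \<Rightarrow> real \<Rightarrow> R2 set" where
  "square x h \<equiv> cbox x (x + h *\<^sub>R One)"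

lemma mem_square: "y \<in> square x h \<longleftrightarrow> (\<forall>i. x $ i \<le> y $ i \<and> y $ i \<le> x $ i + h)"
  by (simp add: mem_box_cart sum_Basis_nth)

text \<open>The square is doubled along the first axis and then along the second. Each doubling has
  an error of h times the integral of \<open>p\<close>, and the second one doubles the error of the
  first: 2 + 1 = 3.\<close>

lemma integral_doubled_square_diff_le:
  fixes v g1 g2 :: "R2 \<Rightarrow> real"
  assumes v: "loc_integrable v" and g: "loc_integrable g1" "loc_integrable g2" and p: "loc_integrable p"
    and weak1: "\<And>\<phi>. test_fun \<phi> \<Longrightarrow> (LINT x|lebesgue. \<phi> x * g1 x) = - (LINT x|lebesgue. partial 1 \<phi> x * v x)"
    and weak2: "\<And>\<phi>. test_fun \<phi> \<Longrightarrow> (LINT x|lebesgue. \<phi> x * g2 x) = - (LINT x|lebesgue. partial 2 \<phi> x * v x)"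
    and le: "\<And>x. \<bar>g1 x\<bar> \<le> p x" "\<And>x. \<bar>g2 x\<bar> \<le> p x"
    and h: "h \<ge> 0"
  shows "\<bar>integral (square x (2 * h)) v - 4 * integral (square x h) v\<bar> \<le> 3 * h * integral (square x (2 * h)) p"
proof -
  let ?b = "x + h *\<^sub>R One :: R2" and ?e = "\<lambda>i. axis i 1 :: R2"
  have b1: "?b $ 1 = x $ 1 + h" and b2: "(?b + h *\<^sub>R ?e 1) $ 2 = x $ 2 + h"
    using one_neq_zero[where 'a = 2] by (simp_all add: sum_Basis_nth axis_def)
  have b12: "?b + h *\<^sub>R ?e 1 + h *\<^sub>R ?e 2 = x + (2 * h) *\<^sub>R One"
    by (simp add: vec_eq_iff sum_Basis_nth axis_def forall_2)
  have abs: "loc_integrable (\<lambda>x. \<bar>g1 x\<bar>)" "loc_integrable (\<lambda>x. \<bar>g2 x\<bar>)"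
    using g unfolding loc_integrable_def by (auto intro: set_integrable_abs)
  have sub: "cbox x (?b + h *\<^sub>R ?e 1) \<subseteq> square x (2 * h)"
    using h by (auto simp: mem_box_cart sum_Basis_nth axis_def forall_2)
  have p0: "0 \<le> p y" for y using le(1)[of y] by linarith
  have I1: "integral (cbox x (?b + h *\<^sub>R ?e 1)) (\<lambda>x. \<bar>g1 x\<bar>) \<le> integral (square x (2 * h)) p"
  proof -
    have "integral (cbox x (?b + h *\<^sub>R ?e 1)) (\<lambda>x. \<bar>g1 x\<bar>) \<le> integral (square x (2 * h)) (\<lambda>x. \<bar>g1 x\<bar>)"
      by (rule integral_subset_le[OF sub]) (use integral_cbox_conv(1)[OF abs(1)] in auto)
    also have "\<dots> \<le> integral (square x (2 * h)) p"
      by (rule Henstock_Kurzweil_Integration.integral_le) (use integral_cbox_conv(1) abs p le in auto)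
    finally show ?thesis .
  qed
  have I2: "integral (square x (2 * h)) (\<lambda>x. \<bar>g2 x\<bar>) \<le> integral (square x (2 * h)) p"
    by (rule Henstock_Kurzweil_Integration.integral_le) (use integral_cbox_conv(1) abs p le in auto)
  have "\<bar>integral (cbox x (?b + h *\<^sub>R ?e 1)) v - 2 * integral (cbox x ?b) v\<bar>
     \<le> h * integral (square x (2 * h)) p"
    using integral_doubled_box_diff_le[OF v g(1) weak1 h b1] mult_left_mono[OF I1 h] by linarith
  moreover have "\<bar>integral (square x (2 * h)) v - 2 * integral (cbox x (?b + h *\<^sub>R ?e 1)) v\<bar>
     \<le> h * integral (square x (2 * h)) p"
    using integral_doubled_box_diff_le[OF v g(2) weak2 h b2] mult_left_mono[OF I2 h] unfolding b12 by linarith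
  ultimately show ?thesis by (simp add: algebra_simps abs_le_iff)
qed

lemma measure_square: "h \<ge> 0 \<Longrightarrow> measure lebesgue (square x h) = h\<^sup>2"
proof -
  assume "h \<ge> 0"
  then have "measure lborel (square x h) = (\<Prod>b\<in>(Basis :: R2 set). h)"
    by (subst measure_lborel_cbox) (auto simp: inner_add_left inner_diff_left inner_sum_left_Basis)
  then show ?thesis by (simp add: measure_completion)
qed

text \<open>Cauchy-Schwarz against the indicator of the square, whose area supplies the factor
  \<open>h\<^sup>2\<close>.\<close>

lemma integral_square_squared_le:
  fixes p :: "R2 \<Rightarrow> real"
  assumes p: "p \<in> borel_measurable lebesgue" "integrable lebesgue (\<lambda>x. (p x)\<^sup>2)" and pl: "loc_integrable p"
    and h: "h \<ge> 0"
  shows "(integral (square x h) p)\<^sup>2 \<le> h\<^sup>2 * (LINT y|lebesgue. indicator (square x h) y * (p y)\<^sup>2)"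
proof -
  have ind2: "(indicator (square x h) y)\<^sup>2 = (indicator (square x h) y :: real)" for y
    by (simp add: indicator_def)
  have m: "(\<lambda>y. indicator (square x h) y :: real) \<in> borel_measurable lebesgue"
    by (intro borel_measurable_indicator fmeasurableD lmeasurable_cbox)
  have 1: "integrable lebesgue (\<lambda>y. (indicator (square x h) y :: real)\<^sup>2)"
    unfolding ind2 using lmeasurable_cbox[of x "x + h *\<^sub>R One"] by (auto simp: fmeasurable_def)
  have 2: "integrable lebesgue (\<lambda>y. (indicator (square x h) y * p y)\<^sup>2)"
    using integrable_mult_indicator[OF _ p(2), of "square x h"] by (simp add: power_mult_distrib ind2)
  have "(LINT y|lebesgue. indicator (square x h) y * (indicator (square x h) y * p y))\<^sup>2
    \<le> (LINT y|lebesgue. (indicator (square x h) y)\<^sup>2) * (LINT y|lebesgue. (indicator (square x h) y * p y)\<^sup>2)"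
    by (rule integral_mult_squared_le(2)[OF m _ 1 2]) (use p m in measurable)
  also have "(\<lambda>y. indicator (square x h) y * (indicator (square x h) y * p y)) = (\<lambda>y. indicator (square x h) y * p y)"
    by (auto simp: indicator_def)
  also have "(LINT y|lebesgue. (indicator (square x h) y :: real)\<^sup>2) = h\<^sup>2"
    unfolding ind2 using measure_square[OF h, of x] by simp
  finally show ?thesis unfolding integral_cbox_conv(3)[OF pl] by (simp add: power_mult_distrib ind2)
qed

text \<open>By Tonelli each point y is weighted with the measure of the set of corners x whose
  square contains y, and this set is again a square of side \<open>h\<close>.\<close>

lemma nn_integral_square_average:
  fixes q :: "R2 \<Rightarrow> ennreal"
  assumes [measurable]: "q \<in> borel_measurable borel" and h: "h \<ge> 0"
  shows measurable_square_average:
      "(\<lambda>x. \<integral>\<^sup>+y. indicator (square x h) y * q y \<partial>lborel) \<in> borel_measurable borel"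
    and "(\<integral>\<^sup>+x. (\<integral>\<^sup>+y. indicator (square x h) y * q y \<partial>lborel) \<partial>lborel) = ennreal (h\<^sup>2) * (\<integral>\<^sup>+y. q y \<partial>lborel)"
proof -
  have "{p :: R2 \<times> R2. snd p \<in> square (fst p) h} = (\<Inter>i. {p. fst p $ i \<le> snd p $ i} \<inter> {p. snd p $ i \<le> fst p $ i + h})"
    by (auto simp: mem_square)
  also have "closed \<dots>"
    by (intro closed_INT ballI closed_Int closed_Collect_le continuous_intros)
  finally have "{p :: R2 \<times> R2. snd p \<in> square (fst p) h} \<in> sets borel" by (rule borel_closed)
  then have S: "{p :: R2 \<times> R2. snd p \<in> square (fst p) h} \<in> sets (borel \<Otimes>\<^sub>M borel)" unfolding borel_prod .
  have "(\<lambda>p. indicator {p. snd p \<in> square (fst p) h} p * q (snd p)) \<in> borel_measurable (borel \<Otimes>\<^sub>M borel)"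
    using S by measurable
  also have "(\<lambda>p. indicator {p. snd p \<in> square (fst p) h} p * q (snd p)) = (\<lambda>(x, y). indicator (square x h) y * q y)"
    by (auto simp: indicator_def)
  finally have M: "(\<lambda>(x, y). indicator (square x h) y * q y) \<in> borel_measurable (borel \<Otimes>\<^sub>M borel)" .
  then have M': "(\<lambda>(x, y). indicator (square x h) y * q y) \<in> borel_measurable (lborel \<Otimes>\<^sub>M lborel)"
    by (simp cong: measurable_cong_sets)
  then show "(\<lambda>x. \<integral>\<^sup>+y. indicator (square x h) y * q y \<partial>lborel) \<in> borel_measurable borel"
    using lborel.borel_measurable_nn_integral[of "\<lambda>x y. indicator (square x h) y * q y" lborel] by simp
  have "(\<integral>\<^sup>+x. (\<integral>\<^sup>+y. indicator (square x h) y * q y \<partial>lborel) \<partial>lborel)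
      = (\<integral>\<^sup>+y. (\<integral>\<^sup>+x. indicator (square x h) y * q y \<partial>lborel) \<partial>lborel)"
    by (rule lborel_pair.Fubini'[OF M', symmetric])
  also have "\<dots> = (\<integral>\<^sup>+y. ennreal (h\<^sup>2) * q y \<partial>lborel)"
  proof (rule nn_integral_cong)
    fix y :: R2
    have "indicator (square x h) y = (indicator (square (y - h *\<^sub>R One) h) x :: ennreal)" for x
      by (auto simp: indicator_def mem_box_cart sum_Basis_nth algebra_simps)
    then have "(\<integral>\<^sup>+x. indicator (square x h) y * q y \<partial>lborel) = emeasure lborel (square (y - h *\<^sub>R One) h) * q y"
      by (simp add: nn_integral_multc)
    also have "emeasure lborel (square (y - h *\<^sub>R One) h) = ennreal (h\<^sup>2)"
      using measure_square[OF h, of "y - h *\<^sub>R One"] emeasure_lborel_cbox_finite[of "y - h *\<^sub>R One" y]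
      by (simp add: emeasure_eq_ennreal_measure measure_completion)
    finally show "(\<integral>\<^sup>+x. indicator (square x h) y * q y \<partial>lborel) = ennreal (h\<^sup>2) * q y" .
  qed
  finally show "(\<integral>\<^sup>+x. (\<integral>\<^sup>+y. indicator (square x h) y * q y \<partial>lborel) \<partial>lborel) = ennreal (h\<^sup>2) * (\<integral>\<^sup>+y. q y \<partial>lborel)"
    by (simp add: nn_integral_cmult)
qed

section \<open>N-functions with the doubling property\<close>

locale doubling_N_function =
  fixes \<Phi> :: "real \<Rightarrow> real"
  assumes N: "N_function \<Phi>" and D2: "Delta2 \<Phi>" and N2: "((\<lambda>t. \<Phi> t / t\<^sup>2) \<longlongrightarrow> 0) (at 0)"
begin

lemma convex: "convex_on UNIV \<Phi>" and nonneg: "0 \<le> \<Phi> t"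
  using N by (simp_all add: N_function_def)

lemma continuous: "continuous_on UNIV \<Phi>"
  by (rule convex_on_continuous[OF open_UNIV convex])

text \<open>(N2) forces the limit of \<open>\<Phi>\<close> at 0 to vanish, and a convex function on
  the whole line is continuous.\<close>

lemma zero: "\<Phi> 0 = 0"
proof -
  have "((\<lambda>t. t\<^sup>2 * (\<Phi> t / t\<^sup>2)) \<longlongrightarrow> 0\<^sup>2 * 0) (at 0)" by (intro tendsto_mult tendsto_power tendsto_ident_at N2)
  moreover have "\<forall>\<^sub>F t in at 0. t\<^sup>2 * (\<Phi> t / t\<^sup>2) = \<Phi> t" by (simp add: eventually_at_filter)
  ultimately have "(\<Phi> \<longlongrightarrow> 0) (at 0)" by (simp add: tendsto_cong)
  moreover have "(\<Phi> \<longlongrightarrow> \<Phi> 0) (at 0)" using continuous by (simp add: continuous_on_def)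
  ultimately show ?thesis using tendsto_unique[of "at (0::real)" \<Phi> "\<Phi> 0" 0] by simp
qed

lemma mono: assumes "0 \<le> s" "s \<le> t" shows "\<Phi> s \<le> \<Phi> t"
proof (cases "t = 0")
  case False
  with assms have t: "t > 0" by simp
  have "\<Phi> ((1 - s/t) *\<^sub>R 0 + (s/t) *\<^sub>R t) \<le> (1 - s/t) * \<Phi> 0 + (s/t) * \<Phi> t"
    by (rule convex_onD[OF convex]) (use assms t in auto)
  then have "\<Phi> s \<le> (s/t) * \<Phi> t" using t by (simp add: zero)
  also have "\<dots> \<le> 1 * \<Phi> t" by (rule mult_right_mono) (use assms t nonneg in auto)
  finally show ?thesis by simp
qed (use assms in simp)

lemma dilation_bound: obtains C where "C \<ge> 0" "\<And>t. t \<ge> 0 \<Longrightarrow> \<Phi> (c * t) \<le> C * \<Phi> t"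
proof -
  obtain K where K: "K > 0" "\<And>t. \<Phi> (2 * t) \<le> K * \<Phi> t" using D2 unfolding Delta2_def by auto
  have pow: "\<Phi> (2 ^ n * t) \<le> K ^ n * \<Phi> t" for n t
  proof (induction n)
    case (Suc n)
    have "\<Phi> (2 ^ Suc n * t) \<le> K * \<Phi> (2 ^ n * t)" using K(2)[of "2 ^ n * t"] by (simp add: mult.assoc)
    also have "\<dots> \<le> K * (K ^ n * \<Phi> t)" using Suc K by (intro mult_left_mono) auto
    finally show ?case by (simp add: mult.assoc)
  qed simp
  obtain n where n: "\<bar>c\<bar> < 2 ^ n" using real_arch_pow[of 2 "\<bar>c\<bar>"] by auto
  show thesis
  proof (rule that)
    show "0 \<le> K ^ n" using K by simp
    fix t :: real assume t: "t \<ge> 0"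
    have even: "\<Phi> (- s) = \<Phi> s" for s using N unfolding N_function_def by blast
    have "\<Phi> (c * t) = \<Phi> (\<bar>c\<bar> * t)" by (cases "c \<ge> 0") (simp_all add: even)
    also have "\<dots> \<le> \<Phi> (2 ^ n * t)" using n t by (intro mono mult_right_mono mult_nonneg_nonneg) auto
    also have "\<dots> \<le> K ^ n * \<Phi> t" by (rule pow)
    finally show "\<Phi> (c * t) \<le> K ^ n * \<Phi> t" .
  qed
qed

text \<open>(1 + s) t is the convex combination of t and 2 t with weight s on the latter, so the
  doubling constant K enters only as s K. Taking s = 1 / (K + 1) makes this at most 1, which gives
  the factor 2 for 1 / r = 1 + s.\<close>

lemma small_dilation_bound: obtains r where "0 < r" "r < 1" "\<And>t. t \<ge> 0 \<Longrightarrow> \<Phi> (t / r) \<le> 2 * \<Phi> t"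
proof -
  obtain K where K: "K > 0" "\<And>t. \<Phi> (2 * t) \<le> K * \<Phi> t" using D2 unfolding Delta2_def by auto
  define s where "s = 1 / (K + 1)"
  have s: "0 < s" "s < 1" "s * K \<le> 1" using K unfolding s_def by (auto simp: field_simps)
  show thesis
  proof (rule that)
    show "0 < 1 / (1 + s)" "1 / (1 + s) < 1" using s by auto
    fix t :: real
    have "\<Phi> (t / (1 / (1 + s))) = \<Phi> ((1 - s) *\<^sub>R t + s *\<^sub>R (2 * t))" by (simp add: algebra_simps)
    also have "\<dots> \<le> (1 - s) * \<Phi> t + s * \<Phi> (2 * t)"
      by (rule convex_onD[OF convex]) (use s in auto)
    also have "s * \<Phi> (2 * t) \<le> s * (K * \<Phi> t)" using K s by (intro mult_left_mono) auto
    also have "s * (K * \<Phi> t) \<le> 1 * \<Phi> t" unfolding mult.assoc[symmetric]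
      by (rule mult_right_mono[OF s(3) nonneg])
    also have "(1 - s) * \<Phi> t \<le> 1 * \<Phi> t" using s by (intro mult_right_mono nonneg) auto
    finally show "\<Phi> (t / (1 / (1 + s))) \<le> 2 * \<Phi> t" by simp
  qed
qed

text \<open>Convexity with weights 1 - r and r separates the first summand from the rest S. Undoing
  the dilation S / r costs a factor 2 at each separation, whence the weights 2^m; the constant
  \<open>C\<close> for the separated term does not accumulate, so it is independent of
  \<open>n\<close>.\<close>

lemma sum_bound:
  obtains C where "C \<ge> 0"
    "\<And>n D. (\<And>m. D m \<ge> 0) \<Longrightarrow> \<Phi> (\<Sum>m<n. D m) \<le> C * (\<Sum>m<n. 2 ^ m * \<Phi> (D m))"
proof -
  obtain r where r: "0 < r" "r < 1" "\<And>t. t \<ge> 0 \<Longrightarrow> \<Phi> (t / r) \<le> 2 * \<Phi> t"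
    using small_dilation_bound by metis
  obtain C where C: "C \<ge> 0" "\<And>t. t \<ge> 0 \<Longrightarrow> \<Phi> (1 / (1 - r) * t) \<le> C * \<Phi> t"
    using dilation_bound[of "1 / (1 - r)"] by metis
  show thesis
  proof (rule that[OF C(1)])
    fix n and D :: "nat \<Rightarrow> real" assume "\<And>m. D m \<ge> 0"
    then show "\<Phi> (\<Sum>m<n. D m) \<le> C * (\<Sum>m<n. 2 ^ m * \<Phi> (D m))"
    proof (induction n arbitrary: D)
      case (Suc n)
      let ?S = "\<Sum>m<n. D (Suc m)"
      have S0: "?S \<ge> 0" using Suc by (intro sum_nonneg) auto
      have "\<Phi> (\<Sum>m<Suc n. D m) = \<Phi> (D 0 + ?S)" by (simp add: sum.lessThan_Suc_shift del: sum.lessThan_Suc)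
      also have "\<dots> = \<Phi> ((1 - r) *\<^sub>R (1 / (1 - r) * D 0) + r *\<^sub>R (?S / r))" using r by simp
      also have "\<dots> \<le> (1 - r) * \<Phi> (1 / (1 - r) * D 0) + r * \<Phi> (?S / r)"
        by (rule convex_onD[OF convex]) (use r in auto)
      also have "\<dots> \<le> 1 * \<Phi> (1 / (1 - r) * D 0) + 1 * \<Phi> (?S / r)"
        using r by (intro add_mono mult_right_mono nonneg) auto
      also have "\<dots> \<le> C * \<Phi> (D 0) + 2 * \<Phi> ?S" using C(2)[of "D 0"] r(3)[OF S0] Suc.prems by auto
      also have "\<dots> \<le> C * \<Phi> (D 0) + 2 * (C * (\<Sum>m<n. 2 ^ m * \<Phi> (D (Suc m))))"
        using Suc.IH[of "\<lambda>m. D (Suc m)"] Suc.prems by simp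
      also have "\<dots> = C * (\<Sum>m<Suc n. 2 ^ m * \<Phi> (D m))"
        by (simp add: sum.lessThan_Suc_shift sum_distrib_left algebra_simps del: sum.lessThan_Suc)
      finally show ?case .
    qed (simp add: zero)
  qed
qed

text \<open>(N2) settles t below some d > 0. For larger t up to \<open>B\<close>, monotonicity
  bounds \<open>\<Phi> t\<close> by \<open>\<Phi> B\<close>, and t^2 is at least d^2.\<close>

lemma quadratic_bound: obtains C where "C \<ge> 0" "\<And>t. 0 \<le> t \<Longrightarrow> t \<le> B \<Longrightarrow> \<Phi> t \<le> C * t\<^sup>2"
proof -
  have "\<forall>\<^sub>F t in at 0. \<Phi> t / t\<^sup>2 < 1" by (rule order_tendstoD[OF N2]) simp
  then obtain d where d: "d > 0" "\<And>t. t \<noteq> 0 \<Longrightarrow> \<bar>t\<bar> < d \<Longrightarrow> \<Phi> t / t\<^sup>2 < 1"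
    unfolding eventually_at by (auto simp: dist_real_def)
  show thesis
  proof (rule that)
    show "0 \<le> 1 + \<Phi> B / d\<^sup>2" using nonneg by simp
    fix t assume t: "0 \<le> t" "t \<le> B"
    show "\<Phi> t \<le> (1 + \<Phi> B / d\<^sup>2) * t\<^sup>2"
    proof (cases "t < d")
      case True
      have "\<Phi> t \<le> t\<^sup>2"
        using d(2)[of t] True t zero by (cases "t = 0") (auto simp: field_simps)
      moreover have "0 \<le> \<Phi> B / d\<^sup>2 * t\<^sup>2" using nonneg by simp
      ultimately show ?thesis by (simp add: algebra_simps)
    next
      case False
      then have "d\<^sup>2 \<le> t\<^sup>2" using d(1) by (intro power_mono) auto
      then have "1 \<le> t\<^sup>2 / d\<^sup>2" using d(1) by (simp add: field_simps)
      then have "\<Phi> B * 1 \<le> \<Phi> B * (t\<^sup>2 / d\<^sup>2)" by (rule mult_left_mono[OF _ nonneg])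
      then show ?thesis using mono[OF t] by (simp add: algebra_simps) (smt (verit) zero_le_power2)
    qed
  qed
qed

end

section \<open>Embedding of the Sobolev space into the Orlicz space\<close>

lemma H1_weak_gradient:
  assumes "v \<in> H1"
  obtains G where "G \<in> L2" "loc_integrable G"
    "\<And>\<phi> i. test_fun \<phi> \<Longrightarrow> (LINT x|lebesgue. \<phi> x * G x $ i) = - (LINT x|lebesgue. partial i \<phi> x * v x)"
proof -
  obtain G where G: "G \<in> L2" "represents G (dgrad v)" using assms unfolding H1_def by auto
  show thesis
  proof (rule that[OF G(1)])
    show l: "loc_integrable G" using G(2) unfolding represents_def by blast
    fix \<phi> :: "R2 \<Rightarrow> real" and i assume \<phi>: "test_fun \<phi>"
    have "(LINT x|lebesgue. \<phi> x * G x $ i) = dist_of G \<phi> \<bullet> axis i 1"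
      unfolding dist_of_inner[OF l \<phi>] by (simp add: inner_axis)
    also have "\<dots> = dgrad v \<phi> \<bullet> axis i 1" using G(2) \<phi> unfolding represents_def by simp
    also have "\<dots> = - (LINT x|lebesgue. partial i \<phi> x * v x)"
      by (simp add: inner_axis dgrad_def dpartial_def dist_of_def)
    finally show "(LINT x|lebesgue. \<phi> x * G x $ i) = - (LINT x|lebesgue. partial i \<phi> x * v x)" .
  qed
qed

text \<open>The estimate is scale invariant in two dimensions. With P the integral of |G| over the
  large square and S that of |G|^2, doubling costs 3 h P and Cauchy-Schwarz gives P^2 \<le> (2 h)^2
  S; dividing by the area 4 h^2 leaves (9/4) S, rounded up to 3 S.\<close>

lemma square_average_increment_le:
  fixes v :: "R2 \<Rightarrow> real" and G :: "R2 \<Rightarrow> R2"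
  assumes v: "loc_integrable v" and G: "G \<in> L2"
    and weak: "\<And>\<phi> i. test_fun \<phi> \<Longrightarrow> (LINT x|lebesgue. \<phi> x * G x $ i) = - (LINT x|lebesgue. partial i \<phi> x * v x)"
    and h: "h > 0"
  shows "(integral (square x h) v / h\<^sup>2 - integral (square x (2 * h)) v / (2 * h)\<^sup>2)\<^sup>2
    \<le> 3 * (LINT y|lebesgue. indicator (square x (2 * h)) y * (norm (G y))\<^sup>2)"
proof -
  have Gm: "G \<in> borel_measurable lebesgue" "integrable lebesgue (\<lambda>x. (norm (G x))\<^sup>2)"
    using G unfolding L2_def by auto
  have "(\<lambda>x. norm (G x)) \<in> L2" using Gm unfolding L2_def by simp
  then have pl: "loc_integrable (\<lambda>x. norm (G x))" by (rule L2_imp_loc_integrable)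
  have Gl: "loc_integrable (\<lambda>x. G x $ i)" for i
    using loc_integrable_inner[OF L2_imp_loc_integrable[OF G], of "axis i 1"] by (simp add: inner_axis)
  let ?P = "integral (square x (2 * h)) (\<lambda>x. norm (G x))"
  let ?S = "LINT y|lebesgue. indicator (square x (2 * h)) y * (norm (G y))\<^sup>2"
  have le: "\<bar>integral (square x (2 * h)) v - 4 * integral (square x h) v\<bar> \<le> 3 * h * ?P"
    by (rule integral_doubled_square_diff_le[OF v Gl Gl pl weak weak])
      (use h in \<open>auto simp: component_le_norm_cart\<close>)
  have P: "?P\<^sup>2 \<le> (2 * h)\<^sup>2 * ?S"
    by (rule integral_square_squared_le[OF _ Gm(2) pl]) (use Gm(1) h in auto)
  have S0: "?S \<ge> 0" by (rule integral_nonneg_AE) simp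
  have "(integral (square x h) v / h\<^sup>2 - integral (square x (2 * h)) v / (2 * h)\<^sup>2)
      = - ((integral (square x (2 * h)) v - 4 * integral (square x h) v) / (4 * h\<^sup>2))"
    using h by (simp add: field_simps power2_eq_square)
  then have "(integral (square x h) v / h\<^sup>2 - integral (square x (2 * h)) v / (2 * h)\<^sup>2)\<^sup>2
      = \<bar>integral (square x (2 * h)) v - 4 * integral (square x h) v\<bar>\<^sup>2 / (4 * h\<^sup>2)\<^sup>2"
    by (simp add: power_divide)
  also have "\<dots> \<le> (3 * h * ?P)\<^sup>2 / (4 * h\<^sup>2)\<^sup>2"
    using le by (intro divide_right_mono power_mono) auto
  also have "\<dots> = 9 * ?P\<^sup>2 / (16 * h\<^sup>2)"
    using h by (simp add: power2_eq_square field_simps)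
  also have "\<dots> \<le> 9 * ((2 * h)\<^sup>2 * ?S) / (16 * h\<^sup>2)"
    using P by (intro divide_right_mono mult_left_mono) auto
  also have "\<dots> = 9 / 4 * ?S" using h by (simp add: power2_eq_square field_simps)
  also have "\<dots> \<le> 3 * ?S" using S0 by simp
  finally show ?thesis .
qed

text \<open>Lebesgue differentiation along squares that have \<open>x\<close> as a corner, with the
  dyadic sides used in the telescoping sum.\<close>

lemma square_averages_tendsto:
  fixes v :: "R2 \<Rightarrow> real"
  assumes v: "loc_integrable v"
  shows "AE x in lebesgue. (\<lambda>n. integral (square x (1 / 2 ^ n)) v / (1 / 2 ^ n)\<^sup>2) \<longlonglongrightarrow> v x"
proof -
  obtain N where N: "negligible N"
    "\<And>x e. \<lbrakk>x \<notin> N; 0 < e\<rbrakk> \<Longrightarrow> \<exists>d>0. \<forall>h. 0 < h \<and> h < d \<longrightarrow>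
       norm (integral (square x h) v /\<^sub>R h ^ DIM(R2) - v x) < e"
    using integrable_ccontinuous_explicit[of v] integral_cbox_conv(1)[OF v] by metis
  have "(\<lambda>n. integral (square x (1 / 2 ^ n)) v / (1 / 2 ^ n)\<^sup>2) \<longlonglongrightarrow> v x" if xN: "x \<notin> N" for x
  proof (rule tendstoI)
    fix e :: real assume "e > 0"
    then obtain d where d: "d > 0" "\<And>h. 0 < h \<and> h < d \<Longrightarrow>
       norm (integral (square x h) v /\<^sub>R h ^ DIM(R2) - v x) < e" using N(2)[OF xN] by metis
    have "(\<lambda>n. 1 / 2 ^ n :: real) \<longlonglongrightarrow> 0" by real_asymp
    then have "\<forall>\<^sub>F n in sequentially. 1 / 2 ^ n < d" by (rule order_tendstoD) (rule d)
    then show "\<forall>\<^sub>F n in sequentially. dist (integral (square x (1 / 2 ^ n)) v / (1 / 2 ^ n)\<^sup>2) (v x) < e"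
    proof eventually_elim
      case (elim n)
      then show ?case using d(2)[of "1 / 2 ^ n"] by (simp add: dist_real_def divide_inverse mult.commute)
    qed
  qed
  then show ?thesis using N(1) by (intro AE_I'[of N]) (auto simp: negligible_iff_null_sets)
qed

context doubling_N_function
begin

text \<open>
  The embedding of \<open>H\<^sup>1(\<real>\<^sup>2)\<close> into the Orlicz space. The averages of \<open>v\<close> over the squares of side
  \<open>2\<^sup>-\<^sup>n\<close> converge to \<open>v\<close>; each increment is bounded uniformly by the \<open>H\<^sup>1\<close> norm, while its
  square has integral of order \<open>4\<^sup>-\<^sup>n\<close>. This beats the factor \<open>2\<^sup>n\<close> of \<open>sum_bound\<close>.
\<close>

lemma H1_imp_integrable:
  assumes vH: "v \<in> H1"
  shows "integrable lebesgue (\<lambda>x. \<Phi> \<bar>v x\<bar>)"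
proof -
  obtain G where G: "G \<in> L2" "loc_integrable G"
    "\<And>\<phi> i. test_fun \<phi> \<Longrightarrow> (LINT x|lebesgue. \<phi> x * G x $ i) = - (LINT x|lebesgue. partial i \<phi> x * v x)"
    by (rule H1_weak_gradient[OF vH]) blast
  have vL: "v \<in> L2" using vH unfolding H1_def by blast
  have v: "loc_integrable v" by (rule L2_imp_loc_integrable[OF vL])
  have vm: "v \<in> borel_measurable lebesgue" "integrable lebesgue (\<lambda>x. (v x)\<^sup>2)"
    using vL unfolding L2_def by auto
  have Gm: "G \<in> borel_measurable lebesgue" "integrable lebesgue (\<lambda>x. (norm (G x))\<^sup>2)"
    using G(1) unfolding L2_def by auto
  \<comment> \<open>One density serves every increment: the square of \<open>v\<close> controls the
    first average, three times the squared gradient all later differences.\<close>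
  define q where "q y = (v y)\<^sup>2 + 3 * (norm (G y))\<^sup>2" for y
  have q0: "0 \<le> q y" for y unfolding q_def by simp
  have qi: "integrable lebesgue q" unfolding q_def using vm Gm by simp
  define S where "S x h = (LINT y|lebesgue. indicator (square x h) y * q y)" for x h
  have iq: "integrable lebesgue (\<lambda>y. indicator (square x h) y * q y)" for x h
    using integrable_mult_indicator[OF _ qi, of "square x h"] by simp
  have iv: "integrable lebesgue (\<lambda>y. indicator (square x h) y * (v y)\<^sup>2)" for x h
    using integrable_mult_indicator[OF _ vm(2), of "square x h"] by simp
  have iG: "integrable lebesgue (\<lambda>y. indicator (square x h) y * (norm (G y))\<^sup>2)" for x h
    using integrable_mult_indicator[OF _ Gm(2), of "square x h"] by simp
  define a where "a n x = integral (square x (1 / 2 ^ n)) v / (1 / 2 ^ n)\<^sup>2" for n and x :: R2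
  \<comment> \<open>Counting the average over the unit square as increment 0 lets the partial sums
    dominate every average.\<close>
  define E where "E m x = (case m of 0 \<Rightarrow> \<bar>a 0 x\<bar> | Suc k \<Rightarrow> \<bar>a (Suc k) x - a k x\<bar>)" for m x
  have E0: "0 \<le> E m x" for m x unfolding E_def by (cases m) auto
  have aE: "\<bar>a n x\<bar> \<le> (\<Sum>m<Suc n. E m x)" for n x
  proof (induction n)
    case (Suc n)
    have "\<bar>a (Suc n) x\<bar> \<le> \<bar>a n x\<bar> + E (Suc n) x" unfolding E_def by simp
    with Suc show ?case by simp
  qed (simp add: E_def)
  \<comment> \<open>Increment m > 0 compares the sides 2 / 2^m and 1 / 2^m. For m = 0 the unit
    square is enlarged to side 2, so that one formula covers both cases.\<close>
  have ES: "(E m x)\<^sup>2 \<le> S x (2 / 2 ^ m)" for m x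
  proof (cases m)
    case 0
    have sub: "square x 1 \<subseteq> square x 2"
    proof
      fix y assume "y \<in> square x 1"
      then show "y \<in> square x 2" unfolding mem_square by (smt (verit))
    qed
    have "(E m x)\<^sup>2 = (integral (square x 1) v)\<^sup>2" unfolding 0 E_def a_def by simp
    also have "\<dots> \<le> 1\<^sup>2 * (LINT y|lebesgue. indicator (square x 1) y * (v y)\<^sup>2)"
      by (rule integral_square_squared_le[OF vm v]) simp
    also have "\<dots> \<le> S x 2"
      unfolding S_def using iv[of x 1] iq[of x 2]
      by (simp, intro integral_mono) (use sub in \<open>auto simp: indicator_def q_def\<close>)
    finally show ?thesis using 0 by simp
  next
    case (Suc k)
    have h: "2 * (1 / 2 ^ Suc k) = (1 / 2 ^ k :: real)" by simp
    have "(E m x)\<^sup>2 = (a (Suc k) x - a k x)\<^sup>2" unfolding Suc E_def by simp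
    also have "\<dots> \<le> 3 * (LINT y|lebesgue. indicator (square x (1 / 2 ^ k)) y * (norm (G y))\<^sup>2)"
      using square_average_increment_le[OF v G(1,3), of "1 / 2 ^ Suc k" x] unfolding h a_def by simp
    also have "\<dots> = (LINT y|lebesgue. 3 * (indicator (square x (1 / 2 ^ k)) y * (norm (G y))\<^sup>2))"
      by simp
    also have "\<dots> \<le> S x (1 / 2 ^ k)"
      unfolding S_def by (intro integral_mono integrable_mult_right iG iq) (auto simp: indicator_def q_def)
    finally show ?thesis using Suc by simp
  qed
  \<comment> \<open>This constant bounds all increments at all points, so (N2) can be used through
    \<open>quadratic_bound\<close> with a single constant.\<close>
  define B where "B = sqrt (LINT y|lebesgue. q y)"
  have EB: "E m x \<le> B" for m x
  proof -
    have "S x (2 / 2 ^ m) \<le> (LINT y|lebesgue. q y)"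
      unfolding S_def by (intro integral_mono iq qi) (auto simp: indicator_def q0)
    then show ?thesis unfolding B_def using ES[of m x] by (intro real_le_rsqrt) linarith
  qed
  obtain C where C: "C \<ge> 0"
    "\<And>n D. (\<And>m. D m \<ge> 0) \<Longrightarrow> \<Phi> (\<Sum>m<n. D m) \<le> C * (\<Sum>m<n. 2 ^ m * \<Phi> (D m))"
    by (rule sum_bound) blast
  obtain C' where C': "C' \<ge> 0" "\<And>t. 0 \<le> t \<Longrightarrow> t \<le> B \<Longrightarrow> \<Phi> t \<le> C' * t\<^sup>2"
    by (rule quadratic_bound[of B]) blast
  \<comment> \<open>Tonelli for the averages works with a Borel integrand on the product, so
    \<open>q\<close> is replaced by a Borel function equal to it almost everywhere.\<close>
  obtain q' where q': "q' \<in> borel_measurable lborel" "AE y in lborel. ennreal (q y) = q' y"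
    using completion_ex_borel_measurable[of "\<lambda>y. ennreal (q y)" lborel] qi by auto
  have q'm: "q' \<in> borel_measurable borel" using q'(1) by simp
  define A where "A m x = (\<integral>\<^sup>+y. indicator (square x (2 / 2 ^ m)) y * q' y \<partial>lborel)" for m x
  have AS: "ennreal (S x (2 / 2 ^ m)) = A m x" for m x
  proof -
    have "ennreal (S x (2 / 2 ^ m)) = (\<integral>\<^sup>+y. ennreal (indicator (square x (2 / 2 ^ m)) y * q y) \<partial>lebesgue)"
      unfolding S_def by (rule nn_integral_eq_integral[symmetric, OF iq]) (simp add: q0)
    also have "\<dots> = (\<integral>\<^sup>+y. ennreal (indicator (square x (2 / 2 ^ m)) y * q y) \<partial>lborel)"
      by (rule nn_integral_completion)
    also have "\<dots> = A m x" unfolding A_def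
      using q'(2) by (intro nn_integral_cong_AE) (auto simp: indicator_def)
    finally show ?thesis .
  qed
  \<comment> \<open>The majorant is the whole series. It does not depend on n and therefore survives
    the passage from the averages to their limit.\<close>
  define R where "R x = ennreal (C * C') * (\<Sum>m. ennreal (2 ^ m) * A m x)" for x
  have le_n: "ennreal (\<Phi> \<bar>a n x\<bar>) \<le> R x" for n x
  proof -
    have "\<Phi> \<bar>a n x\<bar> \<le> \<Phi> (\<Sum>m<Suc n. E m x)" by (rule mono[OF _ aE]) simp
    also have "\<dots> \<le> C * (\<Sum>m<Suc n. 2 ^ m * \<Phi> (E m x))" by (rule C(2)) (rule E0)
    also have "\<dots> \<le> C * (\<Sum>m<Suc n. 2 ^ m * (C' * S x (2 / 2 ^ m)))"
    proof (intro mult_left_mono sum_mono C(1))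
      show "\<Phi> (E m x) \<le> C' * S x (2 / 2 ^ m)" for m
        using C'(2)[OF E0 EB, of m x] mult_left_mono[OF ES C'(1), of m x] by linarith
    qed simp
    also have "\<dots> = (C * C') * (\<Sum>m<Suc n. 2 ^ m * S x (2 / 2 ^ m))"
      by (simp add: sum_distrib_left mult_ac del: sum.lessThan_Suc)
    finally have "ennreal (\<Phi> \<bar>a n x\<bar>) \<le> ennreal ((C * C') * (\<Sum>m<Suc n. 2 ^ m * S x (2 / 2 ^ m)))"
      by (rule ennreal_leI)
    also have "\<dots> = ennreal (C * C') * (\<Sum>m<Suc n. ennreal (2 ^ m) * A m x)"
    proof -
      have S0: "0 \<le> S x h" for h unfolding S_def by (rule integral_nonneg_AE) (simp add: q0)
      have "ennreal (\<Sum>m<Suc n. 2 ^ m * S x (2 / 2 ^ m)) = (\<Sum>m<Suc n. ennreal (2 ^ m * S x (2 / 2 ^ m)))"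
        by (rule sum_ennreal[symmetric]) (simp add: S0)
      also have "\<dots> = (\<Sum>m<Suc n. ennreal (2 ^ m) * A m x)"
        by (intro sum.cong refl) (simp add: ennreal_mult S0 AS)
      moreover have "0 \<le> (\<Sum>m<Suc n. 2 ^ m * S x (2 / 2 ^ m))"
        by (intro sum_nonneg mult_nonneg_nonneg S0) simp
      moreover have "0 \<le> C * C'" using C(1) C'(1) by simp
      ultimately show ?thesis by (simp only: ennreal_mult)
    qed
    also have "\<dots> \<le> R x" unfolding R_def by (intro mult_left_mono sum_le_suminf) auto
    finally show ?thesis .
  qed
  have cont: "((\<lambda>n. \<Phi> \<bar>s n\<bar>) \<longlonglongrightarrow> \<Phi> \<bar>l\<bar>)" if "s \<longlonglongrightarrow> l" for s l
    using continuous that by (intro isCont_tendsto_compose[of _ \<Phi>] tendsto_rabs)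
      (auto simp: continuous_on_eq_continuous_at)
  have "AE x in lebesgue. ennreal (\<Phi> \<bar>v x\<bar>) \<le> R x"
    using square_averages_tendsto[OF v]
  proof eventually_elim
    case (elim x)
    then have "(\<lambda>n. ennreal (\<Phi> \<bar>a n x\<bar>)) \<longlonglongrightarrow> ennreal (\<Phi> \<bar>v x\<bar>)"
      unfolding a_def by (intro tendsto_ennrealI cont)
    then show ?case by (rule LIMSEQ_le_const2) (use le_n in auto)
  qed
  then have "(\<integral>\<^sup>+x. ennreal (\<Phi> \<bar>v x\<bar>) \<partial>lebesgue) \<le> (\<integral>\<^sup>+x. R x \<partial>lebesgue)"
    by (rule nn_integral_mono_AE)
  also have "\<dots> = (\<integral>\<^sup>+x. R x \<partial>lborel)" by (rule nn_integral_completion)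
  also have "\<dots> < \<infinity>"
  proof -
    have Am: "A m \<in> borel_measurable borel" for m
      unfolding A_def by (rule measurable_square_average[OF q'm]) simp
    have iA: "(\<integral>\<^sup>+x. A m x \<partial>lborel) = ennreal ((2 / 2 ^ m)\<^sup>2) * (\<integral>\<^sup>+y. q' y \<partial>lborel)" for m
      unfolding A_def by (rule nn_integral_square_average[OF q'm]) simp
    have Iq: "(\<integral>\<^sup>+y. q' y \<partial>lborel) = ennreal (LINT y|lebesgue. q y)"
    proof -
      have "(\<integral>\<^sup>+y. q' y \<partial>lborel) = (\<integral>\<^sup>+y. ennreal (q y) \<partial>lborel)"
        using q'(2) by (intro nn_integral_cong_AE) auto
      also have "\<dots> = (\<integral>\<^sup>+y. ennreal (q y) \<partial>lebesgue)" by (rule nn_integral_completion[symmetric])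
      also have "\<dots> = ennreal (LINT y|lebesgue. q y)" by (rule nn_integral_eq_integral[OF qi]) (simp add: q0)
      finally show ?thesis .
    qed
    let ?I = "LINT y|lebesgue. q y"
    have I0: "?I \<ge> 0" by (rule integral_nonneg_AE) (simp add: q0)
    have "(\<integral>\<^sup>+x. R x \<partial>lborel) = ennreal (C * C') * (\<Sum>m. ennreal (2 ^ m) * (\<integral>\<^sup>+x. A m x \<partial>lborel))"
      unfolding R_def using Am by (simp add: nn_integral_cmult nn_integral_suminf)
    also have "(\<lambda>m. ennreal (2 ^ m) * (\<integral>\<^sup>+x. A m x \<partial>lborel)) = (\<lambda>m. ennreal (4 * ?I * (1/2) ^ m))"
    proof
      fix m
      \<comment> \<open>The integral of \<open>A m\<close> carries 4 / 4^m; against the weight 2^m a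
        geometric series of ratio 1/2 remains.\<close>
      have "2 ^ m * ((2 / 2 ^ m)\<^sup>2 * ?I) = 4 * ?I * (1/2) ^ m"
        by (simp add: power2_eq_square field_simps)
      then show "ennreal (2 ^ m) * (\<integral>\<^sup>+x. A m x \<partial>lborel) = ennreal (4 * ?I * (1/2) ^ m)"
        unfolding iA Iq using I0 by (simp flip: ennreal_mult)
    qed
    also have "(\<Sum>m. ennreal (4 * ?I * (1/2) ^ m)) = ennreal (\<Sum>m. 4 * ?I * (1/2) ^ m)"
      by (rule suminf_ennreal2) (use I0 in \<open>auto intro!: summable_mult summable_geometric\<close>)
    finally show ?thesis by (simp add: ennreal_mult_less_top)
  qed
  finally show ?thesis
    by (intro integrableI_bounded) (use vm(1) continuous in \<open>auto simp: nonneg intro!: borel_measurable_continuous_on[OF continuous]\<close>)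
qed

end

section \<open>The ring curl on the function spaces\<close>

lemma L2_add:
  assumes "f \<in> L2" "g \<in> L2" shows "(\<lambda>x. f x + g x) \<in> L2"
proof -
  have [measurable]: "f \<in> borel_measurable lebesgue" "g \<in> borel_measurable lebesgue"
    and i: "integrable lebesgue (\<lambda>x. (norm (f x))\<^sup>2)" "integrable lebesgue (\<lambda>x. (norm (g x))\<^sup>2)"
    using assms unfolding L2_def by auto
  have "integrable lebesgue (\<lambda>x. (norm (f x + g x))\<^sup>2)"
  proof (rule Bochner_Integration.integrable_bound)
    show "integrable lebesgue (\<lambda>x. 2 * (norm (f x))\<^sup>2 + 2 * (norm (g x))\<^sup>2)" using i by simp
    have "(norm (a + b))\<^sup>2 \<le> 2 * (norm a)\<^sup>2 + 2 * (norm b)\<^sup>2" for a b :: 'a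
    proof -
      have "(norm (a + b))\<^sup>2 \<le> (norm a + norm b)\<^sup>2" by (intro power_mono norm_triangle_ineq) auto
      also have "\<dots> \<le> 2 * (norm a)\<^sup>2 + 2 * (norm b)\<^sup>2"
        using zero_le_power2[of "norm a - norm b"] by (simp add: power2_sum power2_diff)
      finally show ?thesis .
    qed
    then show "AE x in lebesgue. norm ((norm (f x + g x))\<^sup>2) \<le> norm (2 * (norm (f x))\<^sup>2 + 2 * (norm (g x))\<^sup>2)"
      by simp
  qed measurable
  then show ?thesis unfolding L2_def by simp
qed

lemma L2_cmult:
  fixes f :: "R2 \<Rightarrow> real" assumes "f \<in> L2" shows "(\<lambda>x. c * f x) \<in> L2"
  using assms unfolding L2_def by (auto simp: power_mult_distrib)

lemma L2_diff:
  fixes f g :: "R2 \<Rightarrow> 'b::euclidean_space"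
  assumes "f \<in> L2" "g \<in> L2" shows "(\<lambda>x. f x - g x) \<in> L2"
proof -
  have "(\<lambda>x. - g x) \<in> L2" using assms(2) unfolding L2_def by auto
  from L2_add[OF assms(1) this] show ?thesis by simp
qed

lemma L2_component:
  fixes f :: "R2 \<Rightarrow> 'b::euclidean_space"
  assumes "f \<in> L2" shows "(\<lambda>x. f x \<bullet> c) \<in> L2"
proof -
  have [measurable]: "f \<in> borel_measurable lebesgue" and i: "integrable lebesgue (\<lambda>x. (norm (f x))\<^sup>2)"
    using assms unfolding L2_def by auto
  have "integrable lebesgue (\<lambda>x. (f x \<bullet> c)\<^sup>2)"
  proof (rule Bochner_Integration.integrable_bound)
    show "integrable lebesgue (\<lambda>x. (norm c)\<^sup>2 * (norm (f x))\<^sup>2)" using i by simp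
    have "(f x \<bullet> c)\<^sup>2 \<le> (norm c)\<^sup>2 * (norm (f x))\<^sup>2" for x
      using power_mono[OF Cauchy_Schwarz_ineq2[of "f x" c], of 2] by (simp add: power_mult_distrib mult.commute)
    then show "AE x in lebesgue. norm ((f x \<bullet> c)\<^sup>2) \<le> norm ((norm c)\<^sup>2 * (norm (f x))\<^sup>2)" by simp
  qed measurable
  then show ?thesis unfolding L2_def by simp
qed

lemma L2_componentwise:
  fixes f :: "R2 \<Rightarrow> 'b::euclidean_space"
  assumes "\<And>b. b \<in> Basis \<Longrightarrow> (\<lambda>x. f x \<bullet> b) \<in> L2" shows "f \<in> L2"
proof -
  have m: "(\<lambda>x. f x \<bullet> b) \<in> borel_measurable lebesgue"
    and i: "integrable lebesgue (\<lambda>x. (f x \<bullet> b)\<^sup>2)" if "b \<in> Basis" for b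
    using assms[OF that] unfolding L2_def by auto
  have "f \<in> borel_measurable lebesgue" using m by (subst borel_measurable_euclidean_space) blast
  moreover have "(norm (f x))\<^sup>2 = (\<Sum>b\<in>Basis. (f x \<bullet> b)\<^sup>2)" for x
    by (subst power2_norm_eq_inner, subst euclidean_inner) (simp add: power2_eq_square)
  ultimately show ?thesis unfolding L2_def using i by simp
qed

section \<open>Components of six-dimensional fields and the ring operators\<close>

lemma inner_left_component: "z \<bullet> (axis j 1, 0) = fst z $ j"
  and inner_right_component: "z \<bullet> (0, axis j 1) = snd z $ j"
  for z :: R6
  by (simp_all add: inner_prod_def inner_axis)

lemma left_component_Basis: "(axis j 1, 0) \<in> (Basis :: R6 set)"
  and right_component_Basis: "(0, axis j 1) \<in> (Basis :: R6 set)"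
  by (simp_all add: Basis_prod_def axis_in_Basis_real)

lemma R6_BasisE:
  assumes "b \<in> (Basis :: R6 set)"
  obtains j where "b = (axis j 1, 0)" | j where "b = (0, axis j 1)"
  using assms by (auto simp: Basis_prod_def Basis_vec_def)

lemma L2_R6I:
  fixes u :: "R2 \<Rightarrow> R6"
  assumes "\<And>j. (\<lambda>x. fst (u x) $ j) \<in> L2" "\<And>j. (\<lambda>x. snd (u x) $ j) \<in> L2"
  shows "u \<in> L2"
proof (rule L2_componentwise)
  fix b :: R6 assume "b \<in> Basis"
  then show "(\<lambda>x. u x \<bullet> b) \<in> L2"
    by (cases rule: R6_BasisE) (simp_all add: inner_left_component inner_right_component assms)
qed

lemma R6_eqI:
  fixes y z :: R6
  assumes "fst y $ 1 = fst z $ 1" "fst y $ 2 = fst z $ 2" "fst y $ 3 = fst z $ 3"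
    "snd y $ 1 = snd z $ 1" "snd y $ 2 = snd z $ 2" "snd y $ 3 = snd z $ 3"
  shows "y = z"
  using assms by (simp add: prod_eq_iff vec_eq_iff forall_3)

lemma dist_of_R6_components:
  assumes "loc_integrable c" "test_fun \<phi>"
  shows "fst (dist_of c \<phi>) $ j = (LINT x|lebesgue. \<phi> x * fst (c x :: R6) $ j)"
    "snd (dist_of c \<phi>) $ j = (LINT x|lebesgue. \<phi> x * snd (c x) $ j)"
  using dist_of_inner[OF assms, of "(axis j 1, 0)"] dist_of_inner[OF assms, of "(0, axis j 1)"]
  by (simp_all add: inner_left_component inner_right_component)

lemma test_fun_L2: "test_fun \<phi> \<Longrightarrow> \<phi> \<in> L2"
  for \<phi> :: "R2 \<Rightarrow> real"
  using test_fun_integrable[of \<phi> \<phi>, OF loc_integrable_continuous[OF smooth_continuous[OF test_fun_smooth]]]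
    smooth_lebesgue_measurable[OF test_fun_smooth]
  unfolding L2_def by (auto simp: power2_eq_square)

lemma ring_grad_components:
  "fst (ring_grad k \<alpha> \<alpha>' x) $ 1 = partial 1 \<alpha> x" "fst (ring_grad k \<alpha> \<alpha>' x) $ 2 = partial 2 \<alpha> x"
  "fst (ring_grad k \<alpha> \<alpha>' x) $ 3 = k * \<alpha>' x"
  "snd (ring_grad k \<alpha> \<alpha>' x) $ 1 = partial 1 \<alpha>' x" "snd (ring_grad k \<alpha> \<alpha>' x) $ 2 = partial 2 \<alpha>' x"
  "snd (ring_grad k \<alpha> \<alpha>' x) $ 3 = - k * \<alpha> x"
  unfolding ring_grad_def by simp_all

lemma ring_grad_L2:
  assumes "test_fun \<alpha>" "test_fun \<alpha>'" shows "ring_grad k \<alpha> \<alpha>' \<in> L2"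
proof (rule L2_R6I)
  have "\<forall>j. (\<lambda>x. fst (ring_grad k \<alpha> \<alpha>' x) $ j) \<in> L2" "\<forall>j. (\<lambda>x. snd (ring_grad k \<alpha> \<alpha>' x) $ j) \<in> L2"
    unfolding forall_3 ring_grad_components
    by (intro conjI L2_cmult test_fun_L2 test_fun_partial assms)+
  then show "(\<lambda>x. fst (ring_grad k \<alpha> \<alpha>' x) $ j) \<in> L2" "(\<lambda>x. snd (ring_grad k \<alpha> \<alpha>' x) $ j) \<in> L2" for j
    by auto
qed

lemma ring_dcurl_components:
  "fst (ring_dcurl k u \<phi>) $ 1 = - (LINT x|lebesgue. partial 2 \<phi> x * fst (u x) $ 3) - k * (LINT x|lebesgue. \<phi> x * snd (u x) $ 2)"
  "fst (ring_dcurl k u \<phi>) $ 2 = k * (LINT x|lebesgue. \<phi> x * snd (u x) $ 1) + (LINT x|lebesgue. partial 1 \<phi> x * fst (u x) $ 3)"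
  "fst (ring_dcurl k u \<phi>) $ 3 = - (LINT x|lebesgue. partial 1 \<phi> x * fst (u x) $ 2) + (LINT x|lebesgue. partial 2 \<phi> x * fst (u x) $ 1)"
  "snd (ring_dcurl k u \<phi>) $ 1 = - (LINT x|lebesgue. partial 2 \<phi> x * snd (u x) $ 3) + k * (LINT x|lebesgue. \<phi> x * fst (u x) $ 2)"
  "snd (ring_dcurl k u \<phi>) $ 2 = - k * (LINT x|lebesgue. \<phi> x * fst (u x) $ 1) + (LINT x|lebesgue. partial 1 \<phi> x * snd (u x) $ 3)"
  "snd (ring_dcurl k u \<phi>) $ 3 = - (LINT x|lebesgue. partial 1 \<phi> x * snd (u x) $ 2) + (LINT x|lebesgue. partial 2 \<phi> x * snd (u x) $ 1)"
  unfolding ring_dcurl_def Let_def dpartial_def dist_of_def by simp_all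

text \<open>After integration by parts the terms with k cancel in pairs, thanks to the opposite
  signs of k in the two halves of \<open>ring_grad\<close>. The third component of each half is the
  symmetry of mixed partials.\<close>

lemma ring_dcurl_ring_grad:
  assumes a: "test_fun \<alpha>" "test_fun \<alpha>'" and \<phi>: "test_fun \<phi>"
  shows "ring_dcurl k (ring_grad k \<alpha> \<alpha>') \<phi> = 0"
proof -
  have ibp: "(LINT x|lebesgue. \<phi> x * partial i f x) = - (LINT x|lebesgue. partial i \<phi> x * f x)"
    if "test_fun f" for f i
    using integration_by_parts[OF test_fun_smooth[OF \<phi>] that, of i] by simp
  have comm: "(LINT x|lebesgue. partial 1 \<phi> x * partial 2 f x) = (LINT x|lebesgue. partial 2 \<phi> x * partial 1 f x)"
    if "test_fun f" for f
    by (rule integral_partial_partial_commute[OF \<phi> that])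
  show ?thesis
    by (rule R6_eqI; unfold ring_dcurl_components ring_grad_components)
      (simp_all add: ibp a comm mult.left_commute[of _ k])
qed

text \<open>Cauchy-Schwarz against the fixed test function. One estimate for all vectors
  \<open>c\<close> of norm at most 1 yields the six components.\<close>

lemma dist_tendsto_of_L2_norm:
  fixes w :: "R2 \<Rightarrow> R6"
  assumes w: "w \<in> L2" and wn: "\<And>n. wn n \<in> L2" and lim: "(\<lambda>n. L2_norm (\<lambda>x. wn n x - w x)) \<longlonglongrightarrow> 0"
    and \<psi>: "test_fun \<psi>"
  shows "(\<lambda>n. LINT x|lebesgue. \<psi> x * fst (wn n x) $ j) \<longlonglongrightarrow> (LINT x|lebesgue. \<psi> x * fst (w x) $ j)"
    and "(\<lambda>n. LINT x|lebesgue. \<psi> x * snd (wn n x) $ j) \<longlonglongrightarrow> (LINT x|lebesgue. \<psi> x * snd (w x) $ j)"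
proof -
  have *: "(\<lambda>n. LINT x|lebesgue. \<psi> x * (wn n x \<bullet> c)) \<longlonglongrightarrow> (LINT x|lebesgue. \<psi> x * (w x \<bullet> c))" if c: "norm c \<le> 1" for c
  proof -
    have \<psi>2: "\<psi> \<in> borel_measurable lebesgue" "integrable lebesgue (\<lambda>x. (\<psi> x)\<^sup>2)"
      using test_fun_L2[OF \<psi>] unfolding L2_def by auto
    have int: "integrable lebesgue (\<lambda>x. \<psi> x * (f x \<bullet> c))" if "f \<in> L2" for f :: "R2 \<Rightarrow> R6"
      using test_fun_integrable[OF loc_integrable_inner[OF L2_imp_loc_integrable[OF that]] \<psi>] by simp
    have bound: "norm ((LINT x|lebesgue. \<psi> x * (wn n x \<bullet> c)) - (LINT x|lebesgue. \<psi> x * (w x \<bullet> c)))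
        \<le> sqrt (LINT x|lebesgue. (\<psi> x)\<^sup>2) * L2_norm (\<lambda>x. wn n x - w x)" for n
    proof -
      have d: "(\<lambda>x. wn n x - w x) \<in> L2" by (rule L2_diff[OF wn w])
      then have di: "integrable lebesgue (\<lambda>x. (norm (wn n x - w x))\<^sup>2)" unfolding L2_def by auto
      have dc: "(\<lambda>x. (wn n x - w x) \<bullet> c) \<in> borel_measurable lebesgue" "integrable lebesgue (\<lambda>x. ((wn n x - w x) \<bullet> c)\<^sup>2)"
        using L2_component[OF d, of c] unfolding L2_def by auto
      have le: "(LINT x|lebesgue. ((wn n x - w x) \<bullet> c)\<^sup>2) \<le> (LINT x|lebesgue. (norm (wn n x - w x))\<^sup>2)"
      proof (rule integral_mono[OF dc(2) di])
        fix x
        have "\<bar>(wn n x - w x) \<bullet> c\<bar> \<le> norm (wn n x - w x) * 1"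
          using Cauchy_Schwarz_ineq2[of "wn n x - w x" c] mult_left_mono[OF c norm_ge_zero, of "wn n x - w x"] by linarith
        then show "((wn n x - w x) \<bullet> c)\<^sup>2 \<le> (norm (wn n x - w x))\<^sup>2"
          using power_mono[of "\<bar>(wn n x - w x) \<bullet> c\<bar>" "norm (wn n x - w x)" 2] by simp
      qed
      have "(LINT x|lebesgue. \<psi> x * ((wn n x - w x) \<bullet> c))\<^sup>2
          \<le> (LINT x|lebesgue. (\<psi> x)\<^sup>2) * (LINT x|lebesgue. (norm (wn n x - w x))\<^sup>2)"
        by (rule order_trans[OF integral_mult_squared_le(2)[OF \<psi>2(1) dc(1) \<psi>2(2) dc(2)] mult_left_mono[OF le]])
          (rule integral_nonneg_AE, simp)
      from real_sqrt_le_mono[OF this]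
      have "\<bar>LINT x|lebesgue. \<psi> x * ((wn n x - w x) \<bullet> c)\<bar>
          \<le> sqrt (LINT x|lebesgue. (\<psi> x)\<^sup>2) * L2_norm (\<lambda>x. wn n x - w x)"
        unfolding L2_norm_def by (simp add: real_sqrt_mult)
      moreover have "(LINT x|lebesgue. \<psi> x * ((wn n x - w x) \<bullet> c))
          = (LINT x|lebesgue. \<psi> x * (wn n x \<bullet> c)) - (LINT x|lebesgue. \<psi> x * (w x \<bullet> c))"
        using int[OF wn[of n]] int[OF w] by (simp add: inner_diff_left right_diff_distrib)
      ultimately show ?thesis by simp
    qed
    have "(\<lambda>n. sqrt (LINT x|lebesgue. (\<psi> x)\<^sup>2) * L2_norm (\<lambda>x. wn n x - w x)) \<longlonglongrightarrow> 0"
      using tendsto_mult_right_zero[OF lim] by simp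
    then have "(\<lambda>n. (LINT x|lebesgue. \<psi> x * (wn n x \<bullet> c)) - (LINT x|lebesgue. \<psi> x * (w x \<bullet> c))) \<longlonglongrightarrow> 0"
      by (rule Lim_null_comparison[rotated]) (use bound in auto)
    then show ?thesis by (simp add: LIM_zero_iff)
  qed
  show "(\<lambda>n. LINT x|lebesgue. \<psi> x * fst (wn n x) $ j) \<longlonglongrightarrow> (LINT x|lebesgue. \<psi> x * fst (w x) $ j)"
    using *[of "(axis j 1, 0)"] by (simp add: inner_left_component norm_Pair)
  show "(\<lambda>n. LINT x|lebesgue. \<psi> x * snd (wn n x) $ j) \<longlonglongrightarrow> (LINT x|lebesgue. \<psi> x * snd (w x) $ j)"
    using *[of "(0, axis j 1)"] by (simp add: inner_right_component norm_Pair)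
qed

text \<open>\<open>ring_dcurl\<close> puts all derivatives on the test function, so it passes to L2
  limits, and \<open>W_norm\<close> dominates \<open>L2_norm\<close>; the approximating ring
  gradients are all sent to 0.\<close>

lemma ring_dcurl_W_space:
  assumes w: "w \<in> W_space k \<Phi>" and \<phi>: "test_fun \<phi>"
  shows "ring_dcurl k w \<phi> = 0"
proof -
  obtain \<alpha> \<alpha>' where a: "\<And>n::nat. test_fun (\<alpha> n)" "\<And>n. test_fun (\<alpha>' n)"
    and lim: "(\<lambda>n. W_norm \<Phi> (\<lambda>x. ring_grad k (\<alpha> n) (\<alpha>' n) x - w x)) \<longlonglongrightarrow> 0" and wL: "w \<in> L2"
    using w unfolding W_space_def by blast
  let ?w = "\<lambda>n. ring_grad k (\<alpha> n) (\<alpha>' n)"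
  have wn: "?w n \<in> L2" for n by (rule ring_grad_L2[OF a])
  have "(\<lambda>n. L2_norm (\<lambda>x. ?w n x - w x)) \<longlonglongrightarrow> 0"
  proof (rule Lim_null_comparison[OF _ lim], rule always_eventually, rule allI)
    fix n
    have "0 \<le> L2_norm (\<lambda>x. ?w n x - w x)" unfolding L2_norm_def by (intro real_sqrt_ge_zero integral_nonneg_AE) simp
    then show "norm (L2_norm (\<lambda>x. ?w n x - w x)) \<le> W_norm \<Phi> (\<lambda>x. ?w n x - w x)"
      unfolding W_norm_def by (simp add: real_le_rsqrt)
  qed
  note lims = dist_tendsto_of_L2_norm[OF wL wn this]
  have z: "ring_dcurl k (?w n) \<phi> = 0" for n by (rule ring_dcurl_ring_grad[OF a \<phi>])
  note p = test_fun_partial[OF \<phi>]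
  have "(\<lambda>n. fst (ring_dcurl k (?w n) \<phi>) $ 1) \<longlonglongrightarrow> fst (ring_dcurl k w \<phi>) $ 1"
    "(\<lambda>n. fst (ring_dcurl k (?w n) \<phi>) $ 2) \<longlonglongrightarrow> fst (ring_dcurl k w \<phi>) $ 2"
    "(\<lambda>n. fst (ring_dcurl k (?w n) \<phi>) $ 3) \<longlonglongrightarrow> fst (ring_dcurl k w \<phi>) $ 3"
    "(\<lambda>n. snd (ring_dcurl k (?w n) \<phi>) $ 1) \<longlonglongrightarrow> snd (ring_dcurl k w \<phi>) $ 1"
    "(\<lambda>n. snd (ring_dcurl k (?w n) \<phi>) $ 2) \<longlonglongrightarrow> snd (ring_dcurl k w \<phi>) $ 2"
    "(\<lambda>n. snd (ring_dcurl k (?w n) \<phi>) $ 3) \<longlonglongrightarrow> snd (ring_dcurl k w \<phi>) $ 3"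
    unfolding ring_dcurl_components by (intro tendsto_intros lims \<phi> p)+
  then show ?thesis unfolding z by (intro R6_eqI) (simp_all add: LIMSEQ_const_iff)
qed

lemma ring_dcurl_add:
  assumes "loc_integrable u" "loc_integrable w" and \<phi>: "test_fun \<phi>"
  shows "ring_dcurl k (\<lambda>x. u x + w x) \<phi> = ring_dcurl k u \<phi> + ring_dcurl k w \<phi>"
proof -
  have int: "integrable lebesgue (\<lambda>x. \<psi> x * fst (f x) $ j)" "integrable lebesgue (\<lambda>x. \<psi> x * snd (f x) $ j)"
    if "loc_integrable f" "test_fun \<psi>" for f :: "R2 \<Rightarrow> R6" and \<psi> j
    using test_fun_integrable[OF loc_integrable_inner[OF that(1), of "(axis j 1, 0)"] that(2)]
      test_fun_integrable[OF loc_integrable_inner[OF that(1), of "(0, axis j 1)"] that(2)]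
    by (simp_all add: inner_left_component inner_right_component)
  note ints = int[OF assms(1) \<phi>] int[OF assms(2) \<phi>]
    int[OF assms(1) test_fun_partial[OF \<phi>]] int[OF assms(2) test_fun_partial[OF \<phi>]]
  show ?thesis
    by (rule R6_eqI; simp only: fst_add snd_add vector_add_component ring_dcurl_components)
      (simp_all add: distrib_left ints)
qed

lemma V_space_ring_curl:
  assumes v: "v \<in> V_space k"
  obtains c where "c \<in> L2" "represents c (ring_dcurl k v)"
proof -
  have Hb: "(\<lambda>x. v x \<bullet> b) \<in> H1" if "b \<in> Basis" for b
    using v that unfolding V_space_def by blast
  have H: "(\<lambda>x. fst (v x) $ j) \<in> H1" "(\<lambda>x. snd (v x) $ j) \<in> H1" for j
    using Hb[OF left_component_Basis[of j]] Hb[OF right_component_Basis[of j]]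
    by (simp_all add: inner_left_component inner_right_component)
  define P where "P f H \<longleftrightarrow> H \<in> L2 \<and>
    (\<forall>\<phi> i. test_fun \<phi> \<longrightarrow> (LINT x|lebesgue. \<phi> x * H x $ i) = - (LINT x|lebesgue. partial i \<phi> x * f x))"
    for f and H :: "R2 \<Rightarrow> R2"
  have P: "\<exists>H. P f H" if "f \<in> H1" for f
    unfolding P_def by (rule H1_weak_gradient[OF that]) blast
  obtain G where G: "P (\<lambda>x. fst (v x) $ j) (G j)" for j
    using choice[of "\<lambda>j. P (\<lambda>x. fst (v x) $ j)"] P[OF H(1)] by auto
  obtain G' where G': "P (\<lambda>x. snd (v x) $ j) (G' j)" for j
    using choice[of "\<lambda>j. P (\<lambda>x. snd (v x) $ j)"] P[OF H(2)] by auto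
  have G2: "G j \<in> L2" "G' j \<in> L2" for j using G G' unfolding P_def by auto
  have Gw: "(LINT x|lebesgue. \<phi> x * G j x $ i) = - (LINT x|lebesgue. partial i \<phi> x * fst (v x) $ j)"
    "(LINT x|lebesgue. \<phi> x * G' j x $ i) = - (LINT x|lebesgue. partial i \<phi> x * snd (v x) $ j)"
    if "test_fun \<phi>" for \<phi> i j
    using G[of j] G'[of j] that unfolding P_def by blast+
  have vL: "(\<lambda>x. fst (v x) $ j) \<in> L2" "(\<lambda>x. snd (v x) $ j) \<in> L2" for j
    using H unfolding H1_def by auto
  have GL: "(\<lambda>x. G j x $ i) \<in> L2" "(\<lambda>x. G' j x $ i) \<in> L2" for i j
    using L2_component[OF G2(1), of j "axis i 1"] L2_component[OF G2(2), of j "axis i 1"] by (simp_all add: inner_axis)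
  \<comment> \<open>The formula of the ring curl with weak derivatives inserted:
    \<open>G j x $ i\<close> is the derivative in direction i of the j-th component of the first
    half of \<open>v\<close>, and \<open>G'\<close> plays this role for the second half.\<close>
  define c :: "R2 \<Rightarrow> R6" where "c x = (vector [G 3 x $ 2 - k * snd (v x) $ 2, k * snd (v x) $ 1 - G 3 x $ 1, G 2 x $ 1 - G 1 x $ 2],
    vector [G' 3 x $ 2 + k * fst (v x) $ 2, (- k) * fst (v x) $ 1 - G' 3 x $ 1, G' 2 x $ 1 - G' 1 x $ 2])" for x
  have cL: "c \<in> L2"
  proof (rule L2_R6I)
    have "\<forall>j. (\<lambda>x. fst (c x) $ j) \<in> L2" "\<forall>j. (\<lambda>x. snd (c x) $ j) \<in> L2"
      unfolding forall_3 c_def fst_conv snd_conv vector_3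
      by (intro conjI L2_add L2_diff L2_cmult vL GL)+
    then show "(\<lambda>x. fst (c x) $ j) \<in> L2" "(\<lambda>x. snd (c x) $ j) \<in> L2" for j by auto
  qed
  have "represents c (ring_dcurl k v)"
    unfolding represents_def
  proof (intro conjI allI impI)
    show cl: "loc_integrable c" by (rule L2_imp_loc_integrable[OF cL])
    fix \<phi> :: "R2 \<Rightarrow> real" assume \<phi>: "test_fun \<phi>"
    have int: "integrable lebesgue (\<lambda>x. \<phi> x * f x)" if "f \<in> L2" for f :: "R2 \<Rightarrow> real"
      using test_fun_integrable[OF L2_imp_loc_integrable[OF that] \<phi>] by simp
    note ints = int[OF GL(1)] int[OF GL(2)] int[OF vL(1)] int[OF vL(2)]
    show "dist_of c \<phi> = ring_dcurl k v \<phi>"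
      by (rule R6_eqI; unfold dist_of_R6_components[OF cl \<phi>] ring_dcurl_components)
        (simp_all add: c_def distrib_left right_diff_distrib ints mult.left_commute[of _ k] Gw[OF \<phi>])
  qed
  with cL show thesis by (rule that)
qed

lemma V_space_L2: assumes "v \<in> V_space k" shows "v \<in> L2"
  by (rule L2_componentwise) (use assms in \<open>auto simp: V_space_def H1_def\<close>)

lemma X_space_ring_curl:
  assumes "u \<in> X_space k \<Phi>"
  obtains c where "c \<in> L2" "represents c (ring_dcurl k u)"
proof -
  obtain v w where vw: "v \<in> V_space k" "w \<in> W_space k \<Phi>" "u = (\<lambda>x. v x + w x)"
    using assms unfolding X_space_def by blast
  obtain c where c: "c \<in> L2" "represents c (ring_dcurl k v)" using V_space_ring_curl[OF vw(1)] .
  have wL: "w \<in> L2" using vw(2) unfolding W_space_def by blast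
  have "ring_dcurl k u \<phi> = ring_dcurl k v \<phi>" if \<phi>: "test_fun \<phi>" for \<phi>
    unfolding vw(3) ring_dcurl_add[OF L2_imp_loc_integrable[OF V_space_L2[OF vw(1)]] L2_imp_loc_integrable[OF wL] \<phi>]
    by (simp add: ring_dcurl_W_space[OF vw(2) \<phi>])
  then have "represents c (ring_dcurl k u)" using c(2) unfolding represents_def by simp
  with c(1) show thesis by (rule that)
qed

section \<open>Slicing three-dimensional space\<close>

definition join :: "R2 \<times> real \<Rightarrow> R3" where
  "join p = vector [fst p $ 1, fst p $ 2, snd p]"

lemma join_nth: "join p $ 1 = fst p $ 1" "join p $ 2 = fst p $ 2" "join p $ 3 = snd p"
  unfolding join_def by simp_all

lemma plane_nth: "plane x $ 1 = x $ 1" "plane x $ 2 = x $ 2"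
  unfolding plane_def by simp_all

lemma plane_join: "plane (join p) = fst p"
  by (simp add: vec_eq_iff forall_2 plane_nth join_nth)

lemma axis_nth_3: "(axis 1 a :: 'a::zero ^ 3) $ 1 = a" "(axis 1 a :: 'a ^ 3) $ 2 = 0" "(axis 1 a :: 'a ^ 3) $ 3 = 0"
  "(axis 2 a :: 'a ^ 3) $ 1 = 0" "(axis 2 a :: 'a ^ 3) $ 2 = a" "(axis 2 a :: 'a ^ 3) $ 3 = 0"
  "(axis 3 a :: 'a ^ 3) $ 1 = 0" "(axis 3 a :: 'a ^ 3) $ 2 = 0" "(axis 3 a :: 'a ^ 3) $ 3 = a"
  by (simp_all add: axis_def)

lemma axis_nth_2: "(axis 1 a :: 'a::zero ^ 2) $ 1 = a" "(axis 1 a :: 'a ^ 2) $ 2 = 0"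
  "(axis 2 a :: 'a ^ 2) $ 1 = 0" "(axis 2 a :: 'a ^ 2) $ 2 = a"
  by (simp_all add: axis_def)

lemma join_eq: "join p = fst p $ 1 *\<^sub>R axis 1 1 + fst p $ 2 *\<^sub>R axis 2 1 + snd p *\<^sub>R axis 3 1"
  by (simp add: vec_eq_iff forall_3 join_nth axis_nth_3)

lemma plane_eq: "plane x = x $ 1 *\<^sub>R axis 1 1 + x $ 2 *\<^sub>R axis 2 1"
  by (simp add: vec_eq_iff forall_2 plane_nth axis_nth_2)

lemma join_borel: "join \<in> borel_measurable borel"
  unfolding join_eq[abs_def] by (intro borel_measurable_continuous_onI continuous_intros)

lemma plane_borel: "plane \<in> borel_measurable borel"
  unfolding plane_eq[abs_def] by (intro borel_measurable_continuous_onI continuous_intros)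

lemma prod_Basis_cart:
  fixes x :: "real ^ 'n::finite"
  shows "(\<Prod>b\<in>Basis. x \<bullet> b) = (\<Prod>i\<in>UNIV. x $ i)"
proof -
  have B: "(Basis :: (real ^ 'n) set) = range (\<lambda>i. axis i 1)" by (auto simp: Basis_vec_def)
  have "inj (\<lambda>i. axis i 1 :: real ^ 'n)" by (auto intro: injI simp: axis_eq_axis)
  then show ?thesis unfolding B by (subst prod.reindex) (simp_all add: inner_axis)
qed

abbreviation pair_lborel :: "(R2 \<times> real) measure" where
  "pair_lborel \<equiv> lborel \<Otimes>\<^sub>M lborel"

text \<open>Lebesgue measure is determined by its values on boxes, and \<open>join\<close> pulls a
  box back to the product of a planar box and an interval.\<close>

lemma distr_join: "distr pair_lborel borel join = (lborel :: R3 measure)"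
proof (rule lborel_eqI[symmetric])
  fix l u :: R3 assume le: "\<And>b. b \<in> Basis \<Longrightarrow> l \<bullet> b \<le> u \<bullet> b"
  have len: "l $ i \<le> u $ i" for i using le[OF axis_in_Basis_real[of i]] by (simp add: inner_axis)
  have jm: "join \<in> pair_lborel \<rightarrow>\<^sub>M borel"
    using join_borel by (simp add: lborel_prod)
  have pre: "join -` box l u = box (plane l) (plane u) \<times> box (l $ 3) (u $ 3)"
    by (auto simp: mem_box_cart forall_3 forall_2 join_nth plane_nth)
  have "emeasure (distr pair_lborel borel join) (box l u)
      = emeasure pair_lborel (box (plane l) (plane u) \<times> box (l $ 3) (u $ 3))"
    using jm by (subst emeasure_distr) (simp_all add: pre space_pair_measure)
  also have "\<dots> = emeasure lborel (box (plane l) (plane u)) * emeasure lborel (box (l $ 3) (u $ 3))"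
    by (rule lborel.emeasure_pair_measure_Times) simp_all
  also have "emeasure lborel (box (plane l) (plane u)) = ennreal (\<Prod>b\<in>Basis. (plane u - plane l) \<bullet> b)"
  proof (rule emeasure_lborel_box)
    fix b :: R2 assume "b \<in> Basis"
    then obtain i where b: "b = axis i 1" by (auto simp: Basis_vec_def)
    have "\<forall>i. plane l $ i \<le> plane u $ i" by (simp add: forall_2 plane_nth len)
    then show "plane l \<bullet> b \<le> plane u \<bullet> b" unfolding b by (simp add: inner_axis)
  qed
  also have "(\<Prod>b\<in>Basis. (plane u - plane l) \<bullet> b) = (u $ 1 - l $ 1) * (u $ 2 - l $ 2)"
    unfolding prod_Basis_cart UNIV_2 by (simp add: plane_nth)
  also have "emeasure lborel (box (l $ 3) (u $ 3)) = ennreal (u $ 3 - l $ 3)"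
    using len[of 3] by simp
  also have "ennreal ((u $ 1 - l $ 1) * (u $ 2 - l $ 2)) * ennreal (u $ 3 - l $ 3)
      = ennreal ((u $ 1 - l $ 1) * (u $ 2 - l $ 2) * (u $ 3 - l $ 3))"
    using len by (subst ennreal_mult) auto
  also have "(u $ 1 - l $ 1) * (u $ 2 - l $ 2) * (u $ 3 - l $ 3) = (\<Prod>b\<in>Basis. (u - l) \<bullet> b)"
    unfolding prod_Basis_cart UNIV_3 by (simp add: mult.assoc)
  finally show "emeasure (distr pair_lborel borel join) (box l u) = ennreal (\<Prod>b\<in>Basis. (u - l) \<bullet> b)" .
qed simp

text \<open>The preimage is the cylinder over \<open>N\<close>, of measure 0 times infinity, that is
  0. This is what lifts almost-everywhere statements from the plane to space.\<close>

lemma plane_vimage_null: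
  assumes N: "N \<in> null_sets (lborel :: R2 measure)"
  shows "plane -` N \<in> null_sets lborel"
proof (rule null_setsI)
  have Nb: "N \<in> sets borel" using N by auto
  have jm: "join \<in> pair_lborel \<rightarrow>\<^sub>M borel"
    using join_borel by (simp add: lborel_prod)
  show P: "plane -` N \<in> sets lborel"
    using measurable_sets[OF plane_borel Nb] by simp
  have pre: "join -` (plane -` N) = N \<times> (UNIV :: real set)" by (auto simp: plane_join)
  have "emeasure lborel (plane -` N) = emeasure pair_lborel (N \<times> (UNIV :: real set))"
    using P jm by (subst distr_join[symmetric], subst emeasure_distr) (simp_all add: pre space_pair_measure)
  also have "\<dots> = emeasure lborel N * emeasure lborel (UNIV :: real set)"
    using Nb by (intro lborel.emeasure_pair_measure_Times) simp_all
  also have "\<dots> = 0" using N by auto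
  finally show "emeasure lborel (plane -` N) = 0" .
qed

lemma AE_plane:
  assumes "AE y in lborel. P y" shows "AE x in lborel. P (plane x)"
proof -
  obtain N where N: "{y. \<not> P y} \<subseteq> N" "N \<in> null_sets (lborel :: R2 measure)"
    using assms by (auto elim!: AE_E simp: null_sets_def)
  show ?thesis
    by (rule AE_I'[OF plane_vimage_null[OF N(2)]]) (use N(1) in auto)
qed

text \<open>A Borel map is measurable between the completed measures once preimages of null sets are
  null.\<close>

lemma plane_lebesgue_measurable: "plane \<in> lebesgue \<rightarrow>\<^sub>M lebesgue"
proof (rule completion.measurable_completion2)
  show pl: "plane \<in> lebesgue \<rightarrow>\<^sub>M lborel" using measurable_completion[of plane lborel lborel] plane_borel by simp
  show "null_sets lborel \<subseteq> null_sets (distr lebesgue lborel plane)"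
  proof
    fix N :: "R2 set" assume N: "N \<in> null_sets lborel"
    have P: "plane -` N \<in> null_sets lebesgue"
      using plane_vimage_null[OF N] by (rule null_sets_completionI)
    have "emeasure (distr lebesgue lborel plane) N = emeasure lebesgue (plane -` N)"
      using N pl by (subst emeasure_distr) auto
    then show "N \<in> null_sets (distr lebesgue lborel plane)" using N P by (auto simp: null_sets_def)
  qed
qed

lemma AE_plane_lebesgue:
  assumes "AE y in lebesgue. P y" shows "AE x in lebesgue. P (plane x)"
  using AE_plane[of P] assms by (simp add: AE_completion_iff)

text \<open>A compact set in the ball of radius r lies over the disc of radius r, at heights between
  -r and r. By Tonelli the integral is at most that over the disc times the length of this
  interval.\<close>

lemma loc_integrable_plane:
  fixes X :: "R2 \<Rightarrow> real"
  assumes X: "loc_integrable X" shows "loc_integrable (\<lambda>x. X (plane x))"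
  unfolding loc_integrable_def set_integrable_def
proof (intro allI impI)
  fix K :: "R3 set" assume K: "compact K"
  obtain r where r: "\<And>x. x \<in> K \<Longrightarrow> norm x \<le> r" using compact_imp_bounded[OF K] unfolding bounded_iff by auto
  have Xm: "X \<in> borel_measurable lebesgue" by (rule loc_integrable_measurable[OF X])
  have int: "integrable lebesgue (\<lambda>y. indicator (cball 0 r) y *\<^sub>R X y)"
    using X unfolding loc_integrable_def set_integrable_def by auto
  then have fin: "(\<integral>\<^sup>+y. ennreal (norm (indicator (cball 0 r) y *\<^sub>R X y)) \<partial>lebesgue) < \<infinity>"
    unfolding integrable_iff_bounded by blast
  \<comment> \<open>The product formula concerns the uncompleted measures, hence the Borel version
    of the cut-off integrand.\<close>
  obtain X' where X': "X' \<in> borel_measurable lborel" "AE y in lborel. ennreal (norm (indicator (cball 0 r) y *\<^sub>R X y)) = X' y"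
    using completion_ex_borel_measurable[of "\<lambda>y. ennreal (norm (indicator (cball 0 r) y *\<^sub>R X y))" lborel]
      borel_measurable_integrable[OF int] by auto
  have [measurable]: "X' \<in> borel_measurable borel" using X'(1) by simp
  have [measurable]: "plane \<in> borel_measurable borel" "join \<in> borel_measurable (borel \<Otimes>\<^sub>M borel)"
    using plane_borel join_borel by (simp_all add: borel_prod)
  have jm: "join \<in> pair_lborel \<rightarrow>\<^sub>M borel" using join_borel by (simp add: lborel_prod)
  define J :: "real set" where "J = cball 0 r"
  have [measurable]: "J \<in> sets borel" unfolding J_def by simp
  have [measurable]: "(\<lambda>x :: R3. x $ 3) \<in> borel_measurable borel"
    by (intro borel_measurable_continuous_onI continuous_intros)
  show "integrable lebesgue (\<lambda>x. indicator K x *\<^sub>R X (plane x))"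
  proof (rule integrableI_bounded)
    have "K \<in> sets lebesgue" using K by (simp add: borel_compact)
    then show "(\<lambda>x. indicator K x *\<^sub>R X (plane x)) \<in> borel_measurable lebesgue"
      using measurable_compose[OF plane_lebesgue_measurable Xm] by measurable
    have "(\<integral>\<^sup>+x. ennreal (norm (indicator K x *\<^sub>R X (plane x))) \<partial>lebesgue)
        \<le> (\<integral>\<^sup>+x. X' (plane x) * indicator J (x $ 3) \<partial>lebesgue)"
    proof (rule nn_integral_mono_AE)
      have "AE x in lebesgue. ennreal (norm (indicator (cball 0 r) (plane x) *\<^sub>R X (plane x))) = X' (plane x)"
        using AE_plane[OF X'(2)] by (rule AE_completion)
      then show "AE x in lebesgue. ennreal (norm (indicator K x *\<^sub>R X (plane x))) \<le> X' (plane x) * indicator J (x $ 3)"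
      proof eventually_elim
        case (elim x)
        show ?case
        proof (cases "x \<in> K")
          case True
          have "norm (plane x) \<le> norm x"
            by (simp add: norm_le inner_vec_def sum_2 sum_3 plane_nth)
          then have "plane x \<in> cball 0 r" "x $ 3 \<in> J"
            using r[OF True] component_le_norm_cart[of x 3] by (auto simp: J_def)
          then show ?thesis using elim True by simp
        qed simp
      qed
    qed
    also have "\<dots> = (\<integral>\<^sup>+x. X' (plane x) * indicator J (x $ 3) \<partial>lborel)"
      by (rule nn_integral_completion)
    also have "\<dots> = (\<integral>\<^sup>+p. X' (plane (join p)) * indicator J (join p $ 3) \<partial>pair_lborel)"
      by (subst distr_join[symmetric], rule nn_integral_distr[OF jm]) measurable
    also have "\<dots> = (\<integral>\<^sup>+p. (\<lambda>(y, z). X' y * indicator J z) p \<partial>pair_lborel)"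
      by (simp add: plane_join join_nth case_prod_unfold)
    also have "\<dots> = (\<integral>\<^sup>+y. \<integral>\<^sup>+z. X' y * indicator J z \<partial>lborel \<partial>lborel)"
      by (subst lborel.nn_integral_fst[symmetric]) (simp_all add: case_prod_unfold)
    also have "\<dots> = (\<integral>\<^sup>+y. X' y * emeasure lborel J \<partial>lborel)"
      by (simp add: nn_integral_cmult)
    also have "\<dots> = (\<integral>\<^sup>+y. X' y \<partial>lborel) * emeasure lborel J"
      by (rule nn_integral_multc) simp
    also have "(\<integral>\<^sup>+y. X' y \<partial>lborel) = (\<integral>\<^sup>+y. ennreal (norm (indicator (cball 0 r) y *\<^sub>R X y)) \<partial>lebesgue)"
      unfolding nn_integral_completion using X'(2) by (intro nn_integral_cong_AE) auto
    also have "\<dots> * emeasure lborel J < \<infinity>"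
      using fin emeasure_lborel_cball_finite[of "0::real" r] by (simp add: J_def ennreal_mult_less_top)
    finally show "(\<integral>\<^sup>+x. ennreal (norm (indicator K x *\<^sub>R X (plane x))) \<partial>lebesgue) < \<infinity>" .
  qed
qed

lemma loc_integrable_continuous_mult:
  fixes g :: "real ^ 'n::finite \<Rightarrow> real"
  assumes s: "continuous_on UNIV s" and g: "loc_integrable g"
  shows "loc_integrable (\<lambda>x. s x * g x)"
  unfolding loc_integrable_def set_integrable_def
proof (intro allI impI)
  fix K :: "(real ^ 'n) set" assume K: "compact K"
  have "compact (s ` K)" by (rule compact_continuous_image[OF continuous_on_subset[OF s] K]) simp
  then obtain M where M: "\<And>x. x \<in> K \<Longrightarrow> \<bar>s x\<bar> \<le> M"
    using compact_imp_bounded[of "s ` K"] unfolding bounded_iff by (auto simp: ball_simps)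
  obtain r where r: "\<And>x. x \<in> K \<Longrightarrow> norm x \<le> r" using compact_imp_bounded[OF K] unfolding bounded_iff by auto
  have "s \<in> borel_measurable borel" by (rule borel_measurable_continuous_onI[OF s])
  then have sm: "s \<in> borel_measurable lebesgue" by (intro measurable_completion) simp
  have Km: "K \<in> sets lebesgue" using K by (simp add: borel_compact)
  have "\<bar>indicator K x * s x\<bar> \<le> \<bar>M\<bar> * indicator (cball 0 r) x" for x
    using M[of x] r[of x] by (cases "x \<in> K") auto
  then have "integrable lebesgue (\<lambda>x. (indicator K x * s x) *\<^sub>R g x)"
    by (intro loc_integrable_bounded_mult[OF g]) (use sm Km in measurable)
  then show "integrable lebesgue (\<lambda>x. indicator K x *\<^sub>R (s x * g x))" by (simp add: mult.assoc)
qed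

section \<open>Horizontal slices of test functions\<close>

definition embed_index :: "2 \<Rightarrow> 3" where "embed_index i = (if i = 1 then 1 else 2)"

lemma slice_differentiable:
  assumes "\<And>x. f differentiable at x"
  shows "(\<lambda>y. f (join (y, z))) differentiable at y"
    and "partial i (\<lambda>y. f (join (y, z))) y = partial (embed_index i) f (join (y, z))"
proof -
  have D: "(f has_derivative frechet_derivative f (at (join (y, z)))) (at (join (y, z)))"
    using assms frechet_derivative_works by blast
  have "((\<lambda>y. join (y, z)) has_derivative (\<lambda>h. h $ 1 *\<^sub>R axis 1 1 + h $ 2 *\<^sub>R axis 2 1)) (at y)"
    unfolding join_eq fst_conv snd_conv
    by (auto intro!: derivative_eq_intros bounded_linear.has_derivative[OF bounded_linear_vec_nth])
  from has_derivative_compose[OF this D]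
  have D': "((\<lambda>y. f (join (y, z))) has_derivative
      (\<lambda>h. frechet_derivative f (at (join (y, z))) (h $ 1 *\<^sub>R axis 1 1 + h $ 2 *\<^sub>R axis 2 1))) (at y)" .
  then show "(\<lambda>y. f (join (y, z))) differentiable at y" unfolding differentiable_def by blast
  have "\<forall>i. (axis i 1 :: R2) $ 1 *\<^sub>R axis 1 1 + (axis i 1 :: R2) $ 2 *\<^sub>R axis 2 1 = (axis (embed_index i) 1 :: R3)"
    unfolding forall_2 by (simp add: axis_nth_2 embed_index_def)
  then show "partial i (\<lambda>y. f (join (y, z))) y = partial (embed_index i) f (join (y, z))"
    unfolding has_derivative_imp_partial[OF D'] by (simp add: partial_def)
qed

lemma smooth_slice:
  assumes "smooth f" shows "smooth (\<lambda>y. f (join (y, z)))"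
proof (rule smooth_coinduct[of _ "{\<lambda>y. g (join (y, z)) | g. smooth g}"])
  fix h i assume "h \<in> {\<lambda>y. g (join (y, z)) | g. smooth g}"
  then obtain g where g: "smooth g" "h = (\<lambda>y. g (join (y, z)))" by blast
  show "h differentiable at y" for y unfolding g(2) by (intro slice_differentiable smooth_differentiable g)
  have "partial i h = (\<lambda>y. partial (embed_index i) g (join (y, z)))"
    unfolding g(2) by (intro ext slice_differentiable smooth_differentiable g)
  then show "partial i h \<in> {\<lambda>y. g (join (y, z)) | g. smooth g}" using smooth_partial[OF g(1)] by blast
qed (use assms in blast)

lemma test_fun_slice:
  assumes f: "test_fun f" shows "test_fun (\<lambda>y. f (join (y, z)))"
proof -
  obtain R where R: "\<And>x. norm x \<ge> R \<Longrightarrow> f x = 0" by (rule test_fun_support[OF f]) blast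
  have n: "norm y \<le> norm (join (y, z))" for y
    by (simp add: norm_le inner_vec_def sum_2 sum_3 join_nth)
  have "norm y \<le> R" if "f (join (y, z)) \<noteq> 0" for y
  proof (rule ccontr)
    assume "\<not> norm y \<le> R"
    then show False using n[of y] R[of "join (y, z)"] that by simp
  qed
  then have "bounded {y. f (join (y, z)) \<noteq> 0}" unfolding bounded_iff by blast
  then show ?thesis unfolding test_fun_iff using smooth_slice[OF test_fun_smooth[OF f]] by blast
qed

text \<open>Fubini over horizontal slices, with \<open>X\<close> replaced by a Borel version. Each
  slice is a pairing of \<open>X\<close> with a planar test function, so weak identities in the
  plane can be inserted.\<close>

lemma integral_fiber:
  fixes X :: "R2 \<Rightarrow> real"
  assumes f: "test_fun f" and s: "continuous_on UNIV s" and X: "loc_integrable X"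
  shows "integrable lborel (\<lambda>z. s z * (LINT y|lebesgue. f (join (y, z)) * X y))"
    and "(LINT x|lebesgue. f x * (s (x $ 3) * X (plane x))) = (LINT z|lborel. s z * (LINT y|lebesgue. f (join (y, z)) * X y))"
proof -
  have s3: "continuous_on UNIV (\<lambda>x :: R3. s (x $ 3))"
    by (rule continuous_on_compose2[OF s]) (auto intro: continuous_intros)
  have int: "integrable lebesgue (\<lambda>x. f x * (s (x $ 3) * X (plane x)))"
    using test_fun_integrable[OF loc_integrable_continuous_mult[OF s3 loc_integrable_plane[OF X]] f] by simp
  obtain X' where X': "X' \<in> borel_measurable lborel" "AE y in lborel. X y = X' y"
    using completion_ex_borel_measurable_real[OF loc_integrable_measurable[OF X]] by auto
  have X'm[measurable]: "X' \<in> borel_measurable borel" using X'(1) by simp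
  have [measurable]: "f \<in> borel_measurable borel" by (rule smooth_borel[OF test_fun_smooth[OF f]])
  have [measurable]: "s \<in> borel_measurable borel" by (rule borel_measurable_continuous_onI[OF s])
  have [measurable]: "plane \<in> borel_measurable borel" by (rule plane_borel)
  have jm: "join \<in> pair_lborel \<rightarrow>\<^sub>M borel" using join_borel by (simp add: lborel_prod)
  define h where "h x = f x * (s (x $ 3) * X' (plane x))" for x
  have hm: "h \<in> borel_measurable borel" unfolding h_def by measurable
  then have hm': "h \<in> borel_measurable lebesgue" by (intro measurable_completion) simp
  have ae: "AE x in lebesgue. f x * (s (x $ 3) * X (plane x)) = h x"
    using AE_completion[OF AE_plane[OF X'(2)]] by eventually_elim (simp add: h_def)
  have "integrable lebesgue h"
    using int integrable_cong_AE[OF borel_measurable_integrable[OF int] hm' ae] by simp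
  then have "integrable lborel h" using hm by (simp add: integrable_completion)
  then have "integrable (distr pair_lborel borel join) h" unfolding distr_join .
  then have ij: "integrable pair_lborel (\<lambda>p. h (join p))" by (rule integrable_distr[OF jm])
  then have ij': "integrable pair_lborel (\<lambda>(y, z). h (join (y, z)))" by (simp add: case_prod_unfold)
  have inner: "(LINT y|lborel. h (join (y, z))) = s z * (LINT y|lebesgue. f (join (y, z)) * X y)" for z
  proof -
    have "(LINT y|lebesgue. f (join (y, z)) * X y) = (LINT y|lebesgue. f (join (y, z)) * X' y)"
    proof (rule integral_cong_AE)
      have fz: "(\<lambda>y. f (join (y, z))) \<in> borel_measurable lebesgue"
        by (rule smooth_lebesgue_measurable[OF test_fun_smooth[OF test_fun_slice[OF f]]])
      have X'l: "X' \<in> borel_measurable lebesgue" using X'm by (intro measurable_completion) simp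
      show "(\<lambda>y. f (join (y, z)) * X y) \<in> borel_measurable lebesgue" "(\<lambda>y. f (join (y, z)) * X' y) \<in> borel_measurable lebesgue"
        using fz X'l loc_integrable_measurable[OF X] by (auto intro: borel_measurable_times)
      show "AE y in lebesgue. f (join (y, z)) * X y = f (join (y, z)) * X' y"
        using AE_completion[OF X'(2)] by eventually_elim simp
    qed
    also have "\<dots> = (LINT y|lborel. f (join (y, z)) * X' y)"
      using smooth_borel[OF test_fun_smooth[OF test_fun_slice[OF f]], of z] by (intro integral_completion) simp
    finally show ?thesis unfolding h_def by (simp add: plane_join join_nth mult.left_commute)
  qed
  show "integrable lborel (\<lambda>z. s z * (LINT y|lebesgue. f (join (y, z)) * X y))"
    using lborel_pair.integrable_snd[OF ij'] unfolding inner .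
  have "(LINT x|lebesgue. f x * (s (x $ 3) * X (plane x))) = (LINT x|lebesgue. h x)"
    by (rule integral_cong_AE[OF borel_measurable_integrable[OF int] hm' ae])
  also have "\<dots> = (LINT x|lborel. h x)" using hm by (intro integral_completion) simp
  also have "\<dots> = (LINT p|pair_lborel. h (join p))"
    by (subst distr_join[symmetric], rule integral_distr[OF jm hm])
  also have "\<dots> = (LINT p|pair_lborel. (\<lambda>(y, z). h (join (y, z))) p)" by (simp add: case_prod_unfold)
  also have "\<dots> = (LINT z|lborel. LINT y|lborel. h (join (y, z)))"
    by (rule lborel_pair.integral_snd[OF ij', symmetric])
  finally show "(LINT x|lebesgue. f x * (s (x $ 3) * X (plane x))) = (LINT z|lborel. s z * (LINT y|lebesgue. f (join (y, z)) * X y))"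
    unfolding inner .
qed

section \<open>The curl of the time primitive\<close>

text \<open>The span of the sine and the cosine of one affine phase is closed under partial
  differentiation.\<close>

lemma smooth_trig: "smooth (\<lambda>x :: real ^ 'n::finite. a * sin (k * x $ i + c) + b * cos (k * x $ i + c))"
proof (rule smooth_coinduct[of _ "{\<lambda>x. a * sin (k * x $ i + c) + b * cos (k * x $ i + c) | a b. True}"])
  fix f :: "real ^ 'n \<Rightarrow> real" and j
  assume "f \<in> {\<lambda>x. a * sin (k * x $ i + c) + b * cos (k * x $ i + c) | a b. True}"
  then obtain a b where f: "f = (\<lambda>x. a * sin (k * x $ i + c) + b * cos (k * x $ i + c))" by blast
  have D: "(f has_derivative (\<lambda>h. (a * cos (k * x $ i + c) - b * sin (k * x $ i + c)) * (k * h $ i))) (at x)" for x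
    unfolding f by (auto intro!: derivative_eq_intros bounded_linear.has_derivative[OF bounded_linear_vec_nth]
        simp: algebra_simps)
  then show "f differentiable at x" for x unfolding differentiable_def by blast
  have "partial j f = (\<lambda>x. (- b * (k * axis j 1 $ i)) * sin (k * x $ i + c) + (a * (k * axis j 1 $ i)) * cos (k * x $ i + c))"
    by (rule ext) (simp add: has_derivative_imp_partial[OF D] algebra_simps)
  then show "partial j f \<in> {\<lambda>x. a * sin (k * x $ i + c) + b * cos (k * x $ i + c) | a b. True}" by blast
qed blast

lemma partial_trig:
  "partial i (\<lambda>x. a * sin (k * x $ i + c) + b * cos (k * x $ i + c)) x
    = k * (a * cos (k * x $ i + c) - b * sin (k * x $ i + c))"
proof -
  have "((\<lambda>x. a * sin (k * x $ i + c) + b * cos (k * x $ i + c)) has_derivative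
      (\<lambda>h. (a * cos (k * x $ i + c) - b * sin (k * x $ i + c)) * (k * h $ i))) (at x)"
    by (auto intro!: derivative_eq_intros bounded_linear.has_derivative[OF bounded_linear_vec_nth]
        simp: algebra_simps)
  from has_derivative_imp_partial[OF this] show ?thesis by simp
qed

text \<open>The tensor product of \<open>X\<close> and \<open>s\<close>, read as a distribution on
  space and tested with \<open>f\<close>. The weak identities for the fields become linear relations
  between such numbers.\<close>

definition fiber_pairing :: "(real \<Rightarrow> real) \<Rightarrow> (R3 \<Rightarrow> real) \<Rightarrow> (R2 \<Rightarrow> real) \<Rightarrow> real" where
  "fiber_pairing s f X = (LINT x|lebesgue. f x * (s (x $ 3) * X (plane x)))"

lemma fiber_pairing_integrable:
  assumes "test_fun f" "continuous_on UNIV s" "loc_integrable X"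
  shows "integrable lebesgue (\<lambda>x. f x * (s (x $ 3) * X (plane x)))"
proof -
  have s3: "continuous_on UNIV (\<lambda>x :: R3. s (x $ 3))"
    by (rule continuous_on_compose2[OF assms(2)]) (auto intro: continuous_intros)
  show ?thesis
    using test_fun_integrable[OF loc_integrable_continuous_mult[OF s3 loc_integrable_plane[OF assms(3)]] assms(1)]
    by simp
qed

text \<open>Slices of \<open>f\<close> are planar test functions and slicing commutes with the first
  two partial derivatives, so the planar relation holds on each slice and can be integrated against
  \<open>s\<close>. The coefficients are general enough to fit every component of the ring
  curl.\<close>

lemma fiber_pairing_weak_relation:
  assumes f: "test_fun f" and s: "continuous_on UNIV s"
    and l: "loc_integrable P" "loc_integrable P'" "loc_integrable Q1" "loc_integrable Q2"
    and weak: "\<And>\<psi>. test_fun \<psi> \<Longrightarrow> (LINT y|lebesgue. \<psi> y * P y) + \<kappa> * (LINT y|lebesgue. \<psi> y * P' y)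
      + a * (LINT y|lebesgue. partial 1 \<psi> y * Q1 y) + b * (LINT y|lebesgue. partial 2 \<psi> y * Q2 y) = 0"
  shows "fiber_pairing s f P + \<kappa> * fiber_pairing s f P'
    + a * fiber_pairing s (partial 1 f) Q1 + b * fiber_pairing s (partial 2 f) Q2 = 0"
proof -
  let ?f = "\<lambda>z y. f (join (y, z))"
  have p: "partial 1 f (join (y, z)) = partial 1 (?f z) y" "partial 2 f (join (y, z)) = partial 2 (?f z) y" for y z
    using slice_differentiable(2)[of f 1 z y] slice_differentiable(2)[of f 2 z y] test_fun_differentiable[OF f]
    by (simp_all add: embed_index_def)
  note pf = test_fun_partial[OF f]
  note I = integral_fiber(1)[OF f s l(1)] integral_fiber(1)[OF f s l(2)]
    integral_fiber(1)[OF pf[of 1] s l(3)] integral_fiber(1)[OF pf[of 2] s l(4)]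
  have "fiber_pairing s f P + \<kappa> * fiber_pairing s f P'
      + a * fiber_pairing s (partial 1 f) Q1 + b * fiber_pairing s (partial 2 f) Q2
    = (LINT z|lborel. s z * (LINT y|lebesgue. ?f z y * P y) + \<kappa> * (s z * (LINT y|lebesgue. ?f z y * P' y))
      + a * (s z * (LINT y|lebesgue. partial 1 f (join (y, z)) * Q1 y))
      + b * (s z * (LINT y|lebesgue. partial 2 f (join (y, z)) * Q2 y)))"
    unfolding fiber_pairing_def integral_fiber(2)[OF f s l(1)] integral_fiber(2)[OF f s l(2)]
      integral_fiber(2)[OF pf s l(3)] integral_fiber(2)[OF pf s l(4)]
    using I by simp
  also have "\<dots> = (LINT z|lborel. s z * ((LINT y|lebesgue. ?f z y * P y) + \<kappa> * (LINT y|lebesgue. ?f z y * P' y)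
      + a * (LINT y|lebesgue. partial 1 (?f z) y * Q1 y) + b * (LINT y|lebesgue. partial 2 (?f z) y * Q2 y)))"
    unfolding p by (rule Bochner_Integration.integral_cong) (simp_all add: algebra_simps)
  also have "\<dots> = 0" by (simp add: weak[OF test_fun_slice[OF f]])
  finally show ?thesis .
qed

text \<open>\<open>X (plane x)\<close> is constant along the third axis, so the third partial
  derivative of f times a trigonometric factor integrates to 0 against it; the product rule moves
  the derivative to the trigonometric factor.\<close>

lemma fiber_pairing_partial_3:
  assumes f: "test_fun f" and X: "loc_integrable X"
  shows "fiber_pairing (\<lambda>z. sin (k * z + c)) (partial 3 f) X = - k * fiber_pairing (\<lambda>z. cos (k * z + c)) f X"
    and "fiber_pairing (\<lambda>z. cos (k * z + c)) (partial 3 f) X = k * fiber_pairing (\<lambda>z. sin (k * z + c)) f X"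
proof -
  have sc: "continuous_on UNIV (\<lambda>z. sin (k * z + c))" "continuous_on UNIV (\<lambda>z. cos (k * z + c))"
    by (auto intro!: continuous_intros)
  have *: "(a * fiber_pairing (\<lambda>z. sin (k * z + c)) (partial 3 f) X + b * fiber_pairing (\<lambda>z. cos (k * z + c)) (partial 3 f) X)
     + (k * a * fiber_pairing (\<lambda>z. cos (k * z + c)) f X - k * b * fiber_pairing (\<lambda>z. sin (k * z + c)) f X) = 0" for a b
  proof -
    let ?s = "\<lambda>x :: R3. a * sin (k * x $ 3 + c) + b * cos (k * x $ 3 + c)"
    have t: "test_fun (\<lambda>x. ?s x * f x)" by (rule test_fun_mult_left[OF smooth_trig f])
    have pt: "plane (x + h *\<^sub>R axis 3 1) = plane x" for x h
      by (simp add: vec_eq_iff forall_2 plane_nth axis_nth_3)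
    have "0 = (LINT x|lebesgue. partial 3 (\<lambda>x. ?s x * f x) x * X (plane x))"
      by (rule integral_partial_mult_invariant[OF loc_integrable_plane[OF X] t, symmetric]) (simp add: pt)
    also have "\<dots> = (LINT x|lebesgue. a * (partial 3 f x * (sin (k * x $ 3 + c) * X (plane x)))
        + b * (partial 3 f x * (cos (k * x $ 3 + c) * X (plane x)))
        + (k * a * (f x * (cos (k * x $ 3 + c) * X (plane x))) - k * b * (f x * (sin (k * x $ 3 + c) * X (plane x)))))"
      unfolding partial_mult[OF smooth_differentiable[OF smooth_trig] test_fun_differentiable[OF f]] partial_trig
      by (rule Bochner_Integration.integral_cong) (simp_all add: algebra_simps)
    also have "\<dots> = (a * fiber_pairing (\<lambda>z. sin (k * z + c)) (partial 3 f) X + b * fiber_pairing (\<lambda>z. cos (k * z + c)) (partial 3 f) X)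
     + (k * a * fiber_pairing (\<lambda>z. cos (k * z + c)) f X - k * b * fiber_pairing (\<lambda>z. sin (k * z + c)) f X)"
      unfolding fiber_pairing_def
      using fiber_pairing_integrable[OF test_fun_partial[OF f, of 3] sc(1) X] fiber_pairing_integrable[OF f sc(1) X]
        fiber_pairing_integrable[OF test_fun_partial[OF f, of 3] sc(2) X] fiber_pairing_integrable[OF f sc(2) X]
      by simp
    finally show ?thesis by simp
  qed
  show "fiber_pairing (\<lambda>z. sin (k * z + c)) (partial 3 f) X = - k * fiber_pairing (\<lambda>z. cos (k * z + c)) f X"
    using *[of 1 0] by simp
  show "fiber_pairing (\<lambda>z. cos (k * z + c)) (partial 3 f) X = k * fiber_pairing (\<lambda>z. sin (k * z + c)) f X"
    using *[of 0 1] by simp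
qed

text \<open>One formula with two uses: at the phase \<open>\<omega> * t\<close> it produces
  \<open>A_field\<close> from \<open>u\<close>, and the curl of \<open>A_field\<close> from the ring
  curl of \<open>u\<close>.\<close>

definition curl_field :: "real \<Rightarrow> real \<Rightarrow> (R2 \<Rightarrow> R6) \<Rightarrow> R3 \<Rightarrow> R3" where
  "curl_field k \<theta> c x = sin (k * x $ 3 + \<theta>) *\<^sub>R fst (c (plane x)) - cos (k * x $ 3 + \<theta>) *\<^sub>R snd (c (plane x))"

lemma A_field_eq: "A_field k \<omega> u x t = curl_field k (\<omega> * t) u x"
  unfolding A_field_def curl_field_def by simp

lemma loc_integrable_R6_components:
  assumes "loc_integrable (c :: R2 \<Rightarrow> R6)"
  shows "loc_integrable (\<lambda>x. fst (c x) $ j)" "loc_integrable (\<lambda>x. snd (c x) $ j)"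
  using loc_integrable_inner[OF assms, of "(axis j 1, 0)"] loc_integrable_inner[OF assms, of "(0, axis j 1)"]
  by (simp_all add: inner_left_component inner_right_component)

lemma loc_integrable_vec_componentwise:
  fixes g :: "real ^ 'n::finite \<Rightarrow> real ^ 'm::finite"
  assumes "\<And>j. loc_integrable (\<lambda>x. g x $ j)" shows "loc_integrable g"
proof -
  have "g = (\<lambda>x. \<Sum>j\<in>UNIV. g x $ j *\<^sub>R axis j 1)"
    by (auto simp: vec_eq_iff axis_def if_distrib[of "\<lambda>c. _ * c"] cong: if_cong)
  moreover have "loc_integrable (\<lambda>x. \<Sum>j\<in>UNIV. g x $ j *\<^sub>R (axis j 1 :: real ^ 'm))"
    unfolding loc_integrable_def set_integrable_def
  proof (intro allI impI)
    fix K :: "(real ^ 'n) set" assume "compact K"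
    then have "integrable lebesgue (\<lambda>x. (indicator K x * g x $ j) *\<^sub>R (axis j 1 :: real ^ 'm))" for j
      using assms[of j] unfolding loc_integrable_def set_integrable_def
      by (intro integrable_scaleR_left) auto
    then show "integrable lebesgue (\<lambda>x. indicator K x *\<^sub>R (\<Sum>j\<in>UNIV. g x $ j *\<^sub>R (axis j 1 :: real ^ 'm)))"
      by (simp add: scaleR_sum_right)
  qed
  ultimately show ?thesis by simp
qed

lemma curl_field_nth:
  "curl_field k \<theta> c x $ j = sin (k * x $ 3 + \<theta>) * fst (c (plane x)) $ j - cos (k * x $ 3 + \<theta>) * snd (c (plane x)) $ j"
  unfolding curl_field_def by simp

lemma loc_integrable_curl_field:
  assumes "loc_integrable c" shows "loc_integrable (curl_field k \<theta> c)"
proof (rule loc_integrable_vec_componentwise)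
  show "loc_integrable (\<lambda>x. curl_field k \<theta> c x $ j)" for j
    unfolding curl_field_nth
    by (intro loc_integrable_diff loc_integrable_continuous_mult loc_integrable_plane
        loc_integrable_R6_components assms continuous_intros)
qed

lemma fiber_pairing_curl_field:
  assumes c: "loc_integrable c" and f: "test_fun f"
  shows "(LINT x|lebesgue. f x * curl_field k \<theta> c x $ j)
    = fiber_pairing (\<lambda>z. sin (k * z + \<theta>)) f (\<lambda>y. fst (c y) $ j) - fiber_pairing (\<lambda>z. cos (k * z + \<theta>)) f (\<lambda>y. snd (c y) $ j)"
proof -
  have sc: "continuous_on UNIV (\<lambda>z. sin (k * z + \<theta>))" "continuous_on UNIV (\<lambda>z. cos (k * z + \<theta>))"
    by (auto intro!: continuous_intros)
  show ?thesis
    unfolding fiber_pairing_def curl_field_nth right_diff_distrib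
    by (intro Bochner_Integration.integral_diff fiber_pairing_integrable f sc loc_integrable_R6_components c)
qed

text \<open>The derivative in x3 of sin U - cos U~ is k (cos U + sin U~). Collecting the sines and
  cosines in the curl gives the first half of the ring curl with the sine and the second half with
  minus the cosine.\<close>

lemma represents_dcurl_curl_field:
  assumes u: "loc_integrable u" and c: "represents c (ring_dcurl k u)"
  shows "represents (curl_field k \<theta> c) (dcurl (curl_field k \<theta> u))"
  unfolding represents_def
proof (intro conjI allI impI)
  have cl: "loc_integrable c" using c unfolding represents_def by blast
  show cfl: "loc_integrable (curl_field k \<theta> c)" by (rule loc_integrable_curl_field[OF cl])
  fix f :: "R3 \<Rightarrow> real" assume f: "test_fun f"
  have W: "dist_of c \<psi> = ring_dcurl k u \<psi>" if "test_fun \<psi>" for \<psi>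
    using c that unfolding represents_def by blast
  note Wc = W[THEN arg_cong[where f = "\<lambda>z. fst z $ 1"]] W[THEN arg_cong[where f = "\<lambda>z. fst z $ 2"]]
    W[THEN arg_cong[where f = "\<lambda>z. fst z $ 3"]] W[THEN arg_cong[where f = "\<lambda>z. snd z $ 1"]]
    W[THEN arg_cong[where f = "\<lambda>z. snd z $ 2"]] W[THEN arg_cong[where f = "\<lambda>z. snd z $ 3"]]
  let ?S = "\<lambda>z. sin (k * z + \<theta>)" and ?C = "\<lambda>z. cos (k * z + \<theta>)"
  let ?U = "\<lambda>j y. fst (u y) $ j" and ?U' = "\<lambda>j y. snd (u y) $ j"
  let ?c = "\<lambda>j y. fst (c y) $ j" and ?c' = "\<lambda>j y. snd (c y) $ j"
  have sc: "continuous_on UNIV ?S" "continuous_on UNIV ?C" by (auto intro!: continuous_intros)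
  note lu = loc_integrable_R6_components[OF u] and lc = loc_integrable_R6_components[OF cl]
  \<comment> \<open>The six components of the ring curl in the common shape of
    \<open>fiber_pairing_weak_relation\<close>, with coefficient 0 for absent terms. The first three
    are used with the sine, the others with the cosine.\<close>
  have R1: "fiber_pairing s f (?c 1) + k * fiber_pairing s f (?U' 2)
      + 0 * fiber_pairing s (partial 1 f) (?U 3) + 1 * fiber_pairing s (partial 2 f) (?U 3) = 0"
    and R2: "fiber_pairing s f (?c 2) + (- k) * fiber_pairing s f (?U' 1)
      + (-1) * fiber_pairing s (partial 1 f) (?U 3) + 0 * fiber_pairing s (partial 2 f) (?U 3) = 0"
    and R3: "fiber_pairing s f (?c 3) + 0 * fiber_pairing s f (?U' 1)
      + 1 * fiber_pairing s (partial 1 f) (?U 2) + (-1) * fiber_pairing s (partial 2 f) (?U 1) = 0"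
    and R4: "fiber_pairing s f (?c' 1) + (- k) * fiber_pairing s f (?U 2)
      + 0 * fiber_pairing s (partial 1 f) (?U' 3) + 1 * fiber_pairing s (partial 2 f) (?U' 3) = 0"
    and R5: "fiber_pairing s f (?c' 2) + k * fiber_pairing s f (?U 1)
      + (-1) * fiber_pairing s (partial 1 f) (?U' 3) + 0 * fiber_pairing s (partial 2 f) (?U' 3) = 0"
    and R6: "fiber_pairing s f (?c' 3) + 0 * fiber_pairing s f (?U 1)
      + 1 * fiber_pairing s (partial 1 f) (?U' 2) + (-1) * fiber_pairing s (partial 2 f) (?U' 1) = 0"
    if s: "continuous_on UNIV s" for s
    by (rule fiber_pairing_weak_relation[OF f s lc(1) lu(2) lu(1) lu(1)]
          fiber_pairing_weak_relation[OF f s lc(2) lu(1) lu(2) lu(2)],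
        use Wc in \<open>simp add: dist_of_R6_components[OF cl] ring_dcurl_components\<close>)+
  note R = R1[OF sc(1)] R2[OF sc(1)] R3[OF sc(1)] R4[OF sc(2)] R5[OF sc(2)] R6[OF sc(2)]
  note d3 = fiber_pairing_partial_3[OF f lu(1), of k \<theta>] fiber_pairing_partial_3[OF f lu(2), of k \<theta>]
  have dp: "dpartial i (\<lambda>x. curl_field k \<theta> u x $ j) f
     = - (fiber_pairing ?S (partial i f) (?U j) - fiber_pairing ?C (partial i f) (?U' j))" for i j
    unfolding dpartial_def dist_of_def using fiber_pairing_curl_field[OF u test_fun_partial[OF f]] by simp
  have dc: "dist_of (curl_field k \<theta> c) f $ j = fiber_pairing ?S f (?c j) - fiber_pairing ?C f (?c' j)" for j
    using dist_of_inner[OF cfl f, of "axis j 1"] fiber_pairing_curl_field[OF cl f, of k \<theta> j] by (simp add: inner_axis)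
  show "dist_of (curl_field k \<theta> c) f = dcurl (curl_field k \<theta> u) f"
    unfolding vec_eq_iff forall_3 dc dcurl_def Let_def vector_3 dp
    using R by (simp add: d3)
qed

section \<open>Energy bounds\<close>

context doubling_N_function
begin

text \<open>Doubling replaces subadditivity: a + b is at most twice the maximum, and
  \<open>\<Phi>\<close> of the maximum is at most the sum of both values.\<close>

lemma integrable_add:
  assumes [measurable]: "f \<in> borel_measurable M" "g \<in> borel_measurable M"
    and nn: "\<And>x. 0 \<le> f x" "\<And>x. 0 \<le> g x"
    and i: "integrable M (\<lambda>x. \<Phi> (f x))" "integrable M (\<lambda>x. \<Phi> (g x))"
  shows "integrable M (\<lambda>x. \<Phi> (f x + g x))"
proof -
  obtain C where C: "C \<ge> 0" "\<And>t. t \<ge> 0 \<Longrightarrow> \<Phi> (2 * t) \<le> C * \<Phi> t" by (rule dilation_bound[of 2]) blast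
  show ?thesis
  proof (rule Bochner_Integration.integrable_bound)
    show "integrable M (\<lambda>x. C * \<Phi> (f x) + C * \<Phi> (g x))" using i by simp
    show "(\<lambda>x. \<Phi> (f x + g x)) \<in> borel_measurable M"
      by (rule borel_measurable_continuous_on[OF continuous]) simp
    have "\<Phi> (a + b) \<le> C * \<Phi> a + C * \<Phi> b" if "0 \<le> a" "0 \<le> b" for a b
    proof -
      have "\<Phi> (a + b) \<le> \<Phi> (2 * max a b)" using that by (intro mono) auto
      also have "\<dots> \<le> C * \<Phi> (max a b)" using that by (intro C) auto
      also have "\<dots> \<le> C * \<Phi> a + C * \<Phi> b"
        using C(1) nonneg[of a] nonneg[of b] by (auto simp: max_def)
      finally show ?thesis .
    qed
    then show "AE x in M. norm (\<Phi> (f x + g x)) \<le> norm (C * \<Phi> (f x) + C * \<Phi> (g x))"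
      using nn nonneg C(1) by (intro AE_I2) (simp add: abs_of_nonneg)
  qed
qed

lemma integrable_sum:
  assumes "finite I" "\<And>i. i \<in> I \<Longrightarrow> f i \<in> borel_measurable M" "\<And>i x. 0 \<le> f i x"
    and "\<And>i. i \<in> I \<Longrightarrow> integrable M (\<lambda>x. \<Phi> (f i x))"
  shows "integrable M (\<lambda>x. \<Phi> (\<Sum>i\<in>I. f i x))"
  using assms(1,2,4)
proof (induction I)
  case (insert i I)
  have "integrable M (\<lambda>x. \<Phi> (f i x + (\<Sum>i\<in>I. f i x)))"
    by (rule integrable_add) (use insert assms(3) in \<open>auto intro!: sum_nonneg\<close>)
  then show ?case using insert(1,2) by simp
qed (simp add: zero)

text \<open>The embedding is scalar, so |v| is bounded by the sum of its absolute components, each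
  in \<open>H1\<close>; the part \<open>w\<close> lies in the Orlicz space by definition.\<close>

lemma X_space_integrable:
  assumes u: "u \<in> X_space k \<Phi>"
  shows "integrable lebesgue (\<lambda>x. \<Phi> (norm (u x)))" and "u \<in> L2"
proof -
  obtain v w where vw: "v \<in> V_space k" "w \<in> W_space k \<Phi>" "u = (\<lambda>x. v x + w x)"
    using u unfolding X_space_def by blast
  have w: "w \<in> L2" "w \<in> borel_measurable lebesgue" "integrable lebesgue (\<lambda>x. \<Phi> (norm (w x)))"
    using vw(2) unfolding W_space_def L_Phi_def by auto
  have v: "v \<in> L2" by (rule V_space_L2[OF vw(1)])
  show uL: "u \<in> L2" unfolding vw(3) by (rule L2_add[OF v w(1)])
  have vm: "v \<in> borel_measurable lebesgue" using v unfolding L2_def by blast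
  have vb: "(\<lambda>x. v x \<bullet> b) \<in> H1" if "b \<in> Basis" for b
    using vw(1) that unfolding V_space_def by blast
  have S: "integrable lebesgue (\<lambda>x. \<Phi> (\<Sum>b\<in>Basis. \<bar>v x \<bullet> b\<bar>))"
    by (rule integrable_sum) (use vm vb in \<open>auto intro: H1_imp_integrable\<close>)
  have T: "integrable lebesgue (\<lambda>x. \<Phi> ((\<Sum>b\<in>Basis. \<bar>v x \<bullet> b\<bar>) + norm (w x)))"
    by (rule integrable_add[OF _ _ _ _ S w(3)]) (use vm w(2) in \<open>auto intro!: sum_nonneg\<close>)
  show "integrable lebesgue (\<lambda>x. \<Phi> (norm (u x)))"
  proof (rule Bochner_Integration.integrable_bound[OF T])
    show "(\<lambda>x. \<Phi> (norm (u x))) \<in> borel_measurable lebesgue"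
      by (rule borel_measurable_continuous_on[OF continuous]) (use uL in \<open>auto simp: L2_def\<close>)
    have "norm (u x) \<le> (\<Sum>b\<in>Basis. \<bar>v x \<bullet> b\<bar>) + norm (w x)" for x
      using norm_triangle_ineq[of "v x" "w x"] norm_le_l1[of "v x"] unfolding vw(3) by linarith
    then show "AE x in lebesgue. norm (\<Phi> (norm (u x))) \<le> norm (\<Phi> ((\<Sum>b\<in>Basis. \<bar>v x \<bullet> b\<bar>) + norm (w x)))"
      using nonneg by (intro AE_I2) (auto simp: abs_of_nonneg intro!: mono)
  qed
qed

text \<open>Slopes of a convex function starting at t increase with the other endpoint and are
  nonnegative here, so they converge to their infimum; this is what gives \<open>Lim\<close> a
  meaning. The infimum is at most the slope from t to 2 t.\<close>

lemma right_deriv_le: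
  assumes t: "t > 0"
  shows "right_deriv \<Phi> t * t \<le> \<Phi> (2 * t)"
proof -
  define q where "q s = (\<Phi> s - \<Phi> t) / (s - t)" for s
  have q_mono: "q s \<le> q s'" if "t < s" "s \<le> s'" for s s'
  proof (cases "s = s'")
    case False
    have "(\<Phi> t - \<Phi> s) / (t - s) \<le> (\<Phi> t - \<Phi> s') / (t - s')"
      by (rule convex_on_slope_le(1)[OF convex]) (use that False in auto)
    moreover have "(\<Phi> t - \<Phi> s) / (t - s) = q s" for s
      unfolding q_def using minus_divide_divide[of "\<Phi> s - \<Phi> t" "s - t"] by simp
    ultimately show ?thesis by simp
  qed simp
  have q0: "0 \<le> q s" if "t < s" for s
    unfolding q_def using mono[of t s] t that by simp
  define L where "L = Inf (q ` {t<..})"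
  have bdd: "bdd_below (q ` {t<..})" using q0 by (intro bdd_belowI2) auto
  have L: "L \<le> q s" if "t < s" for s
    unfolding L_def by (rule cInf_lower[OF _ bdd]) (use that in auto)
  have "(q \<longlongrightarrow> L) (at_right t)"
  proof (rule order_tendstoI)
    fix a assume "a < L"
    then show "\<forall>\<^sub>F s in at_right t. a < q s"
      using L by (auto simp: eventually_at_filter intro!: always_eventually intro: less_le_trans)
  next
    fix a assume "L < a"
    then obtain s0 where s0: "t < s0" "q s0 < a"
      using cInf_lessD[of "q ` {t<..}" a] unfolding L_def by auto
    show "\<forall>\<^sub>F s in at_right t. q s < a"
      unfolding eventually_at_right[OF s0(1)]
    proof (intro exI[of _ s0] conjI allI impI s0(1))
      fix y assume "y > t" "y < s0"
      then show "q y < a" using q_mono[of y s0] s0(2) by simp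
    qed
  qed
  then have "right_deriv \<Phi> t = L"
    unfolding right_deriv_def q_def by (intro tendsto_Lim) simp_all
  also have "L \<le> q (2 * t)" by (rule L) (use t in simp)
  finally have "right_deriv \<Phi> t * t \<le> q (2 * t) * t" using t by (intro mult_right_mono) auto
  also have "\<dots> = \<Phi> (2 * t) - \<Phi> t" unfolding q_def using t by simp
  finally show ?thesis using nonneg[of t] by simp
qed

text \<open>(F1) gives |z|^2 for |z| < d. For |z| \<ge> d the constant 1 in the growth bound
  contributes c |z|, at most (c / d) |z|^2, and the derivative term is handled by
  \<open>right_deriv_le\<close> and doubling.\<close>

lemma nonlinearity_growth:
  fixes f :: "'a::real_inner \<Rightarrow> 'a"
  assumes small: "(\<lambda>z. norm (f z)) \<in> o[at 0](\<lambda>z. norm z)"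
    and growth: "\<And>z. norm (f z) \<le> c * (1 + right_deriv \<Phi> (norm z))" and c: "c > 0"
  obtains K where "K \<ge> 0" "\<And>z. f z \<bullet> z \<le> K * ((norm z)\<^sup>2 + \<Phi> (norm z))"
proof -
  have "\<forall>\<^sub>F z in at 0. norm (norm (f z)) \<le> 1 * norm (norm z)"
    by (rule landau_o.smallD[OF small]) simp
  then obtain d where d: "d > 0" "\<And>z. z \<noteq> 0 \<Longrightarrow> norm z < d \<Longrightarrow> norm (f z) \<le> norm z"
    unfolding eventually_at by auto
  obtain C where C: "C \<ge> 0" "\<And>t. t \<ge> 0 \<Longrightarrow> \<Phi> (2 * t) \<le> C * \<Phi> t" by (rule dilation_bound[of 2]) blast
  show thesis
  proof (rule that)
    show "0 \<le> 1 + c / d + c * C" using c d C by simp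
    fix z :: 'a
    let ?K = "1 + c / d + c * C"
    have a: "f z \<bullet> z \<le> norm (f z) * norm z" by (rule norm_cauchy_schwarz)
    have p: "0 \<le> c / d * (norm z)\<^sup>2" "0 \<le> c * C * (norm z)\<^sup>2" "0 \<le> \<Phi> (norm z)" "0 \<le> c / d * \<Phi> (norm z)"
      "0 \<le> c * C * \<Phi> (norm z)"
      using c d C nonneg by simp_all
    consider "z = 0" | "z \<noteq> 0" "norm z < d" | "d \<le> norm z" by linarith
    then show "f z \<bullet> z \<le> ?K * ((norm z)\<^sup>2 + \<Phi> (norm z))"
    proof cases
      case 1
      then show ?thesis by (simp add: zero)
    next
      case 2
      have "norm (f z) * norm z \<le> norm z * norm z" by (rule mult_right_mono[OF d(2)[OF 2]]) simp
      then show ?thesis using a p by (simp add: algebra_simps power2_eq_square)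
    next
      case 3
      then have z: "norm z > 0" using d(1) by linarith
      have "norm (f z) * norm z \<le> c * (1 + right_deriv \<Phi> (norm z)) * norm z"
        by (rule mult_right_mono[OF growth]) simp
      also have "\<dots> = c * norm z + c * (right_deriv \<Phi> (norm z) * norm z)" by (simp add: algebra_simps)
      also have "\<dots> \<le> c / d * (norm z)\<^sup>2 + c * (C * \<Phi> (norm z))"
      proof (rule add_mono)
        have "d * norm z \<le> norm z * norm z" by (rule mult_right_mono[OF 3]) simp
        then have "norm z \<le> (norm z)\<^sup>2 / d" using d(1) by (simp add: field_simps power2_eq_square)
        then show "c * norm z \<le> c / d * (norm z)\<^sup>2" using mult_left_mono[of "norm z" "(norm z)\<^sup>2 / d" c] c by simp
        show "c * (right_deriv \<Phi> (norm z) * norm z) \<le> c * (C * \<Phi> (norm z))"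
          using right_deriv_le[OF z] C(2)[of "norm z"] c by (intro mult_left_mono) auto
      qed
      finally have "f z \<bullet> z \<le> c / d * (norm z)\<^sup>2 + c * C * \<Phi> (norm z)" using a by (simp add: mult.assoc)
      moreover have "?K * ((norm z)\<^sup>2 + \<Phi> (norm z)) = (norm z)\<^sup>2 + \<Phi> (norm z)
          + (c / d * (norm z)\<^sup>2 + c / d * \<Phi> (norm z)) + (c * C * (norm z)\<^sup>2 + c * C * \<Phi> (norm z))"
        by (simp add: algebra_simps)
      ultimately show ?thesis using p zero_le_power2[of "norm z"] by linarith
    qed
  qed
qed

end

text \<open>The two combinations arise from a, b by an orthogonal matrix, so their squared norms add
  up to that of (a, b).\<close>

lemma norm_trig_combination_le:
  fixes a b :: R3
  shows "(norm (cos \<theta> *\<^sub>R a + sin \<theta> *\<^sub>R b))\<^sup>2 \<le> (norm (a, b))\<^sup>2"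
    and "(norm (sin \<theta> *\<^sub>R a - cos \<theta> *\<^sub>R b))\<^sup>2 \<le> (norm (a, b))\<^sup>2"
proof -
  have "(norm (cos \<theta> *\<^sub>R a + sin \<theta> *\<^sub>R b))\<^sup>2 + (norm (sin \<theta> *\<^sub>R a - cos \<theta> *\<^sub>R b))\<^sup>2
      = (cos \<theta> * cos \<theta> + sin \<theta> * sin \<theta>) * (a \<bullet> a + b \<bullet> b)"
    unfolding power2_norm_eq_inner
    by (simp add: inner_add_left inner_add_right inner_diff_left inner_diff_right inner_commute[of b a] algebra_simps del: sin_cos_squared_add3)
  also have "\<dots> = (norm (a, b))\<^sup>2"
    unfolding power2_norm_eq_inner by simp
  finally have *: "(norm (cos \<theta> *\<^sub>R a + sin \<theta> *\<^sub>R b))\<^sup>2 + (norm (sin \<theta> *\<^sub>R a - cos \<theta> *\<^sub>R b))\<^sup>2 = (norm (a, b))\<^sup>2" .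
  then show "(norm (cos \<theta> *\<^sub>R a + sin \<theta> *\<^sub>R b))\<^sup>2 \<le> (norm (a, b))\<^sup>2"
    "(norm (sin \<theta> *\<^sub>R a - cos \<theta> *\<^sub>R b))\<^sup>2 \<le> (norm (a, b))\<^sup>2"
    using zero_le_power2[of "norm (cos \<theta> *\<^sub>R a + sin \<theta> *\<^sub>R b)"] zero_le_power2[of "norm (sin \<theta> *\<^sub>R a - cos \<theta> *\<^sub>R b)"]
    by linarith+
qed

lemma time_average_E_field:
  assumes \<omega>: "\<omega> > 0"
  shows "time_average (2 * pi / \<omega>) (\<lambda>s. (norm (E_field k \<omega> u x s))\<^sup>2) = 1/2 * (norm (u (plane x)))\<^sup>2"
proof -
  define a b where "a = fst (u (plane x))" and "b = snd (u (plane x))"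
  define \<theta> where "\<theta> s = k * x $ 3 + \<omega> * s" for s
  \<comment> \<open>A primitive in time of the squared norm, written in terms of the double
    angle.\<close>
  define G where "G s = (a \<bullet> a + b \<bullet> b) / 2 * s + (a \<bullet> a - b \<bullet> b) / (4 * \<omega>) * sin (2 * \<theta> s) - (a \<bullet> b) / (2 * \<omega>) * cos (2 * \<theta> s)" for s
  have E: "(norm (E_field k \<omega> u x s))\<^sup>2 = (a \<bullet> a + b \<bullet> b) / 2 + (a \<bullet> a - b \<bullet> b) / 2 * cos (2 * \<theta> s) + (a \<bullet> b) * sin (2 * \<theta> s)" for s
  proof -
    have c: "(cos (\<theta> s))\<^sup>2 = (1 + cos (2 * \<theta> s)) / 2"
      unfolding cos_double_cos by simp
    have d: "(sin (\<theta> s))\<^sup>2 = (1 - cos (2 * \<theta> s)) / 2"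
      unfolding cos_double_cos sin_squared_eq by (simp add: field_simps)
    have "(norm (E_field k \<omega> u x s))\<^sup>2 = (cos (\<theta> s))\<^sup>2 * (a \<bullet> a) + (sin (\<theta> s))\<^sup>2 * (b \<bullet> b) + (2 * sin (\<theta> s) * cos (\<theta> s)) * (a \<bullet> b)"
      unfolding E_field_def a_def[symmetric] b_def[symmetric] \<theta>_def[symmetric] power2_norm_eq_inner
      by (simp add: inner_add_left inner_add_right inner_commute[of b a] power2_eq_square algebra_simps)
    then show ?thesis unfolding c d sin_double[symmetric] by (simp add: field_simps)
  qed
  have "(G has_vector_derivative (norm (E_field k \<omega> u x s))\<^sup>2) (at s within {0..2 * pi / \<omega>})" for s
    unfolding has_real_derivative_iff_has_vector_derivative[symmetric] E G_def \<theta>_def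
    using \<omega> by (auto intro!: derivative_eq_intros simp: field_simps)
  moreover have "continuous_on {0..2 * pi / \<omega>} (\<lambda>s. (norm (E_field k \<omega> u x s))\<^sup>2)"
    unfolding E \<theta>_def by (intro continuous_intros)
  ultimately have "(LINT s:{0..2 * pi / \<omega>}|lborel. (norm (E_field k \<omega> u x s))\<^sup>2) = G (2 * pi / \<omega>) - G 0"
    unfolding set_lebesgue_integral_def using \<omega> by (intro integral_FTC_Icc) auto
  also have "\<dots> = (a \<bullet> a + b \<bullet> b) / 2 * (2 * pi / \<omega>)"
  proof -
    \<comment> \<open>Over one period the double angle gains two full turns, so the oscillating
      terms cancel.\<close>
    have "2 * \<theta> (2 * pi / \<omega>) = 2 * \<theta> 0 + 2 * pi + 2 * pi" unfolding \<theta>_def using \<omega> by (simp add: field_simps)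
    then show ?thesis unfolding G_def by (simp only: sin_periodic cos_periodic)
  qed
  also have "a \<bullet> a + b \<bullet> b = (norm (u (plane x)))\<^sup>2"
    unfolding a_def b_def power2_norm_eq_inner inner_prod_def ..
  finally show ?thesis unfolding time_average_def using \<omega> by (simp add: field_simps)
qed

section \<open>Integration over a slab and finiteness of the energy\<close>

lemma AE_join:
  assumes "AE x in lebesgue. P x"
  shows "AE y in lebesgue. AE z in lebesgue. P (join (y, z))"
proof -
  have jm: "join \<in> pair_lborel \<rightarrow>\<^sub>M borel" using join_borel by (simp add: lborel_prod)
  have "AE x in distr pair_lborel borel join. P x"
    unfolding distr_join using assms by (simp add: AE_completion_iff)
  then have "AE p in pair_lborel. P (join p)" by (rule AE_distrD[OF jm])
  then have "AE y in lborel. AE z in lborel. P (join (y, z))" by (rule lborel_pair.AE_pair)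
  then have "AE y in lebesgue. AE z in lborel. P (join (y, z))" by (rule AE_completion)
  then show ?thesis by eventually_elim (rule AE_completion)
qed

text \<open>By \<open>AE_join\<close> the bound holds almost everywhere on almost every vertical
  fibre; fibres have length 1, so integrating over them returns \<open>b\<close> itself.\<close>

lemma nn_integral_slab_finite:
  fixes g :: "R3 \<Rightarrow> real" and b :: "R2 \<Rightarrow> real"
  assumes b: "integrable lebesgue b" "\<And>y. 0 \<le> b y" and le: "AE x in lebesgue. g x \<le> b (plane x)"
  shows "(\<integral>\<^sup>+y. (\<integral>\<^sup>+z\<in>{a..a+1}. ennreal (g (vector [y $ 1, y $ 2, z])) \<partial>lebesgue) \<partial>(lebesgue :: R2 measure)) < \<infinity>"
proof -
  have "(\<integral>\<^sup>+y. (\<integral>\<^sup>+z\<in>{a..a+1}. ennreal (g (vector [y $ 1, y $ 2, z])) \<partial>lebesgue) \<partial>(lebesgue :: R2 measure))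
      \<le> (\<integral>\<^sup>+y. ennreal (b y) \<partial>lebesgue)"
  proof (rule nn_integral_mono_AE)
    show "AE y in lebesgue. (\<integral>\<^sup>+z\<in>{a..a+1}. ennreal (g (vector [y $ 1, y $ 2, z])) \<partial>lebesgue) \<le> ennreal (b y)"
      using AE_join[OF le]
    proof eventually_elim
      case (elim y)
      have j: "vector [y $ 1, y $ 2, z] = join (y, z)" for z by (simp add: join_def)
      have "(\<integral>\<^sup>+z\<in>{a..a+1}. ennreal (g (vector [y $ 1, y $ 2, z])) \<partial>lebesgue)
          \<le> (\<integral>\<^sup>+z\<in>{a..a+1}. ennreal (b y) \<partial>lebesgue)"
      proof (rule nn_integral_mono_AE)
        show "AE z in lebesgue. ennreal (g (vector [y $ 1, y $ 2, z])) * indicator {a..a+1} z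
            \<le> ennreal (b y) * indicator {a..a+1} z"
          using elim by eventually_elim (auto simp: j plane_join intro!: mult_right_mono ennreal_leI)
      qed
      also have "\<dots> = ennreal (b y) * emeasure lebesgue {a..a+1}"
        by (rule nn_integral_cmult_indicator) simp
      finally show ?case by simp
    qed
  qed
  also have "\<dots> = ennreal (LINT y|lebesgue. b y)"
    by (rule nn_integral_eq_integral[OF b(1)]) (simp add: b(2))
  finally show ?thesis by (rule le_less_trans) simp
qed

text \<open>\<open>weak_curl\<close> is a choice and \<open>em_energy\<close> cuts off negative
  densities, so finiteness alone could concern a meaningless quantity. The other assertions exclude
  this: the chosen curl represents the distribution, and the density is measurable and nonnegative
  almost everywhere.\<close>

theorem mainTheorem2:
  fixes k \<omega> :: real
    and \<Phi> :: "real \<Rightarrow> real"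
    and V \<epsilon> :: "R2 \<Rightarrow> real"
    and F :: "R6 \<Rightarrow> real" and f :: "R6 \<Rightarrow> R6"
    and sus :: "real \<Rightarrow> real"
    and u :: "R2 \<Rightarrow> R6"
    and E D B H :: "R3 \<Rightarrow> real \<Rightarrow> R3"
  assumes k: "k \<noteq> 0"
    and N: "N_function \<Phi>"
    and N1: "Delta2 \<Phi>" "Nabla2 \<Phi>"
    and N2: "((\<lambda>t. \<Phi> t / t\<^sup>2) \<longlongrightarrow> 0) (at 0)"
    and N3: "filterlim (\<lambda>t. \<Phi> t / t\<^sup>2) at_top at_top"
    and V: "V \<in> L_infty"
      "\<exists>g. AE x in lebesgue. V x = g (norm x)"
      "AE x in lebesgue. V x > 0"
      "\<exists>c>0. AE x in lebesgue. V x \<ge> c"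
      "esssup lebesgue (\<lambda>x. ereal (V x)) < ereal (k\<^sup>2)"
    and F0: "convex_on UNIV F" "\<And>z. F z \<ge> 0"
      "\<And>z. GDERIV F z :> f z" "continuous_on UNIV f"
    and F1: "(\<lambda>z. norm (f z)) \<in> o[at 0](\<lambda>z. norm z)"
    and F2: "\<exists>c1>0. \<forall>z. norm (f z) \<le> c1 * (1 + right_deriv \<Phi> (norm z))"
    and F3: "\<exists>\<gamma>>2. \<exists>c2>0. \<forall>z. 1 / \<gamma> * (f z \<bullet> z) \<ge> F z \<and> F z \<ge> c2 * \<Phi> (norm z)"
    and \<omega>: "\<omega> > 0"
    and V_eq: "AE x in lebesgue. V x = \<omega>\<^sup>2 * \<epsilon> x"
    and f_eq: "\<And>z. f z = (\<omega>\<^sup>2 * sus (1/2 * (norm z)\<^sup>2)) *\<^sub>R z"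
    and crit: "critical_point k \<Phi> (J_functional k V F) u"
    and E_eq: "E = E_field k \<omega> u"
    and D_eq: "D = D_field k \<omega> \<epsilon> sus u"
    and B_eq: "B = B_field k \<omega> u"
    and H_eq: "H = B"
  shows "\<forall>t a.
    represents (weak_curl (\<lambda>x. A_field k \<omega> u x t)) (dcurl (\<lambda>x. A_field k \<omega> u x t)) \<and>
    energy_density E D B H t \<in> borel_measurable lebesgue \<and>
    (AE x in lebesgue. 0 \<le> energy_density E D B H t x) \<and>
    em_energy E D B H a t < \<infinity>"
proof -
  interpret doubling_N_function \<Phi> by unfold_locales (fact N N1 N2)+
  have uX: "u \<in> X_space k \<Phi>" using crit unfolding critical_point_def by blast
  have uL: "u \<in> L2" and u\<Phi>: "integrable lebesgue (\<lambda>x. \<Phi> (norm (u x)))"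
    using X_space_integrable[OF uX] by blast+
  have ul: "loc_integrable u" by (rule L2_imp_loc_integrable[OF uL])
  have um: "u \<in> borel_measurable lebesgue" and u2: "integrable lebesgue (\<lambda>x. (norm (u x))\<^sup>2)"
    using uL unfolding L2_def by auto
  obtain c where c: "c \<in> L2" "represents c (ring_dcurl k u)" by (rule X_space_ring_curl[OF uX])
  have c2: "integrable lebesgue (\<lambda>x. (norm (c x))\<^sup>2)" using c(1) unfolding L2_def by auto
  obtain c1 where c1: "c1 > 0" "\<And>z. norm (f z) \<le> c1 * (1 + right_deriv \<Phi> (norm z))" using F2 by blast
  obtain K where K: "K \<ge> 0" "\<And>z. f z \<bullet> z \<le> K * ((norm z)\<^sup>2 + \<Phi> (norm z))"
    by (rule nonlinearity_growth[OF F1 c1(2,1)]) blast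
  obtain Cv where Cv0: "0 \<le> Cv" and Cv: "AE x in lebesgue. \<bar>V x\<bar> \<le> Cv"
  proof -
    obtain C where "AE x in lebesgue. \<bar>V x\<bar> \<le> C" using V(1) unfolding L_infty_def by blast
    then have "AE x in lebesgue. \<bar>V x\<bar> \<le> \<bar>C\<bar>" by eventually_elim linarith
    then show thesis by (rule that[rotated]) simp
  qed
  have Vm: "V \<in> borel_measurable lebesgue" using V(1) unfolding L_infty_def by blast

  \<comment> \<open>By (F3) the inner product is at least \<gamma> F(z), and F is
    nonnegative.\<close>
  have f_pos: "0 \<le> f z \<bullet> z" for z
  proof -
    obtain \<gamma> where \<gamma>: "\<gamma> > 2" "\<forall>z. F z \<le> 1 / \<gamma> * (f z \<bullet> z)" using F3 by blast
    have "0 \<le> 1 / \<gamma> * (f z \<bullet> z)" using F0(2)[of z] \<gamma>(2) by (meson order_trans)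
    then show ?thesis using \<gamma>(1) by (simp add: zero_le_divide_iff)
  qed
  have f_inner: "f z \<bullet> z = \<omega>\<^sup>2 * (sus (1/2 * (norm z)\<^sup>2) * (norm z)\<^sup>2)" for z
    using arg_cong[OF f_eq[of z], of "\<lambda>y. y \<bullet> z"] by (simp only: inner_scaleR_left power2_norm_eq_inner mult.assoc)
  \<comment> \<open>At z = 0 the relation \<open>f_eq\<close> says nothing about
    \<open>sus 0\<close>, which may be negative. Where u vanishes the electric field vanishes as
    well, so this value does no harm.\<close>
  have sus_nonneg: "0 \<le> sus (1/2 * (norm z)\<^sup>2)" if "z \<noteq> 0" for z :: R6
  proof -
    have "0 < \<omega>\<^sup>2 * (norm z)\<^sup>2" using that \<omega> by simp
    moreover have "0 \<le> sus (1/2 * (norm z)\<^sup>2) * (\<omega>\<^sup>2 * (norm z)\<^sup>2)"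
      using f_pos[of z] f_inner[of z] by (simp add: mult_ac)
    ultimately show ?thesis by (simp only: zero_le_mult_iff) linarith
  qed

  \<comment> \<open>A majorant living on the plane, with one term each for the linear response, the
    nonlinear response and the magnetic field. The factors \<open>1 / \<omega>\<^sup>2\<close> come
    from solving \<open>V_eq\<close> and \<open>f_eq\<close> for the material coefficients and from
    squaring \<open>1 / \<omega>\<close> in \<open>B_field\<close>.\<close>
  define b where "b y = Cv / \<omega>\<^sup>2 * (norm (u y))\<^sup>2 + 1 / \<omega>\<^sup>2 * (f (u y) \<bullet> u y) + 1 / \<omega>\<^sup>2 * (norm (c y))\<^sup>2" for y
  have fum: "(\<lambda>y. f (u y)) \<in> borel_measurable lebesgue" by (rule borel_measurable_continuous_on[OF F0(4) um])
  have fu: "integrable lebesgue (\<lambda>y. f (u y) \<bullet> u y)"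
  proof (rule Bochner_Integration.integrable_bound)
    show "integrable lebesgue (\<lambda>y. K * ((norm (u y))\<^sup>2 + \<Phi> (norm (u y))))" using u2 u\<Phi> by simp
    show "(\<lambda>y. f (u y) \<bullet> u y) \<in> borel_measurable lebesgue" using fum um by measurable
    show "AE y in lebesgue. norm (f (u y) \<bullet> u y) \<le> norm (K * ((norm (u y))\<^sup>2 + \<Phi> (norm (u y))))"
      using K(2) f_pos by (intro AE_I2) (simp add: abs_of_nonneg order_trans[OF _ abs_ge_self])
  qed
  have b_int: "integrable lebesgue b" unfolding b_def using u2 fu c2 by simp
  have b0: "0 \<le> b y" for y unfolding b_def using Cv0 f_pos by simp

  show ?thesis
  proof (intro allI)
    fix t a
    define A where "A = (\<lambda>x. A_field k \<omega> u x t)"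
    have A: "A = curl_field k (\<omega> * t) u" unfolding A_def A_field_eq ..
    have rep: "represents (curl_field k (\<omega> * t) c) (dcurl A)"
      unfolding A by (rule represents_dcurl_curl_field[OF ul c(2)])
    \<comment> \<open>The explicit representative shows that the choice in \<open>weak_curl\<close>
      succeeds; uniqueness then identifies its value almost everywhere.\<close>
    have repw: "represents (weak_curl A) (dcurl A)"
      unfolding weak_curl_def by (rule someI[of "\<lambda>C. represents C (dcurl A)", OF rep])
    have wae: "AE x in lebesgue. weak_curl A x = curl_field k (\<omega> * t) c x"
      by (rule represents_unique[OF repw rep])
    have Bx: "B x t = - (1 / \<omega>) *\<^sub>R weak_curl A x" for x unfolding B_eq B_field_def A_def ..
    let ?u = "\<lambda>x. u (plane x)" and ?e = "\<lambda>x. norm (E x t)"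
    have e_le: "(?e x)\<^sup>2 \<le> (norm (?u x))\<^sup>2" for x
      using norm_trig_combination_le(1)[of "k * x $ 3 + \<omega> * t" "fst (?u x)" "snd (?u x)"]
      unfolding E_eq E_field_def by simp
    have dens: "energy_density E D B H t x
        = \<epsilon> (plane x) * (?e x)\<^sup>2 + sus (1/2 * (norm (?u x))\<^sup>2) * (?e x)\<^sup>2 + (norm (weak_curl A x) / \<omega>)\<^sup>2" for x
    proof -
      have "B x t \<bullet> H x t = (norm (B x t))\<^sup>2" unfolding H_eq power2_norm_eq_inner ..
      also have "norm (B x t) = norm (weak_curl A x) / \<omega>" unfolding Bx using \<omega> by simp
      finally have "B x t \<bullet> H x t = (norm (weak_curl A x) / \<omega>)\<^sup>2" .
      moreover have "E x t \<bullet> D x t = \<epsilon> (plane x) * (?e x)\<^sup>2 + sus (1/2 * (norm (?u x))\<^sup>2) * (?e x)\<^sup>2"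
        unfolding D_eq D_field_def time_average_E_field[OF \<omega>] E_eq
        by (simp add: inner_add_right power2_norm_eq_inner)
      ultimately show ?thesis unfolding energy_density_def by simp
    qed
    \<comment> \<open>\<open>sus\<close> is an arbitrary function, so the nonlinear term is
      rewritten through the continuous \<open>f\<close> to obtain measurability. Where u vanishes
      both sides are 0 because E does.\<close>
    have nl_eq: "sus (1/2 * (norm (?u x))\<^sup>2) * (?e x)\<^sup>2 = (f (?u x) \<bullet> ?u x) / (\<omega>\<^sup>2 * (norm (?u x))\<^sup>2) * (?e x)\<^sup>2" for x
    proof (cases "?u x = 0")
      case True
      then show ?thesis using e_le[of x] by simp
    next
      case False
      then show ?thesis unfolding f_inner using \<omega> by simp
    qed
    have nl_nonneg: "0 \<le> sus (1/2 * (norm (?u x))\<^sup>2) * (?e x)\<^sup>2" for x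
      unfolding nl_eq using f_pos by simp
    have nl_le: "sus (1/2 * (norm (?u x))\<^sup>2) * (?e x)\<^sup>2 \<le> 1 / \<omega>\<^sup>2 * (f (?u x) \<bullet> ?u x)" for x
    proof (cases "?u x = 0")
      case True
      then show ?thesis using e_le[of x] by simp
    next
      case False
      have "sus (1/2 * (norm (?u x))\<^sup>2) * (?e x)\<^sup>2 \<le> sus (1/2 * (norm (?u x))\<^sup>2) * (norm (?u x))\<^sup>2"
        by (rule mult_left_mono[OF e_le sus_nonneg[OF False]])
      then show ?thesis unfolding f_inner using \<omega> by simp
    qed
    have eps: "AE x in lebesgue. 0 \<le> \<epsilon> (plane x) \<and> \<epsilon> (plane x) \<le> Cv / \<omega>\<^sup>2"
    proof (rule AE_plane_lebesgue)
      show "AE y in lebesgue. 0 \<le> \<epsilon> y \<and> \<epsilon> y \<le> Cv / \<omega>\<^sup>2"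
        using V_eq V(3) Cv
      proof eventually_elim
        case (elim y)
        have "\<epsilon> y = V y / \<omega>\<^sup>2" using elim(1) \<omega> by simp
        then show ?case using elim(2,3) \<omega> by (auto intro!: divide_right_mono)
      qed
    qed

    have "energy_density E D B H t \<in> borel_measurable lebesgue"
    proof -
      have [measurable]: "(\<lambda>x. x $ 3) \<in> borel_measurable (lebesgue :: R3 measure)"
      proof -
        have "(\<lambda>x :: R3. x $ 3) \<in> borel_measurable borel"
          by (intro borel_measurable_continuous_onI continuous_intros)
        then show ?thesis by (intro measurable_completion) simp
      qed
      have upm[measurable]: "(\<lambda>x. ?u x) \<in> borel_measurable lebesgue"
        by (rule measurable_compose[OF plane_lebesgue_measurable um])
      have [measurable]: "(\<lambda>x. f (?u x)) \<in> borel_measurable lebesgue"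
        by (rule measurable_compose[OF plane_lebesgue_measurable fum])
      have [measurable]: "(\<lambda>x. fst (?u x)) \<in> borel_measurable lebesgue" "(\<lambda>x. snd (?u x)) \<in> borel_measurable lebesgue"
        by (rule borel_measurable_continuous_on[OF _ upm], intro continuous_intros)+
      have em[measurable]: "(\<lambda>x. E x t) \<in> borel_measurable lebesgue"
        unfolding E_eq E_field_def by measurable
      have [measurable]: "weak_curl A \<in> borel_measurable lebesgue"
        using repw unfolding represents_def by (intro loc_integrable_measurable) blast
      \<comment> \<open>\<open>\<epsilon>\<close> is prescribed only almost everywhere; it inherits
        measurability from \<open>V\<close> because \<open>lebesgue\<close> is complete.\<close>
      have "AE y in lebesgue. V y / \<omega>\<^sup>2 = \<epsilon> y"
        using V_eq by eventually_elim (use \<omega> in simp)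
      then have "\<epsilon> \<in> borel_measurable lebesgue"
        by (rule borel_measurable_AE[rotated]) (use Vm in measurable)
      then have [measurable]: "(\<lambda>x. \<epsilon> (plane x)) \<in> borel_measurable lebesgue"
        by (rule measurable_compose[OF plane_lebesgue_measurable])
      show ?thesis unfolding dens[abs_def] nl_eq by measurable
    qed
    moreover have "AE x in lebesgue. 0 \<le> energy_density E D B H t x"
      using eps
    proof eventually_elim
      case (elim x)
      then show ?case unfolding dens using nl_nonneg[of x] by simp
    qed
    moreover have "em_energy E D B H a t < \<infinity>"
    proof -
      have "AE x in lebesgue. energy_density E D B H t x \<le> b (plane x)"
        using eps wae
      proof eventually_elim
        case (elim x)
        have "(norm (curl_field k (\<omega> * t) c x))\<^sup>2 \<le> (norm (c (plane x)))\<^sup>2"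
          using norm_trig_combination_le(2)[of "k * x $ 3 + \<omega> * t" "fst (c (plane x))" "snd (c (plane x))"]
          unfolding curl_field_def by simp
        then have "(norm (weak_curl A x) / \<omega>)\<^sup>2 \<le> 1 / \<omega>\<^sup>2 * (norm (c (plane x)))\<^sup>2"
          unfolding elim(2) by (simp add: power_divide divide_right_mono)
        moreover have "\<epsilon> (plane x) * (?e x)\<^sup>2 \<le> Cv / \<omega>\<^sup>2 * (norm (?u x))\<^sup>2"
          using elim(1) e_le[of x] Cv0 by (intro mult_mono) auto
        ultimately show ?case unfolding dens b_def using nl_le[of x] by linarith
      qed
      from nn_integral_slab_finite[OF b_int b0 this, of a]
      moreover have "(1 / 2 :: ennreal) < \<infinity>" using divide_ennreal[of 1 2] ennreal_less_top[of "1/2"] by simp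
      ultimately show ?thesis unfolding em_energy_def by (simp add: ennreal_mult_less_top)
    qed
    ultimately show "represents (weak_curl (\<lambda>x. A_field k \<omega> u x t)) (dcurl (\<lambda>x. A_field k \<omega> u x t)) \<and>
        energy_density E D B H t \<in> borel_measurable lebesgue \<and>
        (AE x in lebesgue. 0 \<le> energy_density E D B H t x) \<and>
        em_energy E D B H a t < \<infinity>"
      using repw unfolding A_def by blast
  qed
qed

end
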